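(* Let $\mathbb F$ be an algebraically closed field of characteristic $p>2$, let $m,n,t\ge1$, let $\lambda\in(\mathbb F^\times)^m$, $\kappa\in(\mathbb F^\times)^n$ satisfy $\lambda_1^{p-1}=\cdots=\lambda_m^{p-1}=\kappa_1^{p-1}=\cdots=\kappa_n^{p-1}$, and let $\mu=(\mu_1,\dots,\mu_{2m+2})\in\mathbb F^{2m+2}$. Let $\mathfrak h=\mathfrak h^{\lambda,\kappa,\mu}_{m,n,t}$ be the restricted twisted Heisenberg Lie superalgebra, with basis $\{e_1,\dots,e_{2m+2}\mid\omega_1,\dots,\omega_{2n},\eta_1,\dots,\eta_t\}$. Then the restricted cohomology space $H^2_*(\mathfrak h)$ (trivial coefficients) is spanned by the classes of the cocycles $$\Big\{(\varphi,\widetilde\varphi)\ \Big|\ \varphi\in\bigcup_{i=1}^4A_i\Big\}\cup\{(0,\overline e^i)\mid 1\le i\le 2m+1\},$$ where $$A_1=\{\delta_{\lambda_i=\pm\lambda_j}(e^{i,j}-\lambda_i\lambda_j^{-1}e^{m+i,m+j}),\ \delta_{\lambda_i=\pm\lambda_j}(e^{i,m+j}+\lambda_i\lambda_j^{-1}e^{j,m+i})\mid 1\le i\le j\le m\},$$ $$A_2=\{\delta_{\lambda_i=\pm\kappa_j}(e^{m+i}\wedge\omega^j-\lambda_i\kappa_j^{-1}e^i\wedge\omega^{n+j}),\ \delta_{\lambda_i=\pm\kappa_j}(e^i\wedge\omega^j-\lambda_i\kappa_j^{-1}e^{m+i}\wedge\omega^{n+j})\mid 1\le i\le m,\ 1\le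 j\le n\},$$ $$A_3=\{\delta_{\kappa_i=\pm\kappa_j}(\omega^{i,j}-\kappa_i\kappa_j^{-1}\omega^{n+i,n+j}),\ \delta_{\kappa_i=\pm\kappa_j}(\omega^{i,n+j}-\kappa_i\kappa_j^{-1}\omega^{j,n+i})\mid 1\le i\le j\le n\},$$ $$A_4=\{\eta^{i,i},\ \eta^{k,l}\mid 1\le i\le t-1,\ 1\le k<l\le t\}.$$ In particular, $\mathrm{sdim}\,H^2_*(\mathfrak h)=(d_0,d_1)$ with $$d_0=2\,\mathrm{Card}\{(i,j)\mid\lambda_i=\pm\lambda_j,\ 1\le i<j\le m\}+2\,\mathrm{Card}\{(i,j)\mid\kappa_i=\pm\kappa_j,\ 1\le i\le j\le n\}+\tfrac{t(t+1)}2+3m,$$ $$d_1=2\,\mathrm{Card}\{(i,j)\mid\lambda_i=\pm\kappa_j,\ 1\le i\le m,\ 1\le j\le n\}.$$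
   Context: The twisted Heisenberg Lie superalgebra $\mathfrak h^{\lambda,\kappa}_{m,n,t}$ is the superspace over $\mathbb F$ of superdimension $(2m+2,2n+t)$ with even basis $e_1,\dots,e_{2m+2}$ and odd basis $\omega_1,\dots,\omega_{2n},\eta_1,\dots,\eta_t$, whose non-vanishing brackets (up to super-skew-symmetry) are $$[e_i,e_{m+i}]=[\omega_j,\omega_j]=-[\omega_{n+j},\omega_{n+j}]=[\eta_k,\eta_k]=e_{2m+1},$$ $$[e_{2m+2},e_i]=\lambda_i e_{m+i},\quad [e_{2m+2},e_{m+i}]=\lambda_i e_i,\quad [e_{2m+2},\omega_j]=\kappa_j\omega_{n+j},\quad [e_{2m+2},\omega_{n+j}]=\kappa_j\omega_j,$$ for $1\le i\le m$, $1\le j\le n$, $1\le k\le t$. Write $|\lambda|$ for the common value of $\lambda_i^{p-1}=\kappa_j^{p-1}$. Then $\mathfrak h^{\lambda,\kappa,\mu}_{m,n,t}$ denotes this Lie superalgebra with the restricted structure (a $[p]$-operator on the even part making it a restricted Lie algebra and the odd part a restricted module) determined by $$e_i^{[p]}=\mu_ie_{2m+1}\ (1\le i\le 2m+1),\qquad e_{2m+2}^{[p]}=|\lambda|e_{2m+2}+\mu_{2m+2}e_{2m+1}.$$ Ordinary cochains of a finite-dimensional Lie superalgebra $\mathfrak g$: $C^0(\mathfrak g)=\mathbb F$, $C^q(\mathfrak g)=\wedge^q\mathfrak g^*$ (super exterior power, viewed as linear forms on $\wedge^q\mathfrak g$), $d^0=0$, $d^1(\psi)(g\wedge h)=\psi([g,h])$,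 $$d^2(\varphi)(g\wedge h\wedge f)=\varphi([g,h]\wedge f)-(-1)^{|f||h|}\varphi([g,f]\wedge h)+(-1)^{|g|(|h|+|f|)}\varphi([h,f]\wedge g).$$ Restricted cochains of a restricted Lie superalgebra $\mathfrak g$. Iterated brackets are left-normed: $[g_1,\dots,g_j]=[[\dots[[g_1,g_2],g_3],\dots],g_j]$. For $\varphi\in C^2(\mathfrak g)$, a map $\omega:\mathfrak g_{\bar0}\to\mathbb F$ is $\varphi$-compatible if for all $g,h\in\mathfrak g_{\bar0}$, $a\in\mathbb F$: $\omega(ag)=a^p\omega(g)$ and $$\omega(g+h)=\omega(g)+\omega(h)+\sum_{g_i\in\{g,h\},\ g_1=g,\ g_2=h}\frac1{\#(g)}\varphi([g_1,g_2,\dots,g_{p-1}]\wedge g_p),$$ where $\#(g)$ is the number of factors $g_i$ equal to $g$ (the sum being over formal choices of $g_3,\dots,g_p$). For $\zeta\in C^3(\mathfrak g)$, a map $\eta:\mathfrak g\times\mathfrak g_{\bar0}\to\mathbb F$ is $\zeta$-compatible if it is linear in the first argument, $\eta(g,ah)=a^p\eta(g,h)$, and $$\eta(g,h_1+h_2)=\eta(g,h_1)+\eta(g,h_2)-\sum_{l_1,\dots,l_p\in\{1,2\},\ l_1=1,\ l_2=2}\frac1{\#\{i: l_i=1\}}\zeta(g\wedge[h_{l_1},\dots,h_{l_{p-1}}]\wedge h_{l_p}).$$ Put $C^1_*(\mathfrak g)=C^1(\mathfrak g)$, $C^2_*(\mathfrak g)=\{(\varphi,\omega)\mid\varphi\in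 C^2(\mathfrak g),\ \omega\ \varphi\text{-compatible}\}$, $C^3_*(\mathfrak g)=\{(\zeta,\eta)\mid\zeta\in C^3(\mathfrak g),\ \eta\ \zeta\text{-compatible}\}$. The differentials are $d^1_*(\psi)=(d^1\psi,\mathrm{ind}^1(\psi))$ with $\mathrm{ind}^1(\psi)(g)=\psi(g^{[p]})$ for $g\in\mathfrak g_{\bar0}$, and $d^2_*(\varphi,\omega)=(d^2\varphi,\mathrm{ind}^2(\varphi,\omega))$ with $$\mathrm{ind}^2(\varphi,\omega)(g,h)=\varphi(g\wedge h^{[p]})-\varphi([g,\underbrace{h,\dots,h}_{p-1}]\wedge h),\quad g\in\mathfrak g,\ h\in\mathfrak g_{\bar0}.$$ $H^2_*(\mathfrak g)=\ker d^2_*/\mathrm{im}\,d^1_*$. The superspace grading: $(\varphi,\omega)$ is even if $\varphi$ is even, and is odd if $\varphi$ is odd and $\omega=0$. Notation: a $\varphi$-compatible map is determined uniquely by arbitrary prescribed values on a basis of $\mathfrak g_{\bar0}$; $\widetilde\varphi$ is the unique $\varphi$-compatible map vanishing on all the even basis vectors $e_1,\dots,e_{2m+2}$. $\overline e^i:\mathfrak g_{\bar0}\to\mathbb F$ is $\overline e^i(\sum_ja_je_j)=a_i^p$. $e^i,\omega^j,\eta^k$ are the dual basis vectors; $e^{i,j}$, $\omega^{i,j}$, $\eta^{k,l}$, $e^i\wedge\omega^j$ denote the dual vectors of $e_i\wedge e_j$, $\omega_i\wedge\omega_j$, $\eta_k\wedge\eta_l$, $e_i\wedge\omega_j$ in $\wedge^2\mathfrak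 g$ (here $e_i\wedge e_j=-e_j\wedge e_i$, so $e^{i,i}=0$, while $\omega_i\wedge\omega_j=\omega_j\wedge\omega_i$ and $\eta_k\wedge\eta_l=\eta_l\wedge\eta_k$). $\delta_P=1$ if the proposition $P$ is true and $0$ otherwise; "$x=\pm y$" means $x=y$ or $x=-y$. $\mathrm{sdim}\,V=(\dim V_{\bar0},\dim V_{\bar1})$. In $\{\dots\mid\dots\}$ for bases, even elements precede the bar and odd ones follow it.
   Formalization: In d_0 the printed term 2 Card{(i,j) | κ_i=±κ_j, i≤j} is replaced by 2 Card{(i,j) | κ_i=±κ_j, i<j} + n: for i=j the second element of A_3 is zero, so the printed d_0 is too large by n (m=n=t=1: at most 5 even classes, printed 6). *)

theory Defs
  imports
    "Jordan_Normal_Form.VS_Connect"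
    "HOL-Library.Function_Algebras"
    "HOL-Library.Product_Plus"
    "HOL-Library.Set_Algebras"
begin

section \<open>Finite-dimensional superalgebras in coordinates\<close>

text \<open>
  A finite-dimensional superspace is given by a homogeneous basis, and its elements are the
  coordinate functions supported in that basis. The field \<open>par\<close> takes the values 0 (even)
  and 1 (odd). Addition of vectors, cochains and pairs of cochains is the pointwise one.
\<close>

record ('i, 'f) superalgebra =
  bas :: "'i set"
  par :: "'i \<Rightarrow> nat"
  brk :: "('i \<Rightarrow> 'f) \<Rightarrow> ('i \<Rightarrow> 'f) \<Rightarrow> ('i \<Rightarrow> 'f)"

definition scl :: "'f::field \<Rightarrow> ('i \<Rightarrow> 'f) \<Rightarrow> ('i \<Rightarrow> 'f)" where
  "scl a x = (\<lambda>b. a * x b)"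

definition unit_vector :: "'i \<Rightarrow> ('i \<Rightarrow> 'f::field)" where
  "unit_vector b = (\<lambda>c. if c = b then 1 else 0)"

definition space :: "('i, 'f::field) superalgebra \<Rightarrow> ('i \<Rightarrow> 'f) set" where
  "space g = {x. \<forall>b. b \<notin> bas g \<longrightarrow> x b = 0}"

definition homog :: "('i, 'f::field) superalgebra \<Rightarrow> nat \<Rightarrow> ('i \<Rightarrow> 'f) set" where
  "homog g i = {x \<in> space g. \<forall>b. x b \<noteq> 0 \<longrightarrow> par g b = i}"

abbreviation even_part :: "('i, 'f::field) superalgebra \<Rightarrow> ('i \<Rightarrow> 'f) set" where
  "even_part g \<equiv> homog g 0"

definition homog_proj :: "('i, 'f::field) superalgebra \<Rightarrow> nat \<Rightarrow> ('i \<Rightarrow> 'f) \<Rightarrow> ('i \<Rightarrow> 'f)" where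
  "homog_proj g i x = (\<lambda>b. if par g b = i then x b else 0)"

text \<open>The left-normed bracket $[[\dots[g_1,g_2],\dots],g_j]$ of a nonempty list.\<close>

definition lnbrk :: "('i, 'f::field) superalgebra \<Rightarrow> ('i \<Rightarrow> 'f) list \<Rightarrow> ('i \<Rightarrow> 'f)" where
  "lnbrk g xs = foldl (brk g) (hd xs) (tl xs)"

text \<open>
  The formal choices $g_1,\dots,g_p \in \{x,y\}$ with $g_1 = x$ and $g_2 = y$: the list has
  the entry \<open>True\<close> where $x$ is chosen and \<open>False\<close> where $y$ is chosen, so that the choices
  stay distinct when $x = y$. \<open>count_list c True\<close> is the number of factors equal to $x$.
\<close>

definition choices :: "nat \<Rightarrow> bool list set" where
  "choices p = {c. length c = p \<and> c ! 0 = True \<and> c ! 1 = False}"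

definition letters :: "'v \<Rightarrow> 'v \<Rightarrow> bool list \<Rightarrow> 'v list" where
  "letters x y c = map (\<lambda>b. if b then x else y) c"

text \<open>
  A restricted structure: the even part is a restricted Lie algebra and the odd part a
  restricted module over it. In Jacobson's formula
  $(x+y)^{[p]} = x^{[p]} + y^{[p]} + \sum_i s_i(x,y)$, where $i\,s_i(x,y)$ is the coefficient of
  $T^{i-1}$ in $\mathrm{ad}(Tx+y)^{p-1}(x)$, the sum of the $s_i$ is written with left-normed
  brackets. The sign $(-1)^{p-1}$ between the two forms is 1, for $p = 2$ as well.
\<close>

definition restricted_structure ::
    "('i, 'f::field) superalgebra \<Rightarrow> (('i \<Rightarrow> 'f) \<Rightarrow> ('i \<Rightarrow> 'f)) \<Rightarrow> bool" where
  "restricted_structure g P \<longleftrightarrow>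
     (\<forall>x\<in>even_part g. P x \<in> even_part g) \<and>
     (\<forall>a. \<forall>x\<in>even_part g. P (scl a x) = scl (a ^ CHAR('f)) (P x)) \<and>
     (\<forall>x\<in>even_part g. \<forall>y\<in>even_part g.
        P (x + y) = P x + P y +
          (\<Sum>c\<in>choices CHAR('f).
             scl (1 / of_nat (count_list c True)) (lnbrk g (letters x y c)))) \<and>
     (\<forall>x\<in>even_part g. \<forall>y\<in>space g. brk g (P x) y = (brk g x ^^ CHAR('f)) y)"


section \<open>Ordinary and restricted cochains with trivial coefficients\<close>

text \<open>
  A linear form on the $q$-th super exterior power is a super-skew-symmetric $q$-linear form.
  All cochains are extended by 0 outside their domain, so that equal cochains are equal as
  functions.
\<close>

definition linear_form :: "('i, 'f::field) superalgebra \<Rightarrow> (('i \<Rightarrow> 'f) \<Rightarrow> 'f) \<Rightarrow> bool" where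
  "linear_form g f \<longleftrightarrow>
     (\<forall>x\<in>space g. \<forall>y\<in>space g. f (x + y) = f x + f y) \<and>
     (\<forall>a. \<forall>x\<in>space g. f (scl a x) = a * f x)"

definition C1 :: "('i, 'f::field) superalgebra \<Rightarrow> (('i \<Rightarrow> 'f) \<Rightarrow> 'f) set" where
  "C1 g = {\<psi>. linear_form g \<psi> \<and> (\<forall>x. x \<notin> space g \<longrightarrow> \<psi> x = 0)}"

definition C2 ::
    "('i, 'f::field) superalgebra \<Rightarrow> (('i \<Rightarrow> 'f) \<Rightarrow> ('i \<Rightarrow> 'f) \<Rightarrow> 'f) set" where
  "C2 g = {\<phi>.
     (\<forall>x\<in>space g. linear_form g (\<lambda>y. \<phi> x y)) \<and>
     (\<forall>y\<in>space g. linear_form g (\<lambda>x. \<phi> x y)) \<and>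
     (\<forall>i\<in>{0,1}. \<forall>j\<in>{0,1}. \<forall>x\<in>homog g i. \<forall>y\<in>homog g j.
        \<phi> x y = - ((-1) ^ (i * j) * \<phi> y x)) \<and>
     (\<forall>x y. x \<notin> space g \<or> y \<notin> space g \<longrightarrow> \<phi> x y = 0)}"

definition d1 ::
    "('i, 'f::field) superalgebra \<Rightarrow> (('i \<Rightarrow> 'f) \<Rightarrow> 'f) \<Rightarrow>
     ('i \<Rightarrow> 'f) \<Rightarrow> ('i \<Rightarrow> 'f) \<Rightarrow> 'f" where
  "d1 g \<psi> = (\<lambda>x y. if x \<in> space g \<and> y \<in> space g then \<psi> (brk g x y) else 0)"

text \<open>The formula for homogeneous arguments, extended trilinearly.\<close>

definition d2 ::
    "('i, 'f::field) superalgebra \<Rightarrow> (('i \<Rightarrow> 'f) \<Rightarrow> ('i \<Rightarrow> 'f) \<Rightarrow> 'f) \<Rightarrow>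
     ('i \<Rightarrow> 'f) \<Rightarrow> ('i \<Rightarrow> 'f) \<Rightarrow> ('i \<Rightarrow> 'f) \<Rightarrow> 'f" where
  "d2 g \<phi> = (\<lambda>x y z. if x \<in> space g \<and> y \<in> space g \<and> z \<in> space g
     then \<Sum>i\<le>1. \<Sum>j\<le>1. \<Sum>k\<le>1.
       (let u = homog_proj g i x; v = homog_proj g j y; w = homog_proj g k z in
          \<phi> (brk g u v) w
          - (-1) ^ (k * j) * \<phi> (brk g u w) v
          + (-1) ^ (i * (j + k)) * \<phi> (brk g v w) u)
     else 0)"

definition compatible ::
    "('i, 'f::field) superalgebra \<Rightarrow> (('i \<Rightarrow> 'f) \<Rightarrow> ('i \<Rightarrow> 'f) \<Rightarrow> 'f) \<Rightarrow>
     (('i \<Rightarrow> 'f) \<Rightarrow> 'f) \<Rightarrow> bool" where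
  "compatible g \<phi> \<omega> \<longleftrightarrow>
     (\<forall>a. \<forall>x\<in>even_part g. \<omega> (scl a x) = a ^ CHAR('f) * \<omega> x) \<and>
     (\<forall>x\<in>even_part g. \<forall>y\<in>even_part g.
        \<omega> (x + y) = \<omega> x + \<omega> y +
          (\<Sum>c\<in>choices CHAR('f).
             1 / of_nat (count_list c True) *
             \<phi> (lnbrk g (butlast (letters x y c))) (last (letters x y c)))) \<and>
     (\<forall>x. x \<notin> even_part g \<longrightarrow> \<omega> x = 0)"

type_synonym ('i, 'f) restricted_2_cochain =
  "(('i \<Rightarrow> 'f) \<Rightarrow> ('i \<Rightarrow> 'f) \<Rightarrow> 'f) \<times> (('i \<Rightarrow> 'f) \<Rightarrow> 'f)"

definition C2_res ::
    "('i, 'f::field) superalgebra \<Rightarrow> ('i, 'f) restricted_2_cochain set" where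
  "C2_res g = {(\<phi>, \<omega>). \<phi> \<in> C2 g \<and> compatible g \<phi> \<omega>}"

definition ind1 ::
    "('i, 'f::field) superalgebra \<Rightarrow> (('i \<Rightarrow> 'f) \<Rightarrow> ('i \<Rightarrow> 'f)) \<Rightarrow>
     (('i \<Rightarrow> 'f) \<Rightarrow> 'f) \<Rightarrow> ('i \<Rightarrow> 'f) \<Rightarrow> 'f" where
  "ind1 g P \<psi> = (\<lambda>x. if x \<in> even_part g then \<psi> (P x) else 0)"

definition ind2 ::
    "('i, 'f::field) superalgebra \<Rightarrow> (('i \<Rightarrow> 'f) \<Rightarrow> ('i \<Rightarrow> 'f)) \<Rightarrow>
     ('i, 'f) restricted_2_cochain \<Rightarrow> ('i \<Rightarrow> 'f) \<Rightarrow> ('i \<Rightarrow> 'f) \<Rightarrow> 'f" where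
  "ind2 g P = (\<lambda>(\<phi>, \<omega>) x h. if x \<in> space g \<and> h \<in> even_part g
     then \<phi> x (P h) - \<phi> (lnbrk g (x # replicate (CHAR('f) - 1) h)) h else 0)"

definition d1_res ::
    "('i, 'f::field) superalgebra \<Rightarrow> (('i \<Rightarrow> 'f) \<Rightarrow> ('i \<Rightarrow> 'f)) \<Rightarrow>
     (('i \<Rightarrow> 'f) \<Rightarrow> 'f) \<Rightarrow> ('i, 'f) restricted_2_cochain" where
  "d1_res g P \<psi> = (d1 g \<psi>, ind1 g P \<psi>)"

definition d2_res ::
    "('i, 'f::field) superalgebra \<Rightarrow> (('i \<Rightarrow> 'f) \<Rightarrow> ('i \<Rightarrow> 'f)) \<Rightarrow>
     ('i, 'f) restricted_2_cochain \<Rightarrow>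
     (('i \<Rightarrow> 'f) \<Rightarrow> ('i \<Rightarrow> 'f) \<Rightarrow> ('i \<Rightarrow> 'f) \<Rightarrow> 'f) \<times> (('i \<Rightarrow> 'f) \<Rightarrow> ('i \<Rightarrow> 'f) \<Rightarrow> 'f)" where
  "d2_res g P c = (d2 g (fst c), ind2 g P c)"

definition Z2_res ::
    "('i, 'f::field) superalgebra \<Rightarrow> (('i \<Rightarrow> 'f) \<Rightarrow> ('i \<Rightarrow> 'f)) \<Rightarrow>
     ('i, 'f) restricted_2_cochain set" where
  "Z2_res g P = {c \<in> C2_res g. d2_res g P c = 0}"

definition B2_res ::
    "('i, 'f::field) superalgebra \<Rightarrow> (('i \<Rightarrow> 'f) \<Rightarrow> ('i \<Rightarrow> 'f)) \<Rightarrow>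
     ('i, 'f) restricted_2_cochain set" where
  "B2_res g P = d1_res g P ` C1 g"

definition even_cochains ::
    "('i, 'f::field) superalgebra \<Rightarrow> ('i, 'f) restricted_2_cochain set" where
  "even_cochains g = {(\<phi>, \<omega>) \<in> C2_res g.
     \<forall>i\<in>{0,1}. \<forall>j\<in>{0,1}. i \<noteq> j \<longrightarrow> (\<forall>x\<in>homog g i. \<forall>y\<in>homog g j. \<phi> x y = 0)}"

definition odd_cochains ::
    "('i, 'f::field) superalgebra \<Rightarrow> ('i, 'f) restricted_2_cochain set" where
  "odd_cochains g = {(\<phi>, \<omega>) \<in> C2_res g. \<omega> = 0 \<and>
     (\<forall>i\<in>{0,1}. \<forall>x\<in>homog g i. \<forall>y\<in>homog g i. \<phi> x y = 0)}"


section \<open>The restricted cohomology space\<close>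

definition scl_res ::
    "'f::field \<Rightarrow> ('i, 'f) restricted_2_cochain \<Rightarrow> ('i, 'f) restricted_2_cochain" where
  "scl_res a = (\<lambda>(\<phi>, \<omega>). (\<lambda>x y. a * \<phi> x y, \<lambda>x. a * \<omega> x))"

text \<open>
  The image of $Z$ in the quotient by $B$, as a space of cosets over \<open>class_ring\<close>. The fields
  \<open>mult\<close> and \<open>one\<close> of the record have no meaning for a module. Adding \<open>B\<close> in the scalar
  multiplication matters only for the scalar 0.
\<close>

definition quotient_space ::
    "('i, 'f::field) restricted_2_cochain set \<Rightarrow> ('i, 'f) restricted_2_cochain set \<Rightarrow>
     ('f, ('i, 'f) restricted_2_cochain set) module" where
  "quotient_space Z B =
     \<lparr>carrier = (\<lambda>c. c +o B) ` Z, mult = undefined, one = undefined,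
      zero = B, add = (\<lambda>X Y. X + Y), smult = (\<lambda>a X. scl_res a ` X + B)\<rparr>"

definition H2_res ::
    "('i, 'f::field) superalgebra \<Rightarrow> (('i \<Rightarrow> 'f) \<Rightarrow> ('i \<Rightarrow> 'f)) \<Rightarrow>
     ('f, ('i, 'f) restricted_2_cochain set) module" where
  "H2_res g P = quotient_space (Z2_res g P) (B2_res g P)"

definition H2_res_even ::
    "('i, 'f::field) superalgebra \<Rightarrow> (('i \<Rightarrow> 'f) \<Rightarrow> ('i \<Rightarrow> 'f)) \<Rightarrow>
     ('f, ('i, 'f) restricted_2_cochain set) module" where
  "H2_res_even g P = quotient_space (Z2_res g P \<inter> even_cochains g) (B2_res g P)"

definition H2_res_odd ::
    "('i, 'f::field) superalgebra \<Rightarrow> (('i \<Rightarrow> 'f) \<Rightarrow> ('i \<Rightarrow> 'f)) \<Rightarrow>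
     ('f, ('i, 'f) restricted_2_cochain set) module" where
  "H2_res_odd g P = quotient_space (Z2_res g P \<inter> odd_cochains g) (B2_res g P)"

definition H2_class ::
    "('i, 'f::field) superalgebra \<Rightarrow> (('i \<Rightarrow> 'f) \<Rightarrow> ('i \<Rightarrow> 'f)) \<Rightarrow>
     ('i, 'f) restricted_2_cochain \<Rightarrow> ('i, 'f) restricted_2_cochain set" where
  "H2_class g P c = c +o B2_res g P"

definition sdim_H2_res ::
    "('i, 'f::field) superalgebra \<Rightarrow> (('i \<Rightarrow> 'f) \<Rightarrow> ('i \<Rightarrow> 'f)) \<Rightarrow> nat \<times> nat" where
  "sdim_H2_res g P =
     (vectorspace.dim class_ring (H2_res_even g P), vectorspace.dim class_ring (H2_res_odd g P))"


section \<open>The twisted Heisenberg Lie superalgebra\<close>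

text \<open>\<open>E i\<close>, \<open>W j\<close>, \<open>Y k\<close> index the basis vectors $e_i$, $\omega_j$, $\eta_k$; indices start at 1.\<close>

datatype hindex = E nat | W nat | Y nat

definition hbas :: "nat \<Rightarrow> nat \<Rightarrow> nat \<Rightarrow> hindex set" where
  "hbas m n t = E ` {1..2*m+2} \<union> W ` {1..2*n} \<union> Y ` {1..t}"

fun hpar :: "hindex \<Rightarrow> nat" where
  "hpar (E i) = 0"
| "hpar (W j) = 1"
| "hpar (Y k) = 1"

text \<open>The brackets of basis vectors exactly as listed, each in one order only.\<close>

fun hlisted :: "nat \<Rightarrow> nat \<Rightarrow> nat \<Rightarrow> (nat \<Rightarrow> 'f) \<Rightarrow> (nat \<Rightarrow> 'f) \<Rightarrow>
    hindex \<Rightarrow> hindex \<Rightarrow> (hindex \<Rightarrow> 'f::field)" where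
  "hlisted m n t lam kap (E i) (E j) =
     (if i \<in> {1..m} \<and> j = m + i then unit_vector (E (2*m+1))
      else if i = 2*m+2 \<and> j \<in> {1..m} then scl (lam j) (unit_vector (E (m + j)))
      else if i = 2*m+2 \<and> j \<in> {m+1..2*m} then scl (lam (j - m)) (unit_vector (E (j - m)))
      else 0)"
| "hlisted m n t lam kap (E i) (W j) =
     (if i = 2*m+2 \<and> j \<in> {1..n} then scl (kap j) (unit_vector (W (n + j)))
      else if i = 2*m+2 \<and> j \<in> {n+1..2*n} then scl (kap (j - n)) (unit_vector (W (j - n)))
      else 0)"
| "hlisted m n t lam kap (W i) (W j) =
     (if i = j \<and> i \<in> {1..n} then unit_vector (E (2*m+1))
      else if i = j \<and> i \<in> {n+1..2*n} then - unit_vector (E (2*m+1))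
      else 0)"
| "hlisted m n t lam kap (Y i) (Y j) =
     (if i = j \<and> i \<in> {1..t} then unit_vector (E (2*m+1)) else 0)"
| "hlisted m n t lam kap _ _ = 0"

definition hbrk_basis :: "nat \<Rightarrow> nat \<Rightarrow> nat \<Rightarrow> (nat \<Rightarrow> 'f) \<Rightarrow> (nat \<Rightarrow> 'f) \<Rightarrow>
    hindex \<Rightarrow> hindex \<Rightarrow> (hindex \<Rightarrow> 'f::field)" where
  "hbrk_basis m n t lam kap b c =
     (if b = c then hlisted m n t lam kap b b
      else hlisted m n t lam kap b c
           - scl ((-1) ^ (hpar b * hpar c)) (hlisted m n t lam kap c b))"

definition heis :: "nat \<Rightarrow> nat \<Rightarrow> nat \<Rightarrow> (nat \<Rightarrow> 'f) \<Rightarrow> (nat \<Rightarrow> 'f) \<Rightarrow>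
    (hindex, 'f::field) superalgebra" where
  "heis m n t lam kap =
     \<lparr>bas = hbas m n t, par = hpar,
      brk = (\<lambda>x y. \<Sum>b\<in>hbas m n t. \<Sum>c\<in>hbas m n t.
               scl (x b * y c) (hbrk_basis m n t lam kap b c))\<rparr>"

text \<open>
  The restricted structure with the prescribed values on the even basis vectors; \<open>l\<close> stands
  for $|\lambda|$. There is exactly one such \<open>P\<close> on the even part, by Jacobson's theorem.
\<close>

definition heis_restricted :: "nat \<Rightarrow> nat \<Rightarrow> nat \<Rightarrow> (nat \<Rightarrow> 'f) \<Rightarrow> (nat \<Rightarrow> 'f) \<Rightarrow> (nat \<Rightarrow> 'f) \<Rightarrow>
    'f \<Rightarrow> ((hindex \<Rightarrow> 'f) \<Rightarrow> (hindex \<Rightarrow> 'f::field)) \<Rightarrow> bool" where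
  "heis_restricted m n t lam kap mu l P \<longleftrightarrow>
     restricted_structure (heis m n t lam kap) P \<and>
     (\<forall>i\<in>{1..2*m+1}. P (unit_vector (E i)) = scl (mu i) (unit_vector (E (2*m+1)))) \<and>
     P (unit_vector (E (2*m+2))) =
       scl l (unit_vector (E (2*m+2))) + scl (mu (2*m+2)) (unit_vector (E (2*m+1)))"


section \<open>The cocycles\<close>

text \<open>
  The form dual to the basis vector $b \wedge c$ of the second super exterior power, evaluated
  on $x \wedge y$. It is 0 if $b = c$ is even.
\<close>

definition dual_wedge :: "('i, 'f::field) superalgebra \<Rightarrow> 'i \<Rightarrow> 'i \<Rightarrow>
    ('i \<Rightarrow> 'f) \<Rightarrow> ('i \<Rightarrow> 'f) \<Rightarrow> 'f" where
  "dual_wedge g b c = (\<lambda>x y. if x \<in> space g \<and> y \<in> space g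
     then (if b = c then (if par g b = 1 then x b * y b else 0)
           else x b * y c - (-1) ^ (par g b * par g c) * (x c * y b))
     else 0)"

definition scl_form :: "'f::field \<Rightarrow> ('v \<Rightarrow> 'v \<Rightarrow> 'f) \<Rightarrow> ('v \<Rightarrow> 'v \<Rightarrow> 'f)" where
  "scl_form a \<phi> = (\<lambda>x y. a * \<phi> x y)"

definition eq_pm :: "'f::field \<Rightarrow> 'f \<Rightarrow> bool" where
  "eq_pm x y \<longleftrightarrow> x = y \<or> x = - y"

definition heis_tilde :: "nat \<Rightarrow> (hindex, 'f::field) superalgebra \<Rightarrow>
    ((hindex \<Rightarrow> 'f) \<Rightarrow> (hindex \<Rightarrow> 'f) \<Rightarrow> 'f) \<Rightarrow> (hindex \<Rightarrow> 'f) \<Rightarrow> 'f" where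
  "heis_tilde m g \<phi> =
     (THE \<omega>. compatible g \<phi> \<omega> \<and> (\<forall>i\<in>{1..2*m+2}. \<omega> (unit_vector (E i)) = 0))"

definition ebar :: "(hindex, 'f::field) superalgebra \<Rightarrow> nat \<Rightarrow> (hindex \<Rightarrow> 'f) \<Rightarrow> 'f" where
  "ebar g i = (\<lambda>x. if x \<in> even_part g then x (E i) ^ CHAR('f) else 0)"

definition A1 :: "nat \<Rightarrow> (hindex, 'f::field) superalgebra \<Rightarrow> (nat \<Rightarrow> 'f) \<Rightarrow>
    ((hindex \<Rightarrow> 'f) \<Rightarrow> (hindex \<Rightarrow> 'f) \<Rightarrow> 'f) set" where
  "A1 m g lam =
     {scl_form (of_bool (eq_pm (lam i) (lam j)))
        (dual_wedge g (E i) (E j)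
         - scl_form (lam i * inverse (lam j)) (dual_wedge g (E (m+i)) (E (m+j))))
      | i j. 1 \<le> i \<and> i \<le> j \<and> j \<le> m} \<union>
     {scl_form (of_bool (eq_pm (lam i) (lam j)))
        (dual_wedge g (E i) (E (m+j))
         + scl_form (lam i * inverse (lam j)) (dual_wedge g (E j) (E (m+i))))
      | i j. 1 \<le> i \<and> i \<le> j \<and> j \<le> m}"

definition A2 :: "nat \<Rightarrow> nat \<Rightarrow> (hindex, 'f::field) superalgebra \<Rightarrow> (nat \<Rightarrow> 'f) \<Rightarrow>
    (nat \<Rightarrow> 'f) \<Rightarrow> ((hindex \<Rightarrow> 'f) \<Rightarrow> (hindex \<Rightarrow> 'f) \<Rightarrow> 'f) set" where
  "A2 m n g lam kap =
     {scl_form (of_bool (eq_pm (lam i) (kap j)))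
        (dual_wedge g (E (m+i)) (W j)
         - scl_form (lam i * inverse (kap j)) (dual_wedge g (E i) (W (n+j))))
      | i j. 1 \<le> i \<and> i \<le> m \<and> 1 \<le> j \<and> j \<le> n} \<union>
     {scl_form (of_bool (eq_pm (lam i) (kap j)))
        (dual_wedge g (E i) (W j)
         - scl_form (lam i * inverse (kap j)) (dual_wedge g (E (m+i)) (W (n+j))))
      | i j. 1 \<le> i \<and> i \<le> m \<and> 1 \<le> j \<and> j \<le> n}"

definition A3 :: "nat \<Rightarrow> (hindex, 'f::field) superalgebra \<Rightarrow> (nat \<Rightarrow> 'f) \<Rightarrow>
    ((hindex \<Rightarrow> 'f) \<Rightarrow> (hindex \<Rightarrow> 'f) \<Rightarrow> 'f) set" where
  "A3 n g kap =
     {scl_form (of_bool (eq_pm (kap i) (kap j)))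
        (dual_wedge g (W i) (W j)
         - scl_form (kap i * inverse (kap j)) (dual_wedge g (W (n+i)) (W (n+j))))
      | i j. 1 \<le> i \<and> i \<le> j \<and> j \<le> n} \<union>
     {scl_form (of_bool (eq_pm (kap i) (kap j)))
        (dual_wedge g (W i) (W (n+j))
         - scl_form (kap i * inverse (kap j)) (dual_wedge g (W j) (W (n+i))))
      | i j. 1 \<le> i \<and> i \<le> j \<and> j \<le> n}"

definition A4 :: "nat \<Rightarrow> (hindex, 'f::field) superalgebra \<Rightarrow>
    ((hindex \<Rightarrow> 'f) \<Rightarrow> (hindex \<Rightarrow> 'f) \<Rightarrow> 'f) set" where
  "A4 t g =
     {dual_wedge g (Y i) (Y i) | i. 1 \<le> i \<and> i \<le> t - 1} \<union>
     {dual_wedge g (Y k) (Y l) | k l. 1 \<le> k \<and> k < l \<and> l \<le> t}"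

definition heis_cocycles :: "nat \<Rightarrow> nat \<Rightarrow> nat \<Rightarrow> (nat \<Rightarrow> 'f) \<Rightarrow> (nat \<Rightarrow> 'f) \<Rightarrow>
    (hindex, 'f::field) restricted_2_cochain set" where
  "heis_cocycles m n t lam kap =
     (let g = heis m n t lam kap in
        {(\<phi>, heis_tilde m g \<phi>) | \<phi>.
           \<phi> \<in> A1 m g lam \<union> A2 m n g lam kap \<union> A3 n g kap \<union> A4 t g} \<union>
        {(0, ebar g i) | i. 1 \<le> i \<and> i \<le> 2*m+1})"

text \<open>
  The even and odd dimensions. For $i = j$ the second family in \<open>A3\<close> is
  $\omega^{i,n+i} - \omega^{i,n+i} = 0$, so each diagonal pair $(i,i)$ contributes one class and
  not two. The term for $\kappa$ is therefore
  $2\,\mathrm{Card}\{(i,j) \mid \kappa_i = \pm\kappa_j,\ i < j\} + n$. The published formula has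
  $2\,\mathrm{Card}\{(i,j) \mid \kappa_i = \pm\kappa_j,\ i \le j\}$ in its place; this is larger
  by exactly $n$ and exceeds the number of nonzero even elements of the spanning set.
\<close>

definition heis_d0 :: "nat \<Rightarrow> nat \<Rightarrow> nat \<Rightarrow> (nat \<Rightarrow> 'f) \<Rightarrow> (nat \<Rightarrow> 'f::field) \<Rightarrow> nat" where
  "heis_d0 m n t lam kap =
     2 * card {(i, j). eq_pm (lam i) (lam j) \<and> 1 \<le> i \<and> i < j \<and> j \<le> m}
     + (2 * card {(i, j). eq_pm (kap i) (kap j) \<and> 1 \<le> i \<and> i < j \<and> j \<le> n} + n)
     + t * (t + 1) div 2 + 3 * m"

definition heis_d1 :: "nat \<Rightarrow> nat \<Rightarrow> (nat \<Rightarrow> 'f) \<Rightarrow> (nat \<Rightarrow> 'f::field) \<Rightarrow> nat" where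
  "heis_d1 m n lam kap =
     2 * card {(i, j). eq_pm (lam i) (kap j) \<and> 1 \<le> i \<and> i \<le> m \<and> 1 \<le> j \<and> j \<le> n}"

end

theory Submission
  imports Defs
begin

text \<open>
  Write \<open>z\<close> and \<open>d\<close> for the last two even basis vectors and \<open>D\<close> for \<open>ad d\<close>. The bracket is
  \<open>[x, y] = B(x, y) z + x\<^sub>d D y - y\<^sub>d D x\<close>. Hence a 2-cochain \<open>\<phi>\<close> is a cocycle if and only if \<open>z\<close> lies in
  its radical and \<open>\<phi>\<close> is \<open>D\<close>-invariant on the span of the basis vectors other than \<open>d\<close>. As
  \<open>D\<^sup>p\<^sup>-\<^sup>1\<close> is the scalar \<open>l\<close> on the \<open>E i\<close> with \<open>i \<le> 2 m\<close> and on the \<open>W j\<close> and kills the \<open>Y k\<close>, the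
  restricted condition adds only \<open>\<phi>(Y k, d) = 0\<close>. A coboundary can be used to make \<open>\<phi>(d, -)\<close> vanish.
  Since \<open>D\<^sup>2\<close> is diagonal, \<open>D\<close>-invariance links only basis vectors whose weights agree up to sign,
  which leaves exactly the listed forms. Explicit coordinates which vanish on coboundaries and are
  dual to the listed cocycles then give both spanning and independence.
\<close>

section \<open>Quotients of spaces of cochains\<close>

text \<open>The map \<open>heis_tilde\<close> is a definite description, so nothing is known about
  it before a compatible map with value 0 on the even basis vectors has been exhibited. For a
  cocycle with \<open>dd\<close> in its radical this can be done by a closed formula. Such a form
  sees an iterated bracket only through powers of \<open>D\<close> and the
  \<open>dd\<close>-coordinates of the letters, so the sum over \<open>choices\<close> collapses to
  binomial sums modulo the characteristic p. The restricted condition is weak for a similar reason.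
  Up to a multiple of \<open>zz\<close>, \<open>P h\<close> is \<open>h\<close> times
  \<open>h dd ^ (p - 1) * l\<close>, and an invariant form gives the bracket of \<open>x\<close>
  with p - 1 copies of \<open>h\<close> the same factor; only the \<open>Y k\<close>, which
  \<open>D\<close> kills, can break the agreement. The coboundary of the form dual to
  \<open>zz\<close> is \<open>BB\<close>, which involves every diagonal dual vector of an odd basis
  vector. It makes one diagonal class redundant, and the pair \<open>(Y t, Y t)\<close> is the one
  given up. Its value, weighted by \<open>BB\<close> and by the \<open>mu i\<close>, therefore
  enters all coordinates.\<close>

definition lin_closed :: "('i, 'f::field) restricted_2_cochain set \<Rightarrow> bool" where
  "lin_closed S \<longleftrightarrow> 0 \<in> S \<and> (\<forall>x\<in>S. \<forall>y\<in>S. x + y \<in> S) \<and> (\<forall>a. \<forall>x\<in>S. scl_res a x \<in> S)"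

lemma scl_res_add: "scl_res a (x + y) = scl_res a x + scl_res a y"
  by (cases x; cases y) (auto simp: scl_res_def fun_eq_iff algebra_simps)

lemma scl_res_add_left: "scl_res (a + b) x = scl_res a x + scl_res b x"
  by (cases x) (auto simp: scl_res_def fun_eq_iff algebra_simps)

lemma scl_res_mult: "scl_res (a * b) x = scl_res a (scl_res b x)"
  by (cases x) (auto simp: scl_res_def fun_eq_iff algebra_simps)

lemma scl_res_one [simp]: "scl_res 1 x = x"
  by (cases x) (auto simp: scl_res_def)

lemma scl_res_zero_left [simp]: "scl_res 0 x = 0"
  by (cases x) (auto simp: scl_res_def fun_eq_iff zero_prod_def)

lemma scl_res_minus_one: "scl_res (- 1) x = - x"
  by (cases x) (auto simp: scl_res_def fun_eq_iff)

lemma lin_closed_zero: "lin_closed S \<Longrightarrow> 0 \<in> S"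
  and lin_closed_add: "lin_closed S \<Longrightarrow> x \<in> S \<Longrightarrow> y \<in> S \<Longrightarrow> x + y \<in> S"
  and lin_closed_scl: "lin_closed S \<Longrightarrow> x \<in> S \<Longrightarrow> scl_res a x \<in> S"
  by (auto simp: lin_closed_def)

lemma lin_closed_minus: "lin_closed S \<Longrightarrow> x \<in> S \<Longrightarrow> - x \<in> S"
  using lin_closed_scl[of S x "- 1"] by (simp add: scl_res_minus_one)

lemma lin_closed_diff: "lin_closed S \<Longrightarrow> x \<in> S \<Longrightarrow> y \<in> S \<Longrightarrow> x - y \<in> S"
  using lin_closed_add[of S x "- y"] lin_closed_minus[of S y] by simp

lemma lin_closed_sum: "lin_closed S \<Longrightarrow> (\<And>i. i \<in> I \<Longrightarrow> f i \<in> S) \<Longrightarrow> sum f I \<in> S"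
  by (induction I rule: infinite_finite_induct) (auto intro: lin_closed_zero lin_closed_add)

lemma lin_closed_Int: "lin_closed S \<Longrightarrow> lin_closed T \<Longrightarrow> lin_closed (S \<inter> T)"
  by (auto simp: lin_closed_def)

lemma coset_eq_iff:
  assumes "lin_closed B"
  shows "c +o B = c' +o B \<longleftrightarrow> c - c' \<in> B"
proof
  assume "c +o B = c' +o B"
  moreover have "c \<in> c +o B"
    using lin_closed_zero[OF assms] by (force simp: elt_set_plus_def)
  ultimately obtain b where "b \<in> B" "c = c' + b"
    by (auto simp: elt_set_plus_def)
  then show "c - c' \<in> B"
    by simp
next
  assume h: "c - c' \<in> B"
  have "c + b = c' + ((c - c') + b)" "c' + b = c + (b - (c - c'))" for b
    by simp_all
  with h show "c +o B = c' +o B"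
    unfolding elt_set_plus_def
    by (blast intro: lin_closed_add[OF assms] lin_closed_diff[OF assms])
qed

lemma coset_add:
  assumes "lin_closed B"
  shows "(c +o B) + (c' +o B) = (c + c') +o B"
proof -
  have "B + B = B"
    using lin_closed_zero[OF assms] lin_closed_add[OF assms]
    by (force simp: set_plus_def)
  then show ?thesis
    by (simp add: set_plus_rearrange)
qed

lemma coset_smult:
  assumes "lin_closed B"
  shows "scl_res a ` (c +o B) + B = scl_res a c +o B"
proof
  show "scl_res a ` (c +o B) + B \<subseteq> scl_res a c +o B"
  proof
    fix x assume "x \<in> scl_res a ` (c +o B) + B"
    then obtain b b' where bb: "b \<in> B" "b' \<in> B" "x = scl_res a (c + b) + b'"
      unfolding set_plus_def elt_set_plus_def by blast
    then have "x = scl_res a c + (scl_res a b + b')"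
      by (simp add: scl_res_add add.assoc)
    then show "x \<in> scl_res a c +o B"
      using bb lin_closed_add[OF assms lin_closed_scl[OF assms]]
      unfolding elt_set_plus_def by blast
  qed
  have "c \<in> c +o B"
    using lin_closed_zero[OF assms] unfolding elt_set_plus_def by force
  then have "scl_res a c \<in> scl_res a ` (c +o B)"
    by blast
  then show "scl_res a c +o B \<subseteq> scl_res a ` (c +o B) + B"
    unfolding set_plus_def elt_set_plus_def by blast
qed

lemma quotient_space_simps:
  "carrier (quotient_space Z B) = (\<lambda>c. c +o B) ` Z"
  "zero (quotient_space Z B) = B"
  "add (quotient_space Z B) X X' = X + X'"
  "smult (quotient_space Z B) a X = scl_res a ` X + B"
  by (simp_all add: quotient_space_def)

lemma coset_carrier: "c \<in> Z \<Longrightarrow> c +o B \<in> carrier (quotient_space Z B)"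
  by (simp add: quotient_space_simps)

text \<open>The space is (Z + B)/B. In this form Z can be the even or the odd cocycles while B
  remains the space of all coboundaries.\<close>

lemma quotient_vectorspace:
  fixes Z B :: "('i, 'f::field) restricted_2_cochain set"
  assumes Z: "lin_closed Z" and B: "lin_closed B"
  shows "vectorspace class_ring (quotient_space Z B)"
proof -
  let ?Q = "quotient_space Z B"
  have z: "0 +o B = B"
    by (auto simp: elt_set_plus_def)
  have ag: "abelian_group ?Q"
  proof (rule abelian_groupI, goal_cases)
    case (1 x y)
    then obtain c c' where "c \<in> Z" "c' \<in> Z" "x = c +o B" "y = c' +o B"
      by (auto simp: quotient_space_simps)
    then show ?case
      using coset_carrier[OF lin_closed_add[OF Z]]
      by (simp add: quotient_space_simps(3) coset_add[OF B])
  next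
    case 2
    then show ?case
      using lin_closed_zero[OF Z] z by (force simp: quotient_space_simps)
  next
    case (6 x)
    then obtain c where c: "c \<in> Z" "x = c +o B"
      by (auto simp: quotient_space_simps)
    then have "(- c) +o B \<in> carrier ?Q" "(- c) +o B + x = B"
      using lin_closed_minus[OF Z] coset_add[OF B, of "- c" c] z
      by (blast intro: coset_carrier lin_closed_minus[OF Z], simp)
    then show ?case
      by (auto simp: quotient_space_simps(2,3))
  next
    case (5 x)
    then obtain c where c: "x = c +o B"
      by (auto simp: quotient_space_simps)
    show ?case
      using coset_add[OF B, of 0 c] c z by (simp add: quotient_space_simps)
  qed (auto simp: quotient_space_simps coset_add[OF B] add_ac)
  have sm: "a \<odot>\<^bsub>?Q\<^esub> (c +o B) = scl_res a c +o B" for a c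
    by (simp add: quotient_space_simps(4) coset_smult[OF B])
  have ad: "(c +o B) \<oplus>\<^bsub>?Q\<^esub> (c' +o B) = (c + c') +o B" for c c'
    by (simp add: quotient_space_simps(3) coset_add[OF B])
  have rep: "\<exists>c\<in>Z. x = c +o B" if "x \<in> carrier ?Q" for x
    using that by (auto simp: quotient_space_simps(1))
  have "module class_ring ?Q"
  proof (rule Module.module.intro[OF class_cring.is_cring ag], unfold_locales, goal_cases)
    case (1 a x)
    then show ?case
      using rep[of x] by (metis sm coset_carrier lin_closed_scl[OF Z])
  next
    case (2 a b x)
    then show ?case
      using rep[of x] by (metis sm ad scl_res_add_left class_ring_simps(3))
  next
    case (3 a x y)
    then show ?case
      using rep[of x] rep[of y] by (metis sm ad scl_res_add)
  next
    case (4 a b x)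
    then show ?case
      using rep[of x] by (metis sm scl_res_mult class_ring_simps(2))
  next
    case (5 x)
    then show ?case
      using rep[of x] by (metis sm scl_res_one class_ring_simps(4))
  qed
  then show ?thesis
    by (intro vectorspace.intro class_field)
qed

text \<open>Coefficients in \<open>lincomb\<close> are attached to classes rather than to indices.
  Injectivity makes every index count exactly once.\<close>

lemma quotient_lincomb:
  fixes Z B :: "('i, 'f::field) restricted_2_cochain set"
  assumes Z: "lin_closed Z" and B: "lin_closed B" and I: "finite I"
    and b: "\<And>i. i \<in> I \<Longrightarrow> b i \<in> Z" and inj: "inj_on (\<lambda>i. b i +o B) I"
  shows "LinearCombinations.module.lincomb (quotient_space Z B) a ((\<lambda>i. b i +o B) ` I)
    = (\<Sum>i\<in>I. scl_res (a (b i +o B)) (b i)) +o B"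
proof -
  let ?Q = "quotient_space Z B"
  interpret vectorspace class_ring ?Q
    by (rule quotient_vectorspace[OF Z B])
  have "lincomb a ((\<lambda>i. b i +o B) ` I) = (\<Oplus>\<^bsub>?Q\<^esub>i\<in>I. a (b i +o B) \<odot>\<^bsub>?Q\<^esub> (b i +o B))"
    unfolding lincomb_def
    by (subst finsum_reindex[OF _ inj])
      (use b in \<open>auto simp: quotient_space_simps(4) coset_smult[OF B]
        intro!: coset_carrier lin_closed_scl[OF Z]\<close>)
  also have "\<dots> = (\<Sum>i\<in>I. scl_res (a (b i +o B)) (b i)) +o B"
    using I b
  proof (induction I)
    case empty
    then show ?case
      by (auto simp: quotient_space_simps elt_set_plus_def)
  next
    case (insert i I)
    then show ?case
      by (subst finsum_insert)
        (auto simp: quotient_space_simps(3,4) coset_smult[OF B] coset_add[OF B]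
          intro!: coset_carrier lin_closed_scl[OF Z])
  qed
  finally show ?thesis .
qed

text \<open>Functionals that vanish on B, are diagonal on the family \<open>b\<close>, and have
  joint kernel on Z inside B force the classes of \<open>b\<close> to be a basis. The diagonal
  values are only asked to be nonzero, since some of the listed cocycles are twice a dual
  vector.\<close>

locale quotient_dual_system =
  fixes Z B :: "('i, 'f::field) restricted_2_cochain set"
    and I :: "'k set" and b :: "'k \<Rightarrow> ('i, 'f) restricted_2_cochain"
    and f :: "'k \<Rightarrow> ('i, 'f) restricted_2_cochain \<Rightarrow> 'f"
  assumes Z: "lin_closed Z" and B: "lin_closed B" and finI: "finite I"
    and bZ: "\<And>i. i \<in> I \<Longrightarrow> b i \<in> Z"
    and f_add: "\<And>i c c'. f i (c + c') = f i c + f i c'"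
    and f_scl: "\<And>i a c. f i (scl_res a c) = a * f i c"
    and f_B: "\<And>i c. i \<in> I \<Longrightarrow> c \<in> B \<Longrightarrow> f i c = 0"
    and f_diag: "\<And>i. i \<in> I \<Longrightarrow> f i (b i) \<noteq> 0"
    and f_off: "\<And>i j. i \<in> I \<Longrightarrow> j \<in> I \<Longrightarrow> i \<noteq> j \<Longrightarrow> f i (b j) = 0"
    and kernel: "\<And>c. c \<in> Z \<Longrightarrow> (\<And>i. i \<in> I \<Longrightarrow> f i c = 0) \<Longrightarrow> c \<in> B"
begin

sublocale vectorspace class_ring "quotient_space Z B"
  by (rule quotient_vectorspace[OF Z B])

lemma f_zero: "f i 0 = 0"
  using f_scl[of i 0 0] by simp

lemma f_sum: "f i (sum g J) = (\<Sum>j\<in>J. f i (g j))"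
  by (induction J rule: infinite_finite_induct) (auto simp: f_add f_zero)

lemma f_comb: "i \<in> I \<Longrightarrow> f i (\<Sum>j\<in>I. scl_res (a j) (b j)) = a i * f i (b i)"
proof -
  assume i: "i \<in> I"
  have "(\<Sum>j\<in>I. a j * f i (b j)) = (\<Sum>j\<in>I. if j = i then a i * f i (b i) else 0)"
    by (intro sum.cong) (auto simp: f_off i)
  then show ?thesis
    using i finI by (simp add: f_sum f_scl)
qed

lemma expand:
  assumes "c \<in> Z"
  shows "c - (\<Sum>i\<in>I. scl_res (f i c / f i (b i)) (b i)) \<in> B"
proof (rule kernel)
  let ?s = "\<Sum>i\<in>I. scl_res (f i c / f i (b i)) (b i)"
  show "c - ?s \<in> Z"
    using assms bZ by (intro lin_closed_diff[OF Z] lin_closed_sum[OF Z] lin_closed_scl[OF Z])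
  fix i assume i: "i \<in> I"
  have "f i c = f i (c - ?s) + f i ?s"
    using f_add[of i "c - ?s" ?s] by simp
  then show "f i (c - ?s) = 0"
    using f_comb[OF i, of "\<lambda>i. f i c / f i (b i)"] f_diag[OF i] by simp
qed

lemma inj_class: "inj_on (\<lambda>i. b i +o B) I"
proof (rule inj_onI, rule ccontr)
  fix i j assume ij: "i \<in> I" "j \<in> I" "b i +o B = b j +o B" "i \<noteq> j"
  then have "b i = b j + (b i - b j)" "f i (b i - b j) = 0"
    by (simp_all add: coset_eq_iff[OF B] f_B)
  then have "f i (b i) = 0"
    using f_off[OF ij(1,2,4)] f_add[of i "b j" "b i - b j"] by simp
  then show False
    using f_diag ij by blast
qed

lemma classes_carrier: "(\<lambda>i. b i +o B) ` I \<subseteq> carrier (quotient_space Z B)"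
  using bZ by (auto simp: quotient_space_simps)

lemma span_classes: "span ((\<lambda>i. b i +o B) ` I) = carrier (quotient_space Z B)"
proof
  show "span ((\<lambda>i. b i +o B) ` I) \<subseteq> carrier (quotient_space Z B)"
    using span_is_subset2[OF classes_carrier] .
  show "carrier (quotient_space Z B) \<subseteq> span ((\<lambda>i. b i +o B) ` I)"
  proof
    fix X assume "X \<in> carrier (quotient_space Z B)"
    then obtain c where c: "c \<in> Z" "X = c +o B"
      by (auto simp: quotient_space_simps)
    \<comment> \<open>Coefficients must be a function of the class, so the index is recovered from
      it by the inverse of the injective class map.\<close>
    define a where "a X = (let i = the_inv_into I (\<lambda>i. b i +o B) X in f i c / f i (b i))" for X
    have a: "i \<in> I \<Longrightarrow> a (b i +o B) = f i c / f i (b i)" for i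
      by (simp add: a_def the_inv_into_f_f[OF inj_class])
    have "X = lincomb a ((\<lambda>i. b i +o B) ` I)"
      using expand[OF c(1)] a
      by (simp add: quotient_lincomb[OF Z B finI bZ inj_class] c(2) coset_eq_iff[OF B])
    then show "X \<in> span ((\<lambda>i. b i +o B) ` I)"
      using finI by (auto simp: span_def)
  qed
qed

lemma indep_classes: "lin_indpt ((\<lambda>i. b i +o B) ` I)"
proof
  assume "lin_dep ((\<lambda>i. b i +o B) ` I)"
  then obtain a X where aX: "lincomb a ((\<lambda>i. b i +o B) ` I) = B" "X \<in> ((\<lambda>i. b i +o B) ` I)" "a X \<noteq> 0"
    using finite_lin_dep[of "(\<lambda>i. b i +o B) ` I"] finI classes_carrier
    by (auto simp: quotient_space_simps)
  then obtain i where i: "i \<in> I" "X = b i +o B"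
    by auto
  let ?s = "\<Sum>i\<in>I. scl_res (a (b i +o B)) (b i)"
  have "?s +o B = 0 +o B"
    using aX(1) by (simp add: quotient_lincomb[OF Z B finI bZ inj_class])
  then have "?s \<in> B"
    by (subst (asm) coset_eq_iff[OF B]) simp
  then have "a (b i +o B) * f i (b i) = 0"
    using f_comb[OF i(1), of "\<lambda>i. a (b i +o B)"] f_B[OF i(1)] by simp
  then show False
    using f_diag i aX by simp
qed

lemma dim_quotient: "dim = card I"
proof -
  have "basis ((\<lambda>i. b i +o B) ` I)"
    using indep_classes span_classes classes_carrier by (simp add: basis_def)
  then have "dim = card ((\<lambda>i. b i +o B) ` I)"
    by (intro dim_basis) (simp_all add: finI)
  then show ?thesis
    by (simp add: card_image[OF inj_class])
qed

end

section \<open>Superalgebras in coordinates\<close>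

lemma scl_simps [simp]:
  "scl 0 x = 0" "scl 1 x = x" "scl a 0 = 0" "scl a (scl b x) = scl (a * b) x"
  "scl a x c = a * x c"
  by (auto simp: scl_def fun_eq_iff)

lemma scl_minus_one: "scl (- 1) x = - x"
  by (auto simp: scl_def)

lemma sum_fun_apply: "(\<Sum>i\<in>I. f i) x = (\<Sum>i\<in>I. f i x)"
  by (induction I rule: infinite_finite_induct) auto

lemma space_zero: "0 \<in> space g"
  and space_add: "x \<in> space g \<Longrightarrow> y \<in> space g \<Longrightarrow> x + y \<in> space g"
  and space_scl: "x \<in> space g \<Longrightarrow> scl a x \<in> space g"
  and space_diff: "x \<in> space g \<Longrightarrow> y \<in> space g \<Longrightarrow> x - y \<in> space g"
  and space_unit: "b \<in> bas g \<Longrightarrow> unit_vector b \<in> space g"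
  by (auto simp: space_def unit_vector_def)

lemma space_sum: "(\<And>i. i \<in> I \<Longrightarrow> f i \<in> space g) \<Longrightarrow> sum f I \<in> space g"
  by (induction I rule: infinite_finite_induct) (auto intro: space_zero space_add)

lemma homog_space: "x \<in> homog g i \<Longrightarrow> x \<in> space g"
  by (simp add: homog_def)

lemma homog_zero: "0 \<in> homog g i"
  and homog_add: "x \<in> homog g i \<Longrightarrow> y \<in> homog g i \<Longrightarrow> x + y \<in> homog g i"
  and homog_scl: "x \<in> homog g i \<Longrightarrow> scl a x \<in> homog g i"
  and homog_unit: "b \<in> bas g \<Longrightarrow> unit_vector b \<in> homog g (par g b)"
proof -
  show "x + y \<in> homog g i" if "x \<in> homog g i" "y \<in> homog g i"
    using that by (force simp: homog_def intro: space_add)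
  show "unit_vector b \<in> homog g (par g b)" if "b \<in> bas g"
    using space_unit[OF that] by (auto simp: homog_def unit_vector_def split: if_splits)
qed (auto simp: homog_def space_zero space_scl)

lemma homog_proj_homog: "x \<in> space g \<Longrightarrow> homog_proj g i x \<in> homog g i"
  by (auto simp: homog_def homog_proj_def space_def split: if_splits)

lemma homog_proj_unit:
  "homog_proj g i (unit_vector b) = (if par g b = i then unit_vector b else 0)"
  by (auto simp: homog_proj_def unit_vector_def fun_eq_iff)

lemma vector_expand:
  assumes "finite (bas g)" "x \<in> space g"
  shows "x = (\<Sum>b\<in>bas g. scl (x b) (unit_vector b))"
proof
  fix c
  have "(\<Sum>b\<in>bas g. x b * unit_vector b c) = (\<Sum>b\<in>bas g. if b = c then x c else 0)"
    by (intro sum.cong) (auto simp: unit_vector_def)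
  then show "x c = (\<Sum>b\<in>bas g. scl (x b) (unit_vector b)) c"
    using assms by (auto simp: sum_fun_apply space_def)
qed

lemma linear_form_add: "linear_form g f \<Longrightarrow> x \<in> space g \<Longrightarrow> y \<in> space g \<Longrightarrow> f (x + y) = f x + f y"
  and linear_form_scl: "linear_form g f \<Longrightarrow> x \<in> space g \<Longrightarrow> f (scl a x) = a * f x"
  by (auto simp: linear_form_def)

lemma linear_form_zero: "linear_form g f \<Longrightarrow> f 0 = 0"
  using linear_form_scl[of g f 0 0] by (simp add: space_zero)

lemma linear_form_diff:
  assumes "linear_form g f" "x \<in> space g" "y \<in> space g"
  shows "f (x - y) = f x - f y"
  using linear_form_add[OF assms(1) space_diff[OF assms(2,3)] assms(3)] by simp

lemma linear_form_sum:
  assumes "linear_form g f" "\<And>i. i \<in> I \<Longrightarrow> h i \<in> space g"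
  shows "f (sum h I) = (\<Sum>i\<in>I. f (h i))"
  using assms(2)
  by (induction I rule: infinite_finite_induct)
    (auto simp: linear_form_zero[OF assms(1)] linear_form_add[OF assms(1)] space_sum)

lemma linear_form_expand:
  assumes "finite (bas g)" "linear_form g f" "x \<in> space g"
  shows "f x = (\<Sum>b\<in>bas g. x b * f (unit_vector b))"
proof -
  have "f x = f (\<Sum>b\<in>bas g. scl (x b) (unit_vector b))"
    using vector_expand[OF assms(1,3)] by simp
  also have "\<dots> = (\<Sum>b\<in>bas g. f (scl (x b) (unit_vector b)))"
    by (rule linear_form_sum[OF assms(2)]) (intro space_scl space_unit)
  finally show ?thesis
    by (simp add: linear_form_scl[OF assms(2)] space_unit)
qed

definition bilinear_form ::
    "('i, 'f::field) superalgebra \<Rightarrow> (('i \<Rightarrow> 'f) \<Rightarrow> ('i \<Rightarrow> 'f) \<Rightarrow> 'f) \<Rightarrow> bool" where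
  "bilinear_form g F \<longleftrightarrow>
     (\<forall>x\<in>space g. linear_form g (F x)) \<and> (\<forall>y\<in>space g. linear_form g (\<lambda>x. F x y))"

lemma bilinear_expand:
  assumes "finite (bas g)" "bilinear_form g F" "x \<in> space g" "y \<in> space g"
  shows "F x y = (\<Sum>b\<in>bas g. \<Sum>c\<in>bas g. x b * y c * F (unit_vector b) (unit_vector c))"
proof -
  have "F x y = (\<Sum>b\<in>bas g. x b * F (unit_vector b) y)"
    using linear_form_expand[OF assms(1), of "\<lambda>x. F x y"] assms by (simp add: bilinear_form_def)
  also have "\<dots> = (\<Sum>b\<in>bas g. x b * (\<Sum>c\<in>bas g. y c * F (unit_vector b) (unit_vector c)))"
    using linear_form_expand[OF assms(1) _ assms(4)] assms
    by (intro sum.cong refl) (simp add: bilinear_form_def space_unit)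
  finally show ?thesis
    by (simp add: sum_distrib_left mult_ac)
qed

text \<open>Only pairs of basis vectors in the supports of \<open>x\<close> and \<open>y\<close>
  have to be compared. For homogeneous arguments this fixes the parities of \<open>b\<close> and
  \<open>c\<close>.\<close>

lemma bilinear_eqI:
  assumes "finite (bas g)" "bilinear_form g F" "bilinear_form g G" "x \<in> space g" "y \<in> space g"
    and "\<And>b c. b \<in> bas g \<Longrightarrow> c \<in> bas g \<Longrightarrow> x b \<noteq> 0 \<Longrightarrow> y c \<noteq> 0 \<Longrightarrow>
      F (unit_vector b) (unit_vector c) = G (unit_vector b) (unit_vector c)"
  shows "F x y = G x y"
  unfolding bilinear_expand[OF assms(1,2,4,5)] bilinear_expand[OF assms(1,3,4,5)]
  using assms(6) by (intro sum.cong refl) auto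

lemma C2_bilinear: "\<phi> \<in> C2 g \<Longrightarrow> bilinear_form g \<phi>"
  by (simp add: C2_def bilinear_form_def)

lemma C2_right: "\<phi> \<in> C2 g \<Longrightarrow> x \<in> space g \<Longrightarrow> linear_form g (\<phi> x)"
  and C2_left: "\<phi> \<in> C2 g \<Longrightarrow> y \<in> space g \<Longrightarrow> linear_form g (\<lambda>x. \<phi> x y)"
  and C2_outside: "\<phi> \<in> C2 g \<Longrightarrow> x \<notin> space g \<or> y \<notin> space g \<Longrightarrow> \<phi> x y = 0"
  by (auto simp: C2_def)

lemma C2_skew:
  assumes "\<phi> \<in> C2 g" "x \<in> homog g i" "y \<in> homog g j" "i \<le> 1" "j \<le> 1"
  shows "\<phi> x y = - ((-1) ^ (i * j) * \<phi> y x)"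
proof -
  have "i \<in> {0, 1}" "j \<in> {0, 1}"
    using assms(4,5) by auto
  then show ?thesis
    using assms(1-3) unfolding C2_def by blast
qed

lemma C2_eqI:
  assumes "finite (bas g)" "\<phi> \<in> C2 g" "\<psi> \<in> C2 g"
    and "\<And>b c. b \<in> bas g \<Longrightarrow> c \<in> bas g \<Longrightarrow>
      \<phi> (unit_vector b) (unit_vector c) = \<psi> (unit_vector b) (unit_vector c)"
  shows "\<phi> = \<psi>"
proof (intro ext)
  fix x y
  show "\<phi> x y = \<psi> x y"
  proof (cases "x \<in> space g \<and> y \<in> space g")
    case True
    then show ?thesis
      using bilinear_eqI[OF assms(1) C2_bilinear[OF assms(2)] C2_bilinear[OF assms(3)]] assms(4)
      by blast
  qed (use assms(2,3) in \<open>auto simp: C2_outside\<close>)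
qed

text \<open>Splitting off the outermost bracket turns the value of a linear form on a left-normed
  bracket into a value of its coboundary, which is the shape found in
  \<open>compatible\<close>.\<close>

lemma lnbrk_snoc:
  assumes "length xs \<ge> 2"
  shows "lnbrk g xs = brk g (lnbrk g (butlast xs)) (last xs)"
proof (cases xs rule: rev_cases)
  case (snoc as a)
  then have "as \<noteq> []"
    using assms by auto
  then show ?thesis
    by (simp add: lnbrk_def snoc)
qed (use assms in simp)

section \<open>The bracket of the twisted Heisenberg superalgebra\<close>

locale twisted_heisenberg =
  fixes m n t :: nat and lam kap :: "nat \<Rightarrow> 'f::field" and l :: 'f
  assumes char_gt_2: "CHAR('f) > 2"
    and t_pos: "t \<ge> 1" and m_pos: "m \<ge> 1"
    and lam_nonzero: "\<And>i. i \<in> {1..m} \<Longrightarrow> lam i \<noteq> 0"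
    and kap_nonzero: "\<And>j. j \<in> {1..n} \<Longrightarrow> kap j \<noteq> 0"
    and lam_power: "\<And>i. i \<in> {1..m} \<Longrightarrow> lam i ^ (CHAR('f) - 1) = l"
    and kap_power: "\<And>j. j \<in> {1..n} \<Longrightarrow> kap j ^ (CHAR('f) - 1) = l"
begin

abbreviation "g \<equiv> heis m n t lam kap"
definition "zz = E (2 * m + 1)"
definition "dd = E (2 * m + 2)"
abbreviation u :: "hindex \<Rightarrow> hindex \<Rightarrow> 'f" where "u \<equiv> unit_vector"

text \<open>
  On the span of the \<open>E i\<close> with \<open>i \<le> 2 m\<close> and of the \<open>W j\<close>, the derivation \<open>ad dd\<close> maps the
  basis vector \<open>b\<close> to \<open>ev b\<close> times the basis vector \<open>sw b\<close>; it kills all other basis vectors.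
\<close>

primrec ev :: "hindex \<Rightarrow> 'f" where
  "ev (E i) = (if 1 \<le> i \<and> i \<le> m then lam i else if m < i \<and> i \<le> 2 * m then lam (i - m) else 0)"
| "ev (W j) = (if 1 \<le> j \<and> j \<le> n then kap j else if n < j \<and> j \<le> 2 * n then kap (j - n) else 0)"
| "ev (Y k) = 0"

primrec sw :: "hindex \<Rightarrow> hindex" where
  "sw (E i) = E (if 1 \<le> i \<and> i \<le> m then m + i else if m < i \<and> i \<le> 2 * m then i - m else i)"
| "sw (W j) = W (if 1 \<le> j \<and> j \<le> n then n + j else if n < j \<and> j \<le> 2 * n then j - n else j)"
| "sw (Y k) = Y k"

text \<open>Since \<open>sw\<close> is an involution preserving \<open>ev\<close>, coordinate
  \<open>b\<close> of the image receives a contribution from coordinate \<open>sw b\<close> alone.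
  The weights vanish outside the basis, so every image lies in the space.\<close>

definition D :: "(hindex \<Rightarrow> 'f) \<Rightarrow> (hindex \<Rightarrow> 'f)" where
  "D x = (\<lambda>b. ev b * x (sw b))"

text \<open>The bracket of \<open>b\<close> and \<open>c\<close> has the component \<open>sg b\<close> along \<open>zz\<close> if \<open>c = pr b\<close>, and 0 otherwise.\<close>

primrec pr :: "hindex \<Rightarrow> hindex" where
  "pr (E i) = sw (E i)"
| "pr (W j) = W j"
| "pr (Y k) = Y k"

primrec sg :: "hindex \<Rightarrow> 'f" where
  "sg (E i) = (if 1 \<le> i \<and> i \<le> m then 1 else if m < i \<and> i \<le> 2 * m then - 1 else 0)"
| "sg (W j) = (if 1 \<le> j \<and> j \<le> n then 1 else if n < j \<and> j \<le> 2 * n then - 1 else 0)"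
| "sg (Y k) = (if 1 \<le> k \<and> k \<le> t then 1 else 0)"

definition BB :: "(hindex \<Rightarrow> 'f) \<Rightarrow> (hindex \<Rightarrow> 'f) \<Rightarrow> 'f" where
  "BB x y = (\<Sum>b\<in>hbas m n t. sg b * x b * y (pr b))"

lemma bas_g [simp]: "bas g = hbas m n t"
  and par_g [simp]: "par g = hpar"
  by (simp_all add: heis_def)

lemma finite_hbas [simp]: "finite (hbas m n t)"
  by (simp add: hbas_def)

lemma hbas_simps [simp]:
  "E i \<in> hbas m n t \<longleftrightarrow> 1 \<le> i \<and> i \<le> 2 * m + 2"
  "W j \<in> hbas m n t \<longleftrightarrow> 1 \<le> j \<and> j \<le> 2 * n"
  "Y k \<in> hbas m n t \<longleftrightarrow> 1 \<le> k \<and> k \<le> t"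
  by (auto simp: hbas_def)

lemma ev_sw [simp]: "ev (sw b) = ev b"
  by (cases b) auto

lemma sw_sw [simp]: "sw (sw b) = b"
  by (cases b) auto

lemma sw_eq_iff [simp]: "sw b = sw c \<longleftrightarrow> b = c"
  by (metis sw_sw)

lemma sw_mem [simp]: "sw b \<in> hbas m n t \<longleftrightarrow> b \<in> hbas m n t"
  by (cases b) auto

lemma pr_mem [simp]: "pr b \<in> hbas m n t \<longleftrightarrow> b \<in> hbas m n t"
  by (cases b) auto

lemma hpar_sw [simp]: "hpar (sw b) = hpar b"
  by (cases b) auto

lemma fixed_simps [simp]:
  "zz \<in> hbas m n t" "dd \<in> hbas m n t" "zz \<noteq> dd" "dd \<noteq> zz"
  "sw zz = zz" "sw dd = dd" "ev zz = 0" "ev dd = 0" "sg zz = 0" "sg dd = 0" "hpar zz = 0" "hpar dd = 0"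
  "pr zz = zz" "pr dd = dd"
  "W j \<noteq> zz" "W j \<noteq> dd" "Y k \<noteq> zz" "Y k \<noteq> dd" "zz \<noteq> W j" "dd \<noteq> W j" "zz \<noteq> Y k" "dd \<noteq> Y k"
  "E i = zz \<longleftrightarrow> i = 2 * m + 1" "E i = dd \<longleftrightarrow> i = 2 * m + 2"
  "zz = E i \<longleftrightarrow> i = 2 * m + 1" "dd = E i \<longleftrightarrow> i = 2 * m + 2"
  by (auto simp: zz_def dd_def)

lemma ev_outside: "b \<notin> hbas m n t \<Longrightarrow> ev b = 0"
  by (cases b) auto

lemma ev_nonzero:
  assumes "b \<in> hbas m n t" "b \<noteq> zz" "b \<noteq> dd" "\<And>k. b \<noteq> Y k"
  shows "ev b \<noteq> 0"
proof (cases b)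
  case (E i)
  then have "i \<le> 2 * m"
    using assms(1-3) by simp
  then have "i \<in> {1..m} \<or> \<not> i \<le> m \<and> i - m \<in> {1..m}"
    using E assms(1) by auto
  then show ?thesis
    using E \<open>i \<le> 2 * m\<close> lam_nonzero[of i] lam_nonzero[of "i - m"] by auto
next
  case (W j)
  then have "j \<in> {1..n} \<or> \<not> j \<le> n \<and> j - n \<in> {1..n}" "j \<le> 2 * n"
    using assms(1) by auto
  then show ?thesis
    using W kap_nonzero[of j] kap_nonzero[of "j - n"] by auto
qed (use assms in auto)

lemma ev_power:
  assumes "ev b \<noteq> 0"
  shows "ev b ^ (CHAR('f) - 1) = l"
proof (cases b)
  case (E i)
  then show ?thesis
    using assms lam_power[of i] lam_power[of "i - m"] by (auto simp: Suc_le_eq split: if_splits)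
next
  case (W i)
  then show ?thesis
    using assms kap_power[of i] kap_power[of "i - n"] by (auto simp: Suc_le_eq split: if_splits)
qed (use assms in auto)

lemma l_nonzero: "l \<noteq> 0"
  using lam_power[of 1] lam_nonzero[of 1] m_pos by auto

lemma two_nonzero: "(2 :: 'f) \<noteq> 0"
  using char_gt_2 of_nat_eq_0_iff_char_dvd[of 2, where ?'a = 'f] by (auto dest: dvd_imp_le)

lemma prime_char: "prime CHAR('f)"
  using char_gt_2 prime_CHAR_semidom[where ?'a = 'f] by simp

lemma odd_char: "odd CHAR('f)"
  using prime_char char_gt_2 by (simp add: prime_odd_nat)

lemma hpar_le: "hpar b \<le> 1"
  by (cases b) auto

lemma D_unit: "D (u b) = scl (ev b) (u (sw b))"
proof
  fix c
  have "c = sw b \<longleftrightarrow> sw c = b"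
    by (metis sw_sw)
  then show "D (u b) c = scl (ev b) (u (sw b)) c"
    by (auto simp: D_def unit_vector_def)
qed

lemma D_add: "D (x + y) = D x + D y"
  and D_diff: "D (x - y) = D x - D y"
  and D_scl: "D (scl a x) = scl a (D x)"
  and D_zero [simp]: "D 0 = 0"
  by (auto simp: D_def fun_eq_iff algebra_simps)

lemma D_fixed [simp]: "D x zz = 0" "D x dd = 0"
  by (simp_all add: D_def)

lemma D_space [simp]: "D x \<in> space g"
  by (auto simp: D_def space_def ev_outside)

lemma D_homog: "x \<in> homog g i \<Longrightarrow> D x \<in> homog g i"
  using D_space by (auto simp: homog_def) (auto simp: D_def)

lemma D2: "D (D x) b = ev b ^ 2 * x b"
  by (simp add: D_def power2_eq_square)

lemma D_pow_even: "(D ^^ (2 * k)) x b = (if k = 0 then x b else ev b ^ (2 * k) * x b)"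
proof (induction k)
  case (Suc k)
  have "(D ^^ (2 * Suc k)) x b = D (D ((D ^^ (2 * k)) x)) b"
    by simp
  also have "\<dots> = ev b ^ 2 * (if k = 0 then x b else ev b ^ (2 * k) * x b)"
    by (simp only: D2 Suc)
  finally show ?case
    by (simp add: power2_eq_square mult_ac)
qed simp

text \<open>The exponent p - 1 is even and positive, so this is a positive power of the diagonal map
  \<open>D\<close> squared, with entries \<open>ev b ^ (p - 1)\<close>. These equal \<open>l\<close>
  whenever the weight is nonzero.\<close>

lemma D_pow_char: "(D ^^ (CHAR('f) - 1)) x b = (if ev b = 0 then 0 else l * x b)"
proof -
  obtain k where k: "CHAR('f) - 1 = 2 * k" "k \<noteq> 0"
    using odd_char char_gt_2 by (auto elim!: oddE)
  then show ?thesis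
    using D_pow_even[of k x b] ev_power[of b] by (simp add: power_0_left)
qed

lemma D_pow_scl: "(D ^^ k) (scl a x) = scl a ((D ^^ k) x)"
  by (induction k) (simp_all only: funpow.simps o_apply id_apply D_scl)

lemma D_pow_diff: "(D ^^ k) (x - y) = (D ^^ k) x - (D ^^ k) y"
  by (induction k) (simp_all only: funpow.simps o_apply id_apply D_diff)

lemma D_pow_add: "(D ^^ k) (x + y) = (D ^^ k) x + (D ^^ k) y"
  by (induction k) (simp_all only: funpow.simps o_apply id_apply D_add)

lemma D_pow_space: "x \<in> space g \<Longrightarrow> (D ^^ k) x \<in> space g"
  by (cases k) simp_all

lemma D_pow_homog: "x \<in> homog g i \<Longrightarrow> (D ^^ k) x \<in> homog g i"
  by (induction k) (simp_all add: D_homog)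

lemma D_pow_zz: "(D ^^ k) (u zz) = (if k = 0 then u zz else 0)"
proof (induction k)
  case (Suc k)
  have "(D ^^ Suc k) (u zz) = D ((D ^^ k) (u zz))"
    by simp
  moreover have "D (u zz) = 0"
    by (simp only: D_unit fixed_simps scl_simps)
  ultimately show ?case
    by (cases "k = 0") (simp_all only: funpow_0 Suc if_True if_False D_zero nat.distinct)
qed simp

lemma space_u [simp]: "b \<in> hbas m n t \<Longrightarrow> u b \<in> space g"
  by (simp add: space_unit)

lemma BB_unit:
  assumes "b \<in> hbas m n t"
  shows "BB (u b) (u c) = (if c = pr b then sg b else 0)"
proof -
  have "BB (u b) (u c) = (\<Sum>a\<in>hbas m n t. if a = b then (if c = pr b then sg b else 0) else 0)"
    unfolding BB_def by (intro sum.cong) (auto simp: unit_vector_def)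
  then show ?thesis
    using assms by simp
qed

lemma hbas_cases [consumes 1, case_names lo hi zz dd W_lo W_hi Y]:
  assumes "b \<in> hbas m n t"
  obtains i where "b = E i" "1 \<le> i" "i \<le> m"
    | i where "b = E (m + i)" "1 \<le> i" "i \<le> m"
    | "b = zz" | "b = dd"
    | j where "b = W j" "1 \<le> j" "j \<le> n"
    | j where "b = W (n + j)" "1 \<le> j" "j \<le> n"
    | k where "b = Y k" "1 \<le> k" "k \<le> t"
proof (cases b)
  case (E i)
  then have "i \<le> m \<or> i = m + (i - m) \<and> 1 \<le> i - m \<and> i - m \<le> m \<or> i = 2 * m + 1 \<or> i = 2 * m + 2"
    using assms by auto
  with E assms that(1-4) show ?thesis
    unfolding zz_def dd_def by (metis hbas_simps(1))
next
  case (W j)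
  then have "j \<le> n \<or> j = n + (j - n) \<and> 1 \<le> j - n \<and> j - n \<le> n"
    using assms by auto
  with W assms that(5,6) show ?thesis
    by (metis hbas_simps(2))
next
  case (Y k)
  with assms that(7) show ?thesis
    by simp
qed

text \<open>A finite check over the kinds of basis vectors. Writing it with the coordinates
  \<open>u b dd\<close> makes the right side the value of a bilinear expression, so that the general
  formula for the bracket follows by expansion.\<close>

lemma hbrk_basis_eq:
  assumes "b \<in> hbas m n t" "c \<in> hbas m n t"
  shows "hbrk_basis m n t lam kap b c =
    scl (BB (u b) (u c)) (u zz) + scl (u b dd) (D (u c)) - scl (u c dd) (D (u b))"
proof -
  have u_dd: "u b dd = (if b = dd then 1 else 0)" "u c dd = (if c = dd then 1 else 0)"
    by (auto simp: unit_vector_def)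
  have "hbrk_basis m n t lam kap b c = scl (if c = pr b then sg b else 0) (u zz)
      + scl (if b = dd then ev c else 0) (u (sw c)) - scl (if c = dd then ev b else 0) (u (sw b))"
    using assms(1)
  proof (cases rule: hbas_cases)
    case (lo i)
    with assms(2) show ?thesis
      by (cases rule: hbas_cases) (auto simp: hbrk_basis_def scl_minus_one zz_def dd_def simp del: fixed_simps)
  next
    case (hi i)
    with assms(2) show ?thesis
      by (cases rule: hbas_cases) (auto simp: hbrk_basis_def scl_minus_one zz_def dd_def simp del: fixed_simps)
  next
    case zz
    with assms(2) show ?thesis
      by (cases rule: hbas_cases) (auto simp: hbrk_basis_def scl_minus_one zz_def dd_def simp del: fixed_simps)
  next
    case dd
    with assms(2) show ?thesis
      by (cases rule: hbas_cases) (auto simp: hbrk_basis_def scl_minus_one zz_def dd_def simp del: fixed_simps)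
  next
    case (W_lo i)
    with assms(2) show ?thesis
      by (cases rule: hbas_cases) (auto simp: hbrk_basis_def scl_minus_one zz_def dd_def simp del: fixed_simps)
  next
    case (W_hi i)
    with assms(2) show ?thesis
      by (cases rule: hbas_cases) (auto simp: hbrk_basis_def scl_minus_one zz_def dd_def simp del: fixed_simps)
  next
    case (Y i)
    with assms(2) show ?thesis
      by (cases rule: hbas_cases) (auto simp: hbrk_basis_def scl_minus_one zz_def dd_def simp del: fixed_simps)
  qed
  then show ?thesis
    using assms by (auto simp: BB_unit D_unit u_dd)
qed

lemma BB_bilinear: "bilinear_form g BB"
  by (auto simp: bilinear_form_def linear_form_def BB_def algebra_simps sum.distrib sum_distrib_left
    intro!: sum.cong)

lemma brk_eq:
  assumes "x \<in> space g" "y \<in> space g"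
  shows "brk g x y = scl (BB x y) (u zz) + scl (x dd) (D y) - scl (y dd) (D x)"
proof
  fix a
  define F where "F x y = (scl (BB x y) (u zz) + scl (x dd) (D y) - scl (y dd) (D x)) a" for x y
  have "bilinear_form g F"
    using BB_bilinear
    by (auto simp: bilinear_form_def linear_form_def F_def D_def algebra_simps)
  then have "F x y = (\<Sum>b\<in>hbas m n t. \<Sum>c\<in>hbas m n t. x b * y c * F (u b) (u c))"
    using bilinear_expand[of g F x y] assms by simp
  also have "\<dots> = (\<Sum>b\<in>hbas m n t. \<Sum>c\<in>hbas m n t. x b * y c * hbrk_basis m n t lam kap b c a)"
    by (intro sum.cong refl) (simp add: hbrk_basis_eq F_def)
  also have "\<dots> = brk g x y a"
    by (simp add: heis_def sum_fun_apply)
  finally show "brk g x y a = (scl (BB x y) (u zz) + scl (x dd) (D y) - scl (y dd) (D x)) a"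
    by (simp add: F_def)
qed

lemma brk_space: "x \<in> space g \<Longrightarrow> y \<in> space g \<Longrightarrow> brk g x y \<in> space g"
  by (simp add: brk_eq space_add space_diff space_scl)

text \<open>The derived algebra has no \<open>dd\<close>-component. After one bracket, each further
  bracket with \<open>h\<close> is \<open>- h dd\<close> times \<open>D\<close> up to a multiple of
  \<open>zz\<close>.\<close>

lemma brk_dd: "x \<in> space g \<Longrightarrow> y \<in> space g \<Longrightarrow> brk g x y dd = 0"
  by (simp add: brk_eq unit_vector_def)

end

section \<open>Restricted cochains\<close>

text \<open>The sums over \<open>choices\<close> cancel in the difference of two maps compatible
  with the same form. The difference is then additive and homogeneous for the p-th power, so it is
  determined by the even basis vectors.\<close>

lemma compatible_unique:
  fixes g :: "('i, 'f::field) superalgebra"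
  assumes fin: "finite (bas g)" and char: "CHAR('f) > 0"
    and c: "compatible g \<phi> \<omega>" "compatible g \<phi> \<omega>'"
    and eq: "\<And>b. b \<in> bas g \<Longrightarrow> par g b = 0 \<Longrightarrow> \<omega> (unit_vector b) = \<omega>' (unit_vector b)"
  shows "\<omega> = \<omega>'"
proof
  fix x
  define \<delta> where "\<delta> y = \<omega> y - \<omega>' y" for y
  have add: "\<delta> (y + z) = \<delta> y + \<delta> z" if "y \<in> even_part g" "z \<in> even_part g" for y z
    using c that by (simp add: compatible_def \<delta>_def)
  have scl: "\<delta> (scl a y) = a ^ CHAR('f) * \<delta> y" if "y \<in> even_part g" for a y
    using c that by (simp add: compatible_def \<delta>_def right_diff_distrib)
  have zero: "\<delta> 0 = 0"
    using scl[OF homog_zero, of 0] char by (simp add: power_0_left)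
  show "\<omega> x = \<omega>' x"
  proof (cases "x \<in> even_part g")
    case True
    have unit: "scl (x b) (unit_vector b) \<in> even_part g \<and> \<delta> (scl (x b) (unit_vector b)) = 0"
      if "b \<in> bas g" for b
    proof (cases "par g b = 0")
      case True
      then have "unit_vector b \<in> even_part g"
        using homog_unit[OF that] by simp
      moreover have "\<delta> (unit_vector b) = 0"
        using eq[OF that True] by (simp add: \<delta>_def)
      ultimately show ?thesis
        by (metis homog_scl scl mult_zero_right)
    next
      case False
      then have "x b = 0"
        using \<open>x \<in> even_part g\<close> by (auto simp: homog_def)
      then show ?thesis
        by (metis scl_simps(1) zero homog_zero)
    qed
    have "S \<subseteq> bas g \<longrightarrow> (\<Sum>b\<in>S. scl (x b) (unit_vector b)) \<in> even_part g \<and>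
        \<delta> (\<Sum>b\<in>S. scl (x b) (unit_vector b)) = 0" if "finite S" for S
      using that
    proof (induction S)
      case empty
      then show ?case
        by (simp only: sum.empty zero homog_zero simp_thms)
    next
      case (insert b S)
      show ?case
      proof
        assume "insert b S \<subseteq> bas g"
        then have IH: "(\<Sum>b\<in>S. scl (x b) (unit_vector b)) \<in> even_part g"
          "\<delta> (\<Sum>b\<in>S. scl (x b) (unit_vector b)) = 0" and b: "b \<in> bas g"
          using insert.IH by blast+
        show "(\<Sum>b\<in>insert b S. scl (x b) (unit_vector b)) \<in> even_part g \<and>
            \<delta> (\<Sum>b\<in>insert b S. scl (x b) (unit_vector b)) = 0"
          unfolding sum.insert[OF insert.hyps]
          using add[OF conjunct1[OF unit[OF b]] IH(1)] homog_add[OF conjunct1[OF unit[OF b]] IH(1)]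
            unit[OF b] IH(2) by (simp only: add_0 simp_thms)
      qed
    qed
    from this[OF fin] have "\<delta> x = 0"
      using vector_expand[OF fin homog_space[OF True]] by (metis order_refl)
    then show ?thesis
      by (simp add: \<delta>_def)
  qed (use c in \<open>simp add: compatible_def\<close>)
qed

lemma linear_form_plus: "linear_form g f \<Longrightarrow> linear_form g h \<Longrightarrow> linear_form g (\<lambda>x. f x + h x)"
  and linear_form_mult: "linear_form g f \<Longrightarrow> linear_form g (\<lambda>x. a * f x)"
  by (auto simp: linear_form_def algebra_simps)

lemma linear_form_minus: "linear_form g f \<Longrightarrow> linear_form g (\<lambda>x. - f x)"
  by (auto simp: linear_form_def)

lemma C2I:
  assumes "bilinear_form g \<phi>"
    and "\<And>i j x y. i \<le> 1 \<Longrightarrow> j \<le> 1 \<Longrightarrow> x \<in> homog g i \<Longrightarrow> y \<in> homog g j \<Longrightarrow>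
      \<phi> x y = - ((-1) ^ (i * j) * \<phi> y x)"
    and "\<And>x y. x \<notin> space g \<or> y \<notin> space g \<Longrightarrow> \<phi> x y = 0"
  shows "\<phi> \<in> C2 g"
proof -
  have "i \<le> 1" if "i \<in> {0, 1}" for i :: nat
    using that by auto
  then show ?thesis
    using assms unfolding C2_def bilinear_form_def by blast
qed

lemma C2_add:
  assumes "\<phi> \<in> C2 g" "\<psi> \<in> C2 g"
  shows "\<phi> + \<psi> \<in> C2 g"
proof (rule C2I)
  show "bilinear_form g (\<phi> + \<psi>)"
    using linear_form_plus[OF C2_left[OF assms(1)] C2_left[OF assms(2)]]
      linear_form_plus[OF C2_right[OF assms(1)] C2_right[OF assms(2)]]
    by (simp add: bilinear_form_def plus_fun_def)
  fix i j :: nat and x y assume "i \<le> 1" "j \<le> 1" "x \<in> homog g i" "y \<in> homog g j"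
  then show "(\<phi> + \<psi>) x y = - ((-1) ^ (i * j) * (\<phi> + \<psi>) y x)"
    using C2_skew[OF assms(1), of x i y j] C2_skew[OF assms(2), of x i y j]
    by (simp add: algebra_simps)
qed (use assms in \<open>auto simp: C2_outside\<close>)

lemma C2_scl:
  assumes "\<phi> \<in> C2 g"
  shows "(\<lambda>x y. a * \<phi> x y) \<in> C2 g"
proof (rule C2I)
  show "bilinear_form g (\<lambda>x y. a * \<phi> x y)"
    using linear_form_mult[OF C2_left[OF assms], of _ a] linear_form_mult[OF C2_right[OF assms], of _ a]
    by (simp add: bilinear_form_def)
  fix i j :: nat and x y assume "i \<le> 1" "j \<le> 1" "x \<in> homog g i" "y \<in> homog g j"
  then show "a * \<phi> x y = - ((-1) ^ (i * j) * (a * \<phi> y x))"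
    using C2_skew[OF assms, of x i y j] by simp
qed (use assms in \<open>auto simp: C2_outside\<close>)

lemma C2_zero: "0 \<in> C2 g"
  by (auto simp: C2_def linear_form_def)

lemma compatible_add:
  assumes "compatible g \<phi> \<omega>" "compatible g \<phi>' \<omega>'"
  shows "compatible g (\<phi> + \<phi>') (\<omega> + \<omega>')"
  using assms by (simp add: compatible_def algebra_simps sum.distrib add_divide_distrib)

lemma compatible_scl:
  assumes "compatible g \<phi> \<omega>"
  shows "compatible g (\<lambda>x y. a * \<phi> x y) (\<lambda>x. a * \<omega> x)"
  using assms by (simp add: compatible_def algebra_simps sum_distrib_left)

lemma compatible_zero: "compatible g 0 0"
  by (simp add: compatible_def)

lemma C2_res_lin_closed: "lin_closed (C2_res g)"
  unfolding lin_closed_def C2_res_def scl_res_def zero_prod_def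
  using C2_add[of _ g] compatible_add[of g] C2_scl[of _ g] compatible_scl[of g]
    C2_zero[of g] compatible_zero[of g] by auto

lemma d2_add: "d2 g (\<phi> + \<psi>) = d2 g \<phi> + d2 g \<psi>"
  by (intro ext) (simp add: d2_def Let_def algebra_simps sum.distrib sum_subtractf)

lemma d2_scl: "d2 g (\<lambda>x y. a * \<phi> x y) = (\<lambda>x y z. a * d2 g \<phi> x y z)"
  by (intro ext) (simp add: d2_def Let_def algebra_simps sum_distrib_left)

lemma ind2_add: "ind2 g P (c + c') = ind2 g P c + ind2 g P c'"
  by (cases c; cases c') (auto simp: ind2_def fun_eq_iff)

lemma ind2_scl: "ind2 g P (scl_res a c) x h = a * ind2 g P c x h"
  by (cases c) (simp add: ind2_def scl_res_def right_diff_distrib)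

lemma Z2_res_iff: "c \<in> Z2_res g P \<longleftrightarrow> c \<in> C2_res g \<and> d2 g (fst c) = 0 \<and> ind2 g P c = 0"
  by (simp add: Z2_res_def d2_res_def zero_prod_def)

lemma Z2_res_lin_closed: "lin_closed (Z2_res g P)"
proof -
  have "d2 g (fst (scl_res a c)) = (\<lambda>x y z. a * d2 g (fst c) x y z)" for a c
    by (simp add: scl_res_def split_beta d2_scl)
  moreover have "d2 g 0 = 0" "ind2 g P 0 = 0"
    by (auto simp: d2_def ind2_def fun_eq_iff zero_prod_def)
  ultimately show ?thesis
    using C2_res_lin_closed[of g]
    by (auto simp: lin_closed_def Z2_res_iff d2_add ind2_add ind2_scl fun_eq_iff)
qed

lemma C1_add: "\<psi> \<in> C1 g \<Longrightarrow> \<psi>' \<in> C1 g \<Longrightarrow> \<psi> + \<psi>' \<in> C1 g"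
  and C1_scl: "\<psi> \<in> C1 g \<Longrightarrow> (\<lambda>x. a * \<psi> x) \<in> C1 g"
  and C1_zero: "0 \<in> C1 g"
  by (auto simp: C1_def linear_form_def algebra_simps)

lemma B2_res_lin_closed: "lin_closed (B2_res g P)"
proof -
  have "d1_res g P \<psi> + d1_res g P \<psi>' = d1_res g P (\<psi> + \<psi>')"
    "scl_res a (d1_res g P \<psi>) = d1_res g P (\<lambda>x. a * \<psi> x)" "0 = d1_res g P 0" for a \<psi> \<psi>'
    by (auto simp: d1_res_def d1_def ind1_def scl_res_def fun_eq_iff zero_prod_def)
  note d1 = this
  show ?thesis
    unfolding lin_closed_def B2_res_def
    using d1(3) C1_zero[of g] by (auto simp: d1(1,2) intro!: imageI C1_add C1_scl)
qed

lemma even_cochains_iff: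
  "c \<in> even_cochains g \<longleftrightarrow> c \<in> C2_res g \<and>
    (\<forall>x\<in>homog g 0. \<forall>y\<in>homog g 1. fst c x y = 0 \<and> fst c y x = 0)"
  by (cases c) (auto simp: even_cochains_def)

lemma odd_cochains_iff:
  "c \<in> odd_cochains g \<longleftrightarrow> c \<in> C2_res g \<and> snd c = 0 \<and>
    (\<forall>x\<in>homog g 0. \<forall>y\<in>homog g 0. fst c x y = 0) \<and>
    (\<forall>x\<in>homog g 1. \<forall>y\<in>homog g 1. fst c x y = 0)"
  by (cases c) (auto simp: odd_cochains_def)

lemma scl_res_sel: "fst (scl_res a c) x y = a * fst c x y" "snd (scl_res a c) x = a * snd c x"
  by (simp_all add: scl_res_def split_beta)

lemma even_cochains_lin_closed: "lin_closed (even_cochains g)"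
  using C2_res_lin_closed[of g]
  unfolding lin_closed_def by (auto simp: even_cochains_iff scl_res_sel simp del: split_paired_All split_paired_Ex)

lemma odd_cochains_lin_closed: "lin_closed (odd_cochains g)"
  using C2_res_lin_closed[of g]
  unfolding lin_closed_def
  by (auto simp: odd_cochains_iff scl_res_sel fun_eq_iff zero_fun_def)

text \<open>Cochains are skew on homogeneous arguments by definition. Against an even argument the
  sign does not depend on the parity of the other one, so the rule extends to inhomogeneous
  \<open>x\<close>.\<close>

lemma C2_skew_even:
  assumes fin: "finite (bas g)" and par: "\<And>b. b \<in> bas g \<Longrightarrow> par g b \<le> 1"
    and "\<phi> \<in> C2 g" "x \<in> space g" "y \<in> even_part g"
  shows "\<phi> x y = - \<phi> y x"
proof -
  have "bilinear_form g (\<lambda>x y. - \<phi> y x)"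
    unfolding bilinear_form_def
    using linear_form_minus[OF C2_left[OF assms(3)]] linear_form_minus[OF C2_right[OF assms(3)]]
    by blast
  note eqI = bilinear_eqI[OF fin C2_bilinear[OF assms(3)] this assms(4) homog_space[OF assms(5)]]
  show ?thesis
  proof (rule eqI)
    fix b c assume "b \<in> bas g" "c \<in> bas g" "y c \<noteq> 0"
    moreover from this have "par g c = 0"
      using assms(5) by (auto simp: homog_def)
    ultimately show "\<phi> (unit_vector b) (unit_vector c) = - \<phi> (unit_vector c) (unit_vector b)"
      using C2_skew[OF assms(3) homog_unit homog_unit, of b c] par
      by (simp only: mult_0_right power_0 mult_1)
  qed
qed

section \<open>Cocycles of the twisted Heisenberg superalgebra\<close>

lemma bilinear_plus: "bilinear_form g F \<Longrightarrow> bilinear_form g G \<Longrightarrow> bilinear_form g (\<lambda>x y. F x y + G x y)"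
  and bilinear_mult: "bilinear_form g F \<Longrightarrow> bilinear_form g (\<lambda>x y. a * F x y)"
  and bilinear_minus: "bilinear_form g F \<Longrightarrow> bilinear_form g (\<lambda>x y. - F x y)"
  and bilinear_swap: "bilinear_form g F \<Longrightarrow> bilinear_form g (\<lambda>x y. F y x)"
  unfolding bilinear_form_def
  by (auto intro!: linear_form_plus linear_form_mult linear_form_minus)

definition linear_endo :: "('i, 'f::field) superalgebra \<Rightarrow> (('i \<Rightarrow> 'f) \<Rightarrow> ('i \<Rightarrow> 'f)) \<Rightarrow> bool" where
  "linear_endo g T \<longleftrightarrow> (\<forall>x\<in>space g. T x \<in> space g) \<and>
     (\<forall>x\<in>space g. \<forall>y\<in>space g. T (x + y) = T x + T y) \<and> (\<forall>a. \<forall>x\<in>space g. T (scl a x) = scl a (T x))"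

lemma linear_form_comp: "linear_form g f \<Longrightarrow> linear_endo g T \<Longrightarrow> linear_form g (\<lambda>x. f (T x))"
  by (auto simp: linear_form_def linear_endo_def)

lemma bilinear_comp_left: "bilinear_form g F \<Longrightarrow> linear_endo g T \<Longrightarrow> bilinear_form g (\<lambda>x y. F (T x) y)"
  and bilinear_comp_right: "bilinear_form g F \<Longrightarrow> linear_endo g T \<Longrightarrow> bilinear_form g (\<lambda>x y. F x (T y))"
  unfolding bilinear_form_def
  by (auto intro: linear_form_comp simp: linear_endo_def)

lemma linear_form_coord: "linear_form g (\<lambda>x. x b)"
  by (simp add: linear_form_def)

lemma bilinear_tensor:
  "linear_form g f \<Longrightarrow> linear_form g h \<Longrightarrow> bilinear_form g (\<lambda>x y. f x * h y)"
  unfolding bilinear_form_def linear_form_def by (auto simp: algebra_simps)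

lemma linear_form_cong:
  assumes "linear_form g f" "\<And>x. x \<in> space g \<Longrightarrow> f x = f' x"
  shows "linear_form g f'"
  unfolding linear_form_def
proof (intro conjI ballI allI)
  fix x y assume "x \<in> space g" "y \<in> space g"
  then show "f' (x + y) = f' x + f' y"
    using assms(2)[symmetric] linear_form_add[OF assms(1)] by (simp only: space_add)
next
  fix a x assume "x \<in> space g"
  then show "f' (scl a x) = a * f' x"
    using assms(2)[symmetric] linear_form_scl[OF assms(1)] by (simp only: space_scl)
qed

lemma bilinear_cong:
  assumes "bilinear_form g F" "\<And>x y. x \<in> space g \<Longrightarrow> y \<in> space g \<Longrightarrow> F x y = F' x y"
  shows "bilinear_form g F'"
  unfolding bilinear_form_def
proof (intro conjI ballI)
  fix x assume x: "x \<in> space g"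
  then have "linear_form g (F x)" "linear_form g (\<lambda>y. F y x)"
    using assms(1) by (simp_all add: bilinear_form_def)
  then show "linear_form g (F' x)" "linear_form g (\<lambda>y. F' y x)"
    using assms(2) x by (auto intro: linear_form_cong)
qed

text \<open>The scalar identity behind the vanishing of \<open>d2\<close>. Here \<open>xd\<close>,
  \<open>yd\<close>, \<open>wd\<close> are the \<open>dd\<close>-coordinates and \<open>dx\<close>,
  \<open>dy\<close>, \<open>dw\<close> the values of the form at \<open>dd\<close> and
  \<open>D x\<close>, \<open>D y\<close>, \<open>D w\<close>. The pairs \<open>p1, p2\<close>, then
  \<open>q1, q2\<close>, then \<open>r1, r2\<close> are the two terms of invariance for (x, y), (x,
  w), (y, w), and \<open>s1\<close>, \<open>s2\<close>, \<open>s3\<close> are the parity signs. A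
  sign is 1 wherever it meets a nonzero \<open>dd\<close>-coordinate, because \<open>dd\<close> is
  even.\<close>

lemma cocycle_identity:
  fixes xd yd wd :: "'a::comm_ring_1"
  assumes D: "p1 + p2 = xd * dy + yd * - dx" "q1 + q2 = xd * dw + wd * - dx" "r1 + r2 = yd * dw + wd * - dy"
    and s: "yd * s1 = yd" "wd * s2 = wd" "wd * s3 = wd" "s1 * s1 = 1" "s2 * s2 = 1" "s3 * s3 = 1"
  shows "xd * r1 - yd * q1 - s3 * (xd * - (s3 * r2) - wd * p1)
    + s1 * s2 * (yd * - (s2 * q2) - wd * - (s1 * p2)) = 0"
proof -
  have "xd * r1 - yd * q1 - s3 * (xd * - (s3 * r2) - wd * p1)
      + s1 * s2 * (yd * - (s2 * q2) - wd * - (s1 * p2))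
    = xd * (r1 + (s3 * s3) * r2) - yd * q1 - (s2 * s2) * (yd * s1) * q2
      + (wd * s3) * p1 + (s1 * s1) * (wd * s2) * p2"
    by (simp add: algebra_simps)
  also have "\<dots> = xd * (r1 + r2) - yd * (q1 + q2) + wd * (p1 + p2)"
    unfolding s by (simp add: algebra_simps)
  also have "\<dots> = 0"
    unfolding D by (simp add: algebra_simps)
  finally show ?thesis .
qed

lemma prod_list_minus: "(\<Prod>x\<leftarrow>xs. - f x) = (- 1) ^ length xs * (\<Prod>x\<leftarrow>xs. f x :: 'f::comm_ring_1)"
  by (induction xs) simp_all

context twisted_heisenberg
begin

lemma D_endo: "linear_endo g D"
  by (simp add: linear_endo_def D_add D_scl del: scl_simps(5) plus_fun_apply)

lemma D_pow_endo: "linear_endo g (D ^^ k)"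
  by (simp add: linear_endo_def D_pow_add D_pow_scl D_pow_space del: scl_simps(5) plus_fun_apply)

lemmas bilinear_eqI_g = bilinear_eqI[of g, unfolded bas_g, OF finite_hbas]

lemmas C2_skew_even_g = C2_skew_even[of g, unfolded bas_g par_g, OF finite_hbas hpar_le]

section \<open>Ordinary cocycles as invariant forms with \<open>zz\<close> in the radical\<close>

definition invariant :: "((hindex \<Rightarrow> 'f) \<Rightarrow> (hindex \<Rightarrow> 'f) \<Rightarrow> 'f) \<Rightarrow> bool" where
  "invariant \<phi> \<longleftrightarrow> (\<forall>b\<in>hbas m n t. \<phi> (u zz) (u b) = 0) \<and>
     (\<forall>b\<in>hbas m n t. \<forall>c\<in>hbas m n t. b \<noteq> dd \<longrightarrow> c \<noteq> dd \<longrightarrow>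
        ev b * \<phi> (u (sw b)) (u c) + ev c * \<phi> (u b) (u (sw c)) = 0)"

lemma brk_zero: "brk g 0 y = 0" "brk g x 0 = 0"
  by (simp_all add: heis_def fun_eq_iff)

lemma brk_unit:
  assumes "b \<in> hbas m n t" "c \<in> hbas m n t"
  shows "brk g (u b) (u c) = scl (if c = pr b then sg b else 0) (u zz)
    + scl (if b = dd then ev c else 0) (u (sw c)) - scl (if c = dd then ev b else 0) (u (sw b))"
proof -
  have "u b dd = (if b = dd then 1 else 0)" "u c dd = (if c = dd then 1 else 0)"
    by (auto simp: unit_vector_def)
  then show ?thesis
    using assms by (simp add: brk_eq BB_unit D_unit)
qed

text \<open>A parity projection maps a basis vector to itself or to 0, so one of the eight summands
  in \<open>d2\<close> survives.\<close>

lemma d2_unit: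
  assumes "\<phi> \<in> C2 g" "b \<in> hbas m n t" "c \<in> hbas m n t" "e \<in> hbas m n t"
  shows "d2 g \<phi> (u b) (u c) (u e) = \<phi> (brk g (u b) (u c)) (u e)
    - (- 1) ^ (hpar e * hpar c) * \<phi> (brk g (u b) (u e)) (u c)
    + (- 1) ^ (hpar b * (hpar c + hpar e)) * \<phi> (brk g (u c) (u e)) (u b)"
proof -
  have z: "\<phi> 0 y = 0" "\<phi> y 0 = 0" if "y \<in> space g" for y
    using linear_form_zero[OF C2_left[OF assms(1) that]] linear_form_zero[OF C2_right[OF assms(1) that]]
    by auto
  have p: "hpar a = 0 \<or> hpar a = 1" for a
    by (cases a) auto
  have s: "(\<Sum>i\<le>1. f i) = f 0 + f (1::nat)" for f :: "nat \<Rightarrow> 'f"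
    by simp
  have z00: "\<phi> 0 0 = 0"
    by (rule z(1)[OF space_zero])
  show ?thesis
    using p[of b] p[of c] p[of e] assms
    unfolding d2_def s
    by (elim disjE) (simp_all only: homog_proj_unit par_g space_u Let_def if_True if_False brk_zero z
      z00 brk_space simp_thms mult_zero_right mult_zero_left diff_zero add_0 add_0_right
      zero_neq_one one_neq_zero mult_1 mult_1_right power_0 diff_self)
qed

lemma C2_zero_left: "\<phi> \<in> C2 g \<Longrightarrow> w \<in> space g \<Longrightarrow> \<phi> 0 w = 0"
  and C2_zero_right: "\<phi> \<in> C2 g \<Longrightarrow> w \<in> space g \<Longrightarrow> \<phi> w 0 = 0"
  by (rule linear_form_zero[OF C2_left] linear_form_zero[OF C2_right]; assumption)+

lemma C2_add_left: "\<phi> \<in> C2 g \<Longrightarrow> x \<in> space g \<Longrightarrow> y \<in> space g \<Longrightarrow> w \<in> space g \<Longrightarrow> \<phi> (x + y) w = \<phi> x w + \<phi> y w"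
  and C2_diff_left: "\<phi> \<in> C2 g \<Longrightarrow> x \<in> space g \<Longrightarrow> y \<in> space g \<Longrightarrow> w \<in> space g \<Longrightarrow> \<phi> (x - y) w = \<phi> x w - \<phi> y w"
  and C2_scl_left: "\<phi> \<in> C2 g \<Longrightarrow> x \<in> space g \<Longrightarrow> w \<in> space g \<Longrightarrow> \<phi> (scl a x) w = a * \<phi> x w"
  and C2_add_right: "\<phi> \<in> C2 g \<Longrightarrow> x \<in> space g \<Longrightarrow> y \<in> space g \<Longrightarrow> w \<in> space g \<Longrightarrow> \<phi> w (x + y) = \<phi> w x + \<phi> w y"
  and C2_scl_right: "\<phi> \<in> C2 g \<Longrightarrow> x \<in> space g \<Longrightarrow> w \<in> space g \<Longrightarrow> \<phi> w (scl a x) = a * \<phi> w x"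
  using linear_form_add[OF C2_left[of \<phi> g w], of x y] linear_form_diff[OF C2_left[of \<phi> g w], of x y]
    linear_form_scl[OF C2_left[of \<phi> g w], of x a] linear_form_add[OF C2_right[of \<phi> g w], of x y]
    linear_form_scl[OF C2_right[of \<phi> g w], of x a]
  by blast+

lemma C2_brk_unit:
  assumes "\<phi> \<in> C2 g" "b \<in> hbas m n t" "c \<in> hbas m n t" "w \<in> space g"
  shows "\<phi> (brk g (u b) (u c)) w = (if c = pr b then sg b else 0) * \<phi> (u zz) w
    + (if b = dd then 1 else 0) * (ev c * \<phi> (u (sw c)) w) - (if c = dd then 1 else 0) * (ev b * \<phi> (u (sw b)) w)"
  unfolding brk_unit[OF assms(2,3)]
  using assms
  by (simp add: C2_add_left C2_diff_left C2_scl_left space_add space_scl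
    del: plus_fun_apply minus_apply scl_simps(5))

lemma invariant_if_d2_zero:
  assumes "\<phi> \<in> C2 g" "d2 g \<phi> = 0"
  shows "invariant \<phi>"
proof -
  note eq = d2_unit[OF assms(1), unfolded assms(2) zero_fun_apply]
  \<comment> \<open>The vector \<open>zz\<close> is written as a bracket of two basis vectors that
    both commute with \<open>e\<close>: the pair \<open>E 1\<close>, \<open>E (m + 1)\<close> when
    \<open>e\<close> is some \<open>Y k\<close>, and \<open>Y 1\<close> with itself otherwise. The
    cocycle identity for the pair and \<open>e\<close> then reduces to this value.\<close>
  have z: "\<phi> (u zz) (u e) = 0" if e: "e \<in> hbas m n t" for e
  proof (cases "\<exists>k. e = Y k")
    case True
    then show ?thesis
      using eq[of "E 1" "E (m + 1)" e] e m_pos by (auto simp: C2_brk_unit[OF assms(1)])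
  next
    case False
    then show ?thesis
      using eq[of "Y 1" "Y 1" e] e t_pos by (auto simp: C2_brk_unit[OF assms(1)])
  qed
  have "ev b * \<phi> (u (sw b)) (u c) + ev c * \<phi> (u b) (u (sw c)) = 0"
    if bc: "b \<in> hbas m n t" "c \<in> hbas m n t" "b \<noteq> dd" "c \<noteq> dd" for b c
  proof -
    have "ev b * \<phi> (u (sw b)) (u c) - (- 1) ^ (hpar c * hpar b) * (ev c * \<phi> (u (sw c)) (u b)) = 0"
      using eq[of dd b c] bc by (simp add: C2_brk_unit[OF assms(1)] z)
    moreover have "\<phi> (u (sw c)) (u b) = - ((- 1) ^ (hpar c * hpar b) * \<phi> (u b) (u (sw c)))"
      using C2_skew[OF assms(1) homog_unit homog_unit, of "sw c" b] bc hpar_le by simp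
    ultimately show ?thesis
      by (cases "even (hpar c * hpar b)") simp_all
  qed
  then show ?thesis
    by (simp add: invariant_def z)
qed

lemma invariant_zz:
  assumes "\<phi> \<in> C2 g" "invariant \<phi>" "x \<in> space g"
  shows "\<phi> (u zz) x = 0" "\<phi> x (u zz) = 0"
proof -
  show 1: "\<phi> (u zz) x = 0"
    using linear_form_expand[of g "\<phi> (u zz)" x] C2_right[OF assms(1), of "u zz"] assms(2,3)
    by (simp add: invariant_def)
  have "u zz \<in> even_part g"
    using homog_unit[of zz g] by simp
  then show "\<phi> x (u zz) = 0"
    using C2_skew_even_g[OF assms(1,3)] 1 by simp
qed

lemma even_u_dd: "u dd \<in> even_part g" and even_u_zz: "u zz \<in> even_part g"
  using homog_unit[of dd g] homog_unit[of zz g] by simp_all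

text \<open>Invariance is imposed away from \<open>dd\<close> only. As \<open>D\<close> kills
  \<open>dd\<close>, the right side is exactly what the left side becomes when one argument is
  \<open>dd\<close>.\<close>

lemma invariant_D:
  assumes "\<phi> \<in> C2 g" "invariant \<phi>" "x \<in> space g" "y \<in> space g"
  shows "\<phi> (D x) y + \<phi> x (D y) = x dd * \<phi> (u dd) (D y) + y dd * \<phi> (D x) (u dd)"
proof -
  define F where "F x y = \<phi> (D x) y + \<phi> x (D y)" for x y
  define G where "G x y = x dd * \<phi> (u dd) (D y) + y dd * \<phi> (D x) (u dd)" for x y
  have "bilinear_form g F"
    unfolding F_def
    by (rule bilinear_plus[OF bilinear_comp_left[OF C2_bilinear[OF assms(1)] D_endo]
      bilinear_comp_right[OF C2_bilinear[OF assms(1)] D_endo]])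
  moreover have "bilinear_form g G"
    unfolding G_def
    using bilinear_tensor[OF linear_form_coord linear_form_comp[OF C2_right[OF assms(1)] D_endo], of "u dd" dd]
      bilinear_swap[OF bilinear_tensor[OF linear_form_coord
        linear_form_comp[OF C2_left[OF assms(1), of "u dd"] D_endo], of dd]]
    by (simp add: bilinear_plus)
  ultimately have "F x y = G x y"
  proof (rule bilinear_eqI_g[OF _ _ assms(3,4), of F G])
    fix b c assume bc: "b \<in> hbas m n t" "c \<in> hbas m n t"
    have "u b dd = (if b = dd then 1 else 0)" "u c dd = (if c = dd then 1 else 0)"
      by (auto simp: unit_vector_def)
    then show "F (u b) (u c) = G (u b) (u c)"
      using assms(2) bc
      by (auto simp: F_def G_def D_unit C2_scl_left[OF assms(1)] C2_scl_right[OF assms(1)]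
        C2_zero_left[OF assms(1)] C2_zero_right[OF assms(1)] invariant_def
        simp del: scl_simps(5))
  qed
  then show ?thesis
    by (simp add: F_def G_def)
qed

lemma C2_brk:
  assumes "\<phi> \<in> C2 g" "invariant \<phi>" "x \<in> space g" "y \<in> space g" "w \<in> space g"
  shows "\<phi> (brk g x y) w = x dd * \<phi> (D y) w - y dd * \<phi> (D x) w"
  unfolding brk_eq[OF assms(3,4)]
  using assms
  by (simp add: C2_add_left C2_diff_left C2_scl_left invariant_zz space_add space_scl
    del: plus_fun_apply minus_apply scl_simps(5))

lemma d2_zero_if_invariant:
  assumes "\<phi> \<in> C2 g" "invariant \<phi>"
  shows "d2 g \<phi> = 0"
proof -
  have "\<phi> (brk g x y) w - (- 1) ^ (k * j) * \<phi> (brk g x w) y + (- 1) ^ (i * (j + k)) * \<phi> (brk g y w) x = 0"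
    if h: "x \<in> homog g i" "y \<in> homog g j" "w \<in> homog g k" "i \<le> 1" "j \<le> 1" "k \<le> 1" for x y w i j k
  proof -
    note s = h(1-3)[THEN homog_space]
    note brk = C2_brk[OF assms]
    have odd: "a dd = 0" if "a \<in> homog g 1" for a
      using that by (auto simp: homog_def)
    have "\<phi> (D w) y = - ((- 1) ^ (k * j) * \<phi> y (D w))" "\<phi> (D w) x = - ((- 1) ^ (k * i) * \<phi> x (D w))"
      "\<phi> (D y) x = - ((- 1) ^ (j * i) * \<phi> x (D y))"
      using C2_skew[OF assms(1)] D_homog h by blast+
    note skew = this
    have skew_dd: "\<phi> (D a) (u dd) = - \<phi> (u dd) (D a)" for a
      by (rule C2_skew_even_g[OF assms(1) D_space even_u_dd])
    note D = invariant_D[OF assms s(1,2), unfolded skew_dd] invariant_D[OF assms s(1,3), unfolded skew_dd]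
      invariant_D[OF assms s(2,3), unfolded skew_dd]
    \<comment> \<open>A nonzero \<open>dd\<close>-coordinate forces an even argument, and then the
      sign is 1.\<close>
    have 1: "y dd * (- 1) ^ (j * i) = y dd" "w dd * (- 1) ^ (k * i) = w dd" "w dd * (- 1) ^ (k * j) = w dd"
      using odd h(2,3,5,6) by (cases j; cases k; force)+
    have 2: "(- 1) ^ a * (- 1) ^ a = (1 :: 'f)" for a :: nat
      by (simp flip: power_add)
    have 3: "(- 1) ^ (i * (j + k)) = (- 1) ^ (j * i) * (- 1 :: 'f) ^ (k * i)"
      by (simp add: power_add algebra_simps)
    show ?thesis
      unfolding brk[OF s(1,2,3)] brk[OF s(1,3,2)] brk[OF s(2,3,1)] skew 3
      by (rule cocycle_identity[OF D 1 2 2 2])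
  qed
  then show ?thesis
    unfolding d2_def Let_def by (auto simp: fun_eq_iff homog_proj_homog intro!: sum.neutral)
qed

section \<open>Iterated brackets seen through an invariant form\<close>

lemma zz_vector: "(D ^^ k) (scl a (u zz)) = (if k = 0 then scl a (u zz) else 0)"
  by (simp add: D_pow_scl D_pow_zz del: scl_simps(5))

lemma D_pow_Suc': "(D ^^ k) (D x) = (D ^^ Suc k) x"
  by (simp add: funpow_swap1)

text \<open>The \<open>zz\<close>-component of the bracket contributes nothing: \<open>D\<close>
  kills it for positive \<open>k\<close>, and the form does for \<open>k = 0\<close>.\<close>

lemma C2_D_pow_brk:
  assumes "\<phi> \<in> C2 g" "invariant \<phi>" "x \<in> space g" "y \<in> space g" "w \<in> space g"
  shows "\<phi> ((D ^^ k) (brk g x y)) w = x dd * \<phi> ((D ^^ Suc k) y) w - y dd * \<phi> ((D ^^ Suc k) x) w"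
proof -
  have "\<phi> ((D ^^ k) (scl a (u zz))) w = 0" for a
    unfolding zz_vector using assms
    by (simp add: C2_scl_left invariant_zz C2_zero_left del: scl_simps(5))
  then show ?thesis
    unfolding brk_eq[OF assms(3,4)] D_pow_diff D_pow_add D_pow_scl[of k "x dd"] D_pow_scl[of k "y dd"]
      D_pow_Suc' using assms
    by (simp add: C2_add_left C2_diff_left C2_scl_left space_add space_scl D_pow_space
      del: plus_fun_apply minus_apply scl_simps(5) funpow.simps)
qed

text \<open>A vector without \<open>dd\<close>-coordinate is sent by a further bracket with
  \<open>h\<close> to \<open>- h dd\<close> times its image under \<open>D\<close>, up to a multiple
  of \<open>zz\<close>, which lies in the radical.\<close>

lemma C2_foldl_brk:
  assumes "\<phi> \<in> C2 g" "invariant \<phi>" "y \<in> space g"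
  shows "w \<in> space g \<Longrightarrow> w dd = 0 \<Longrightarrow> set hs \<subseteq> space g \<Longrightarrow>
    \<phi> (foldl (brk g) w hs) y = (\<Prod>h\<leftarrow>hs. - h dd) * \<phi> ((D ^^ length hs) w) y"
proof (induction hs arbitrary: w)
  case Nil
  show ?case
    by simp
next
  case (Cons h hs)
  have "\<phi> (foldl (brk g) w (h # hs)) y = (\<Prod>h\<leftarrow>hs. - h dd) * \<phi> ((D ^^ length hs) (brk g w h)) y"
    using Cons.IH[of "brk g w h"] Cons.prems brk_space brk_dd by simp
  also have "\<phi> ((D ^^ length hs) (brk g w h)) y = - h dd * \<phi> ((D ^^ length (h # hs)) w) y"
    using C2_D_pow_brk[OF assms(1,2) _ _ assms(3), of w h "length hs"] Cons.prems by simp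
  finally show ?case
    by (simp add: mult_ac)
qed

lemma D_pow_char_unit: "(D ^^ (CHAR('f) - 1)) (u b) = scl (if ev b = 0 then 0 else l) (u b)"
  unfolding fun_eq_iff D_pow_char by (simp add: unit_vector_def)

text \<open>The weight of \<open>Y k\<close> is 0. Invariance at the pair \<open>Y k\<close>,
  \<open>sw c\<close> therefore leaves only the term \<open>ev c * \<phi> (u (Y k)) (u c)\<close>,
  whose weight is nonzero unless \<open>c\<close> is \<open>zz\<close> or \<open>dd\<close>.\<close>

lemma invariant_Y_even:
  assumes "\<phi> \<in> C2 g" "invariant \<phi>" "\<forall>k\<in>{1..t}. \<phi> (u (Y k)) (u dd) = 0"
    and "Y k \<in> hbas m n t" "c \<in> hbas m n t" "hpar c = 0"
  shows "\<phi> (u (Y k)) (u c) = 0"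
proof (cases "c = zz \<or> c = dd")
  case True
  then show ?thesis
    using assms invariant_zz[OF assms(1,2), of "u (Y k)"] by auto
next
  case False
  then have "ev c \<noteq> 0"
    using assms(5,6) by (intro ev_nonzero) auto
  moreover have "ev (Y k) * \<phi> (u (sw (Y k))) (u (sw c)) + ev (sw c) * \<phi> (u (Y k)) (u (sw (sw c))) = 0"
    using assms(2,4,5) False unfolding invariant_def
    by (metis sw_mem sw_sw fixed_simps(6,18))
  ultimately show ?thesis
    by simp
qed

text \<open>The power of \<open>D\<close> is the scalar \<open>l\<close> apart from
  \<open>zz\<close>, \<open>dd\<close> and the \<open>Y k\<close>. Among these, \<open>zz\<close> is
  in the radical and the \<open>Y k\<close> are orthogonal to the even part, so only
  \<open>dd\<close> needs the correction term.\<close>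

lemma C2_D_pow_char:
  assumes "\<phi> \<in> C2 g" "invariant \<phi>" "\<forall>k\<in>{1..t}. \<phi> (u (Y k)) (u dd) = 0"
    and x: "x \<in> space g" and h: "h \<in> even_part g"
  shows "\<phi> ((D ^^ (CHAR('f) - 1)) x) h = l * \<phi> x h - l * (x dd * \<phi> (u dd) h)"
proof -
  define F where "F x y = \<phi> ((D ^^ (CHAR('f) - 1)) x) y + l * (x dd * \<phi> (u dd) y)" for x y
  define G where "G x y = l * \<phi> x y" for x y
  have "bilinear_form g F"
    unfolding F_def
    by (rule bilinear_plus[OF bilinear_comp_left[OF C2_bilinear[OF assms(1)] D_pow_endo]
      bilinear_mult[OF bilinear_tensor[OF linear_form_coord C2_right[OF assms(1) space_u]]]]) simp
  moreover have "bilinear_form g G"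
    unfolding G_def by (rule bilinear_mult[OF C2_bilinear[OF assms(1)]])
  ultimately have "F x h = G x h"
  proof (rule bilinear_eqI_g[OF _ _ x homog_space[OF h], of F G])
    fix b c assume bc: "b \<in> hbas m n t" "c \<in> hbas m n t" "h c \<noteq> 0"
    then have c: "hpar c = 0"
      using h by (auto simp: homog_def)
    have dd: "u b dd = (if b = dd then 1 else 0)"
      by (auto simp: unit_vector_def)
    have F: "F (u b) (u c) = (if ev b = 0 then 0 else l) * \<phi> (u b) (u c) + l * ((if b = dd then 1 else 0) * \<phi> (u dd) (u c))"
      unfolding F_def D_pow_char_unit dd using bc by (simp only: C2_scl_left[OF assms(1)] space_u)
    consider "ev b \<noteq> 0" | "b = zz" | "b = dd" | k where "b = Y k"
      using ev_nonzero[OF bc(1)] by blast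
    then show "F (u b) (u c) = G (u b) (u c)"
    proof cases
      case 1
      then have "b \<noteq> dd"
        by auto
      then show ?thesis
        using 1 by (simp add: F G_def)
    next
      case 2
      then show ?thesis
        unfolding F G_def using invariant_zz[OF assms(1,2)] bc(2) by simp
    next
      case 3
      then show ?thesis
        unfolding F G_def by simp
    next
      case (4 k)
      then show ?thesis
        unfolding F G_def using invariant_Y_even[OF assms(1-3) _ bc(2) c, of k] bc(1) by simp
    qed
  qed
  then show ?thesis
    by (simp add: F_def G_def algebra_simps)
qed

lemma C2_diag_even:
  assumes "\<phi> \<in> C2 g" "h \<in> even_part g"
  shows "\<phi> h h = 0"
proof -
  have "2 * \<phi> h h = 0"
    using C2_skew_even_g[OF assms(1) homog_space[OF assms(2)] assms(2)] by (simp add: eq_neg_iff_add_eq_0)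
  then show ?thesis
    using two_nonzero by simp
qed

text \<open>The two correction terms at \<open>dd\<close> cancel against each other, since
  \<open>\<phi> h h = 0\<close>. The remaining factor is the one with which \<open>P h\<close> is a
  multiple of \<open>h\<close> modulo \<open>zz\<close>.\<close>

lemma C2_power_bracket:
  assumes "\<phi> \<in> C2 g" "invariant \<phi>" "\<forall>k\<in>{1..t}. \<phi> (u (Y k)) (u dd) = 0"
    and x: "x \<in> space g" and h: "h \<in> even_part g"
  shows "\<phi> (lnbrk g (x # replicate (CHAR('f) - 1) h)) h = h dd ^ (CHAR('f) - 1) * l * \<phi> x h"
proof -
  \<comment> \<open>The first of the p - 1 brackets is kept apart, because it removes the
    \<open>dd\<close>-coordinate of \<open>x\<close>. The other \<open>q = p - 2\<close> brackets
    contribute an odd power of \<open>- h dd\<close>.\<close>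
  obtain q where q: "CHAR('f) = Suc (Suc q)" "odd q"
    using char_gt_2 odd_char by (cases "CHAR('f)"; cases "CHAR('f) - 1") auto
  have hs: "h \<in> space g"
    by (rule homog_space[OF h])
  have "\<phi> (lnbrk g (x # replicate (CHAR('f) - 1) h)) h = \<phi> (foldl (brk g) (brk g x h) (replicate q h)) h"
    by (simp add: lnbrk_def q(1))
  also have "\<dots> = (- h dd) ^ q * \<phi> ((D ^^ q) (brk g x h)) h"
    using C2_foldl_brk[OF assms(1,2) hs, of "brk g x h" "replicate q h"] x hs
    by (simp add: brk_space brk_dd set_replicate_conv_if)
  also have "\<phi> ((D ^^ q) (brk g x h)) h
      = x dd * \<phi> ((D ^^ (CHAR('f) - 1)) h) h - h dd * \<phi> ((D ^^ (CHAR('f) - 1)) x) h"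
    using C2_D_pow_brk[OF assms(1,2) x hs hs, of q] by (simp add: q(1))
  also have "\<dots> = - (h dd * (l * \<phi> x h))"
    unfolding C2_D_pow_char[OF assms(1-3) x h] C2_D_pow_char[OF assms(1-3) hs h] C2_diag_even[OF assms(1) h]
    by (simp add: algebra_simps)
  finally show ?thesis
    using q by simp
qed

lemma ad_power:
  assumes "h \<in> space g" "y \<in> space g"
  shows "\<exists>c. (brk g h ^^ Suc k) y = scl (h dd ^ k) ((D ^^ k) (brk g h y)) + scl c (u zz)"
proof (induction k)
  case 0
  have "(brk g h ^^ Suc 0) y = scl (h dd ^ 0) ((D ^^ 0) (brk g h y)) + scl 0 (u zz)"
    by (simp del: scl_simps(5))
  then show ?case
    by blast
next
  case (Suc k)
  then obtain c where c: "(brk g h ^^ Suc k) y = scl (h dd ^ k) ((D ^^ k) (brk g h y)) + scl c (u zz)"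
    by blast
  define w where "w = scl (h dd ^ k) ((D ^^ k) (brk g h y)) + scl c (u zz)"
  have b: "brk g h y \<in> space g" "brk g h y dd = 0"
    using assms by (simp_all add: brk_space brk_dd)
  have w: "w \<in> space g"
    unfolding w_def using b by (intro space_add space_scl D_pow_space) simp_all
  have "(D ^^ k) (brk g h y) dd = 0"
    using b by (cases k) simp_all
  then have w_dd: "w dd = 0"
    by (simp add: w_def unit_vector_def)
  have "(brk g h ^^ Suc (Suc k)) y = brk g h w"
    using c by (simp add: w_def)
  also have "\<dots> = scl (BB h w) (u zz) + scl (h dd) (D w)"
    unfolding brk_eq[OF assms(1) w] w_dd by simp
  also have "D w = scl (h dd ^ k) ((D ^^ Suc k) (brk g h y))"
    unfolding w_def D_add D_scl D_unit fixed_simps by simp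
  also have "scl (BB h w) (u zz) + scl (h dd) \<dots> =
      scl (h dd ^ Suc k) ((D ^^ Suc k) (brk g h y)) + scl (BB h w) (u zz)"
    by (simp add: add.commute)
  finally show ?case
    by blast
qed

end

section \<open>The p-operator and the restricted cocycle condition\<close>

locale restricted_heisenberg = twisted_heisenberg m n t lam kap l
  for m n t :: nat and lam kap :: "nat \<Rightarrow> 'f::field" and l :: 'f +
  fixes mu :: "nat \<Rightarrow> 'f" and P :: "(hindex \<Rightarrow> 'f) \<Rightarrow> (hindex \<Rightarrow> 'f)"
  assumes restricted: "heis_restricted m n t lam kap mu l P"
begin

lemma P_even: "h \<in> even_part g \<Longrightarrow> P h \<in> even_part g"
  and P_ad: "h \<in> even_part g \<Longrightarrow> y \<in> space g \<Longrightarrow> brk g (P h) y = (brk g h ^^ CHAR('f)) y"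
  and P_unit: "i \<in> {1..2*m+1} \<Longrightarrow> P (u (E i)) = scl (mu i) (u zz)"
  and P_dd: "P (u dd) = scl l (u dd) + scl (mu (2*m+2)) (u zz)"
  using restricted by (auto simp: heis_restricted_def restricted_structure_def zz_def dd_def)

text \<open>
  The centre of the even part is spanned by \<open>zz\<close>, so comparing \<open>ad (P h)\<close> with the \<open>p\<close>-th power
  of \<open>ad h\<close> determines \<open>P h\<close> up to a multiple of \<open>zz\<close>.
\<close>

lemma P_eq:
  assumes h: "h \<in> even_part g"
  obtains c where "P h = scl (h dd ^ (CHAR('f) - 1) * l) h + scl c (u zz)"
proof -
  define \<beta> where "\<beta> = h dd ^ (CHAR('f) - 1) * l"
  define p1 where "p1 = CHAR('f) - 1"
  have p1: "CHAR('f) = Suc p1"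
    using char_gt_2 by (simp add: p1_def)
  have hs: "h \<in> space g" and Ps: "P h \<in> space g"
    using h P_even homog_space by blast+
  have ad: "brk g (P h) y b = h dd ^ p1 * (if ev b = 0 then 0 else l * brk g h y b)"
    if y: "y \<in> space g" and b: "b \<noteq> zz" for y b
  proof -
    obtain c where "brk g (P h) y = scl (h dd ^ p1) ((D ^^ p1) (brk g h y)) + scl c (u zz)"
      using ad_power[OF hs y, of p1] P_ad[OF h y] by (auto simp: p1)
    then show ?thesis
      using b D_pow_char[of "brk g h y" b] by (simp add: unit_vector_def p1_def)
  qed
  \<comment> \<open>Bracketing with \<open>dd\<close> gives minus \<open>D (P h)\<close> up to
    \<open>zz\<close>, and its coordinate \<open>sw b\<close> is \<open>ev b * P h b\<close> up to
    sign. This determines all coordinates of nonzero weight.\<close>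
  have nz: "P h b = \<beta> * h b" if "ev b \<noteq> 0" for b
  proof -
    have "sw b \<noteq> zz" "sw b \<noteq> dd"
      using that by (metis ev_sw fixed_simps(7,8))+
    moreover have "b \<noteq> dd"
      using that by auto
    ultimately have "- (ev b * P h b) = h dd ^ p1 * (l * - (ev b * h b))"
      using ad[of "u dd" "sw b"] that by (simp add: brk_eq hs Ps) (simp add: D_def unit_vector_def)
    then show ?thesis
      using that by (simp add: \<beta>_def p1_def)
  qed
  \<comment> \<open>Bracketing with \<open>E 1\<close>, whose weight is nonzero, reads off the
    \<open>dd\<close>-coordinate.\<close>
  have dd: "P h dd = \<beta> * h dd"
  proof -
    have ev: "ev (E 1) \<noteq> 0"
      using ev_nonzero[of "E 1"] m_pos by auto
    have "sw (E 1) \<noteq> zz"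
      using ev by (metis ev_sw fixed_simps(7))
    moreover have "u (E 1) dd = 0"
      using m_pos by (simp add: unit_vector_def)
    moreover have "u (E 1) \<in> space g"
      using m_pos by simp
    ultimately have "P h dd * ev (E 1) = h dd ^ p1 * (l * (h dd * ev (E 1)))"
      using ad[of "u (E 1)" "sw (E 1)"] ev
      by (simp add: brk_eq hs Ps del: ev.simps sw.simps) (simp add: D_def unit_vector_def del: ev.simps sw.simps)
    then show ?thesis
      using ev by (simp add: \<beta>_def p1_def del: ev.simps)
  qed
  have "P h b = \<beta> * h b" if not_zz: "b \<noteq> zz" for b
  proof (cases "b \<in> hbas m n t \<and> hpar b = 0")
    case True
    then have "b \<noteq> Y k" for k
      by auto
    then consider "b = dd" | "ev b \<noteq> 0"
      using ev_nonzero[of b] not_zz True by blast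
    then show ?thesis
      using nz dd by cases auto
  next
    case False
    then have "h b = 0" "P h b = 0"
      using h P_even[OF h] by (auto simp: homog_def space_def)
    then show ?thesis
      by simp
  qed
  then have "P h = scl \<beta> h + scl (P h zz - \<beta> * h zz) (u zz)"
    by (auto simp: fun_eq_iff unit_vector_def)
  then show thesis
    using that unfolding \<beta>_def by blast
qed

lemma ind2_zero:
  assumes "\<phi> \<in> C2 g" "invariant \<phi>" "\<forall>k\<in>{1..t}. \<phi> (u (Y k)) (u dd) = 0"
  shows "ind2 g P (\<phi>, \<omega>) = 0"
proof -
  have "\<phi> x (P h) = \<phi> (lnbrk g (x # replicate (CHAR('f) - 1) h)) h"
    if x: "x \<in> space g" and h: "h \<in> even_part g" for x h
  proof -
    obtain c where "P h = scl (h dd ^ (CHAR('f) - 1) * l) h + scl c (u zz)"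
      using P_eq[OF h] .
    then have "\<phi> x (P h) = h dd ^ (CHAR('f) - 1) * l * \<phi> x h"
      using x homog_space[OF h] assms(1,2)
      by (simp add: C2_add_right C2_scl_right space_scl invariant_zz del: plus_fun_apply scl_simps(5))
    then show ?thesis
      by (simp only: C2_power_bracket[OF assms x h])
  qed
  then show ?thesis
    by (auto simp: ind2_def fun_eq_iff)
qed

text \<open>At \<open>h = dd\<close> the bracket term vanishes because \<open>Y k\<close> commutes
  with \<open>dd\<close>. What is left is \<open>l\<close> times the value, as \<open>P dd\<close>
  is \<open>l\<close> times \<open>dd\<close> plus a multiple of \<open>zz\<close>.\<close>

lemma Y_dd_zero:
  assumes "\<phi> \<in> C2 g" "invariant \<phi>" "ind2 g P (\<phi>, \<omega>) = 0" "k \<in> {1..t}"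
  shows "\<phi> (u (Y k)) (u dd) = 0"
proof -
  obtain q where q: "CHAR('f) = Suc (Suc q)"
    using char_gt_2 by (cases "CHAR('f)"; cases "CHAR('f) - 1") auto
  have Yk: "Y k \<in> hbas m n t" "u (Y k) \<in> space g"
    using assms(4) by simp_all
  have brk0: "brk g (u (Y k)) (u dd) = 0"
    unfolding brk_unit[OF Yk(1) fixed_simps(2)] by (simp add: dd_def)
  have "foldl (brk g) 0 (replicate j (u dd)) = 0" for j
    by (induction j) (simp_all only: replicate.simps foldl.simps brk_zero)
  then have "lnbrk g (u (Y k) # replicate (CHAR('f) - 1) (u dd)) = 0"
    by (simp add: lnbrk_def q brk0)
  moreover have "\<phi> (u (Y k)) (P (u dd)) = l * \<phi> (u (Y k)) (u dd)"
    unfolding P_dd using Yk assms(1,2)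
    by (simp add: C2_add_right C2_scl_right space_scl invariant_zz del: plus_fun_apply scl_simps(5))
  moreover have "ind2 g P (\<phi>, \<omega>) (u (Y k)) (u dd) = 0"
    by (simp add: assms(3))
  ultimately have "l * \<phi> (u (Y k)) (u dd) = 0"
    using Yk even_u_dd C2_zero_left[OF assms(1), of "u dd"] by (simp add: ind2_def)
  then show ?thesis
    using l_nonzero by simp
qed

lemma Z2_iff:
  "(\<phi>, \<omega>) \<in> Z2_res g P \<longleftrightarrow> \<phi> \<in> C2 g \<and> compatible g \<phi> \<omega> \<and> invariant \<phi> \<and>
    (\<forall>k\<in>{1..t}. \<phi> (u (Y k)) (u dd) = 0)"
  unfolding Z2_res_iff fst_conv C2_res_def
  using invariant_if_d2_zero d2_zero_if_invariant ind2_zero Y_dd_zero by blast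

end

section \<open>The compatible maps\<close>

text \<open>Words are grouped by the number of letters \<open>True\<close>, as in the binomial
  theorem. A leading \<open>True\<close> shifts the argument of \<open>F\<close> by one, so the
  induction needs arbitrary \<open>F\<close>.\<close>

lemma sum_bool_lists:
  fixes b b' :: "'f::comm_ring_1" and F :: "nat \<Rightarrow> 'f"
  shows "(\<Sum>cs\<in>{cs. length cs = N}. F (count_list cs True) * (\<Prod>c\<leftarrow>cs. if c then b else b'))
    = (\<Sum>j\<le>N. of_nat (N choose j) * (b ^ j * b' ^ (N - j) * F j))"
proof (induction N arbitrary: F)
  case 0
  show ?case
    by simp
next
  case (Suc N)
  let ?A = "{cs :: bool list. length cs = N}"
  define S where "S F = (\<Sum>cs\<in>?A. F (count_list cs True) * (\<Prod>c\<leftarrow>cs. if c then b else b'))" for F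
  define G where "G j = b ^ j * b' ^ (Suc N - j) * F j" for j
  have fin: "finite ?A"
    using finite_lists_length_eq[of "UNIV :: bool set" N] by simp
  have split: "{cs. length cs = Suc N} = (#) True ` ?A \<union> (#) False ` ?A"
  proof (rule Set.set_eqI)
    fix cs :: "bool list"
    show "cs \<in> {cs. length cs = Suc N} \<longleftrightarrow> cs \<in> (#) True ` ?A \<union> (#) False ` ?A"
      by (cases cs; cases "hd cs") auto
  qed
  have "(\<Sum>cs\<in>{cs. length cs = Suc N}. F (count_list cs True) * (\<Prod>c\<leftarrow>cs. if c then b else b'))
      = b * S (\<lambda>j. F (Suc j)) + b' * S F"
    unfolding split S_def
    by (subst sum.union_disjoint) (auto simp: fin sum.reindex sum_distrib_left mult_ac intro!: sum.cong)
  also have "b * S (\<lambda>j. F (Suc j)) = (\<Sum>j\<le>N. of_nat (N choose j) * G (Suc j))"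
    using Suc.IH[of "\<lambda>j. F (Suc j)"]
    by (simp add: S_def G_def sum_distrib_left mult_ac)
  also have "b' * S F = (\<Sum>j\<le>N. of_nat (N choose j) * G j)"
  proof -
    have "of_nat (N choose j) * G j = b' * (of_nat (N choose j) * (b ^ j * b' ^ (N - j) * F j))" if "j \<le> N" for j
      using that by (simp add: G_def Suc_diff_le mult_ac)
    then show ?thesis
      using Suc.IH[of F] by (simp add: S_def sum_distrib_left)
  qed
  also have "\<dots> = G 0 + (\<Sum>j\<le>N. of_nat (N choose Suc j) * G (Suc j))"
  proof -
    have "(\<Sum>j\<le>N. of_nat (N choose j) * G j) = (\<Sum>j\<le>Suc N. of_nat (N choose j) * G j)"
      by (simp add: binomial_eq_0)
    also have "\<dots> = G 0 + (\<Sum>j\<le>N. of_nat (N choose Suc j) * G (Suc j))"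
      by (subst sum.atMost_Suc_shift) simp
    finally show ?thesis .
  qed
  also have "(\<Sum>j\<le>N. of_nat (N choose j) * G (Suc j)) + (G 0 + (\<Sum>j\<le>N. of_nat (N choose Suc j) * G (Suc j)))
      = G 0 + (\<Sum>j\<le>N. of_nat (Suc N choose Suc j) * G (Suc j))"
    by (simp add: sum.distrib algebra_simps)
  also have "\<dots> = (\<Sum>j\<le>Suc N. of_nat (Suc N choose j) * G j)"
    by (subst sum.atMost_Suc_shift) simp
  finally show ?case
    by (simp only: G_def)
qed

text \<open>The first two letters are prescribed and the last one is the second argument of the
  form, which leaves p - 3 free letters in the middle.\<close>

lemma sum_choices:
  fixes f :: "bool list \<Rightarrow> 'f::comm_monoid_add"
  shows "(\<Sum>c\<in>choices (Suc (Suc (Suc N))). f c) =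
    (\<Sum>cs\<in>{cs. length cs = N}. f (True # False # cs @ [True]) + f (True # False # cs @ [False]))"
proof -
  let ?A = "{cs :: bool list. length cs = N}"
  define h where "h e cs = True # False # cs @ [e]" for e :: bool and cs
  have fin: "finite ?A"
    using finite_lists_length_eq[of "UNIV :: bool set" N] by simp
  have inj: "inj_on (h e) ?A" for e
    by (auto simp: h_def inj_on_def)
  have "choices (Suc (Suc (Suc N))) = h True ` ?A \<union> h False ` ?A"
  proof (rule Set.set_eqI)
    fix c
    show "c \<in> choices (Suc (Suc (Suc N))) \<longleftrightarrow> c \<in> h True ` ?A \<union> h False ` ?A"
    proof
      assume c: "c \<in> choices (Suc (Suc (Suc N)))"
      then obtain cs where cs: "c = True # False # cs" "length cs = Suc N"
        by (auto simp: choices_def length_Suc_conv)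
      then obtain ds e where "cs = ds @ [e]" "length ds = N"
        by (metis length_Suc_conv_rev)
      with cs show "c \<in> h True ` ?A \<union> h False ` ?A"
        by (cases e) (auto simp: h_def)
    qed (auto simp: h_def choices_def)
  qed
  then have "(\<Sum>c\<in>choices (Suc (Suc (Suc N))). f c) = (\<Sum>c\<in>h True ` ?A. f c) + (\<Sum>c\<in>h False ` ?A. f c)"
    using fin by (simp only:) (subst sum.union_disjoint; auto simp: h_def)
  then show ?thesis
    unfolding sum.reindex[OF inj] by (simp add: sum.distrib h_def)
qed

text \<open>With \<open>j\<close> letters \<open>True\<close> in the middle, a word has
  \<open>j + 1\<close> of them if its last letter is \<open>False\<close> and \<open>j + 2\<close>
  otherwise; these are the denominators of \<open>S1\<close> and \<open>S2\<close>. Absorbing a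
  denominator into the binomial coefficient completes an expansion of
  \<open>(b + b') ^ (N + 1)\<close>, because N + 1 is -2 modulo p.\<close>

lemma char_binomial_sums:
  fixes b b' :: "'f::field"
  assumes p: "CHAR('f) = Suc (Suc (Suc N))"
  defines "S1 \<equiv> \<Sum>j\<le>N. of_nat (N choose j) * (b ^ j * b' ^ (N - j) * (1 / of_nat (Suc j)))"
    and "S2 \<equiv> \<Sum>j\<le>N. of_nat (N choose j) * (b ^ j * b' ^ (N - j) * (1 / of_nat (Suc (Suc j))))"
  shows "2 * (b * S1) = b' ^ Suc N - (b + b') ^ Suc N"
    and "2 * (b' * S2) = (b + b') ^ Suc N - b ^ Suc N"
    and "2 * (b * S2) - 2 * (b' * S1) = - (2 * (b + b') ^ Suc N)"
proof -
  have nz: "of_nat (Suc j) \<noteq> (0 :: 'f)" if "Suc j \<le> Suc (Suc N)" for j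
    using that p of_nat_eq_0_iff_char_dvd[of "Suc j", where ?'a = 'f] by (auto dest: dvd_imp_le)
  \<comment> \<open>The two numbers add up to N + 3 = p.\<close>
  have minus: "of_nat (Suc N - j) = - (of_nat (Suc (Suc j)) :: 'f)" if "j \<le> Suc N" for j
  proof -
    have "of_nat (Suc N - j) + of_nat (Suc (Suc j)) = (of_nat (Suc (Suc (Suc N))) :: 'f)"
      using that by (simp only: of_nat_add[symmetric]) simp
    also have "\<dots> = 0"
      unfolding p[symmetric] by (rule of_nat_CHAR)
    finally show ?thesis
      by (simp only: eq_neg_iff_add_eq_0)
  qed
  have two: "of_nat (Suc N) = (- 2 :: 'f)"
    using minus[of 0] by simp
  have bin: "(b + b') ^ Suc N = (\<Sum>j\<le>Suc N. of_nat (Suc N choose j) * b ^ j * b' ^ (Suc N - j))"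
    by (rule binomial_ring)
  show 1: "2 * (b * S1) = b' ^ Suc N - (b + b') ^ Suc N"
  proof -
    have "(b + b') ^ Suc N = b' ^ Suc N + (\<Sum>j\<le>N. of_nat (Suc N choose Suc j) * b ^ Suc j * b' ^ (N - j))"
      unfolding bin by (subst sum.atMost_Suc_shift) simp
    also have "(\<Sum>j\<le>N. of_nat (Suc N choose Suc j) * b ^ Suc j * b' ^ (N - j)) = of_nat (Suc N) * (b * S1)"
      unfolding S1_def sum_distrib_left
    proof (rule sum.cong[OF refl])
      fix j assume "j \<in> {..N}"
      then have "of_nat (Suc j) \<noteq> (0 :: 'f)"
        by (intro nz) simp
      moreover have "of_nat (Suc j) * of_nat (Suc N choose Suc j) = (of_nat (Suc N) * of_nat (N choose j) :: 'f)"
        by (simp only: of_nat_mult[symmetric] Suc_times_binomial_eq mult.commute)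
      ultimately have "of_nat (Suc N choose Suc j) = (of_nat (Suc N) * of_nat (N choose j) / of_nat (Suc j) :: 'f)"
        by (metis nonzero_eq_divide_eq mult.commute)
      then show "of_nat (Suc N choose Suc j) * b ^ Suc j * b' ^ (N - j) =
          of_nat (Suc N) * (b * (of_nat (N choose j) * (b ^ j * b' ^ (N - j) * (1 / of_nat (Suc j)))))"
        by (simp only:) (simp add: mult_ac del: of_nat_Suc)
    qed
    finally show ?thesis
      unfolding two by simp
  qed
  show 2: "2 * (b' * S2) = (b + b') ^ Suc N - b ^ Suc N"
  proof -
    have "(b + b') ^ Suc N = (\<Sum>j\<le>N. of_nat (Suc N choose j) * b ^ j * b' ^ (Suc N - j)) + b ^ Suc N"
      unfolding bin by simp
    also have "(\<Sum>j\<le>N. of_nat (Suc N choose j) * b ^ j * b' ^ (Suc N - j)) = 2 * (b' * S2)"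
      unfolding S2_def sum_distrib_left
    proof (rule sum.cong[OF refl])
      fix j assume j: "j \<in> {..N}"
      then have j2: "of_nat (Suc (Suc j)) \<noteq> (0 :: 'f)"
        by (intro nz) simp
      have "of_nat (Suc N - j) * of_nat (Suc N choose j) = (of_nat (Suc N) * of_nat (N choose j) :: 'f)"
        using binomial_absorb_comp[of "Suc N" j] by (simp only: of_nat_mult[symmetric] diff_Suc_1)
      moreover have "of_nat (Suc N - j) = - (of_nat (Suc (Suc j)) :: 'f)"
        using j by (intro minus) simp
      ultimately have "of_nat (Suc (Suc j)) * of_nat (Suc N choose j) = (2 * of_nat (N choose j) :: 'f)"
        unfolding two by (simp only: mult_minus_left neg_equal_iff_equal)
      then have "of_nat (Suc N choose j) = (2 * of_nat (N choose j) / of_nat (Suc (Suc j)) :: 'f)"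
        using j2 by (metis nonzero_eq_divide_eq mult.commute)
      moreover have "b' ^ (Suc N - j) = b' * b' ^ (N - j)"
        using j by (simp add: Suc_diff_le)
      ultimately show "of_nat (Suc N choose j) * b ^ j * b' ^ (Suc N - j) =
          2 * (b' * (of_nat (N choose j) * (b ^ j * b' ^ (N - j) * (1 / of_nat (Suc (Suc j))))))"
        by (simp only:) (simp add: mult_ac del: of_nat_Suc)
    qed
    finally show ?thesis
      by simp
  qed
  show "2 * (b * S2) - 2 * (b' * S1) = - (2 * (b + b') ^ Suc N)"
  proof (cases "b = 0 \<or> b' = 0")
    \<comment> \<open>Division by \<open>b * b'\<close> is impossible here, but only an extreme
      summand survives: \<open>j = 0\<close> in \<open>S1\<close> if \<open>b = 0\<close>, and
      \<open>j = N\<close> in \<open>S2\<close> if \<open>b' = 0\<close>.\<close>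
    case True
    have one: "of_nat (Suc 0) = (1 :: 'f)"
      by simp
    have "(of_nat (Suc (Suc N)) :: 'f) = - 1"
      using minus[of N] by (metis Suc_diff_Suc diff_self_eq_0 le_SucI lessI minus_minus of_nat_1 One_nat_def order_refl)
    then have inv: "1 / (of_nat (Suc (Suc N)) :: 'f) = - 1"
      by (simp del: of_nat_Suc)
    consider "b = 0" | "b \<noteq> 0" "b' = 0"
      using True by blast
    then show ?thesis
    proof cases
      case 1
      have "S1 = (\<Sum>j\<le>N. if j = 0 then b' ^ N else 0)"
        unfolding S1_def using 1 by (intro sum.cong) (auto simp: power_0_left)
      then show ?thesis
        using 1 by simp
    next
      case 2
      have "S2 = (\<Sum>j\<le>N. if j = N then b ^ N * (1 / of_nat (Suc (Suc N))) else 0)"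
        unfolding S2_def using 2 by (intro sum.cong) (auto simp: power_0_left one simp del: of_nat_Suc)
      then show ?thesis
        unfolding inv using 2 by simp
    qed
  next
    case False
    have "prime (CHAR('f))"
      using prime_CHAR_semidom[where ?'a = 'f] p by simp
    then have dream: "(b + b') ^ CHAR('f) = b ^ CHAR('f) + b' ^ CHAR('f)"
      by (rule freshmans_dream) (rule refl)
    \<comment> \<open>Multiplying by \<open>b * b'\<close> brings in the first two identities. The
      p-th powers recombine to \<open>(b + b') ^ p\<close>, and
      \<open>b ^ 2 + b' ^ 2 - (b + b') ^ 2\<close> leaves the factor
      \<open>- 2 * b * b'\<close>.\<close>
    have "b * b' * (2 * (b * S2) - 2 * (b' * S1)) = b ^ 2 * (2 * (b' * S2)) - b' ^ 2 * (2 * (b * S1))"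
      by (simp add: power2_eq_square algebra_simps)
    also have "\<dots> = (b ^ 2 + b' ^ 2) * (b + b') ^ Suc N - (b ^ CHAR('f) + b' ^ CHAR('f))"
      unfolding 1 2 p by (simp add: power2_eq_square algebra_simps)
    also have "\<dots> = b * b' * (- (2 * (b + b') ^ Suc N))"
      unfolding dream[symmetric] unfolding p by (simp add: power2_eq_square algebra_simps)
    finally show ?thesis
      using False by (metis mult_left_cancel no_zero_divisors)
  qed
qed

section \<open>A closed formula for the compatible map of a horizontal form\<close>

context twisted_heisenberg
begin

definition horizontal :: "((hindex \<Rightarrow> 'f) \<Rightarrow> (hindex \<Rightarrow> 'f) \<Rightarrow> 'f) \<Rightarrow> bool" where
  "horizontal \<phi> \<longleftrightarrow> \<phi> \<in> C2 g \<and> invariant \<phi> \<and> (\<forall>x\<in>space g. \<phi> (u dd) x = 0)"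

text \<open>
  Modulo \<open>p\<close> the sum over \<open>choices\<close> in the compatibility condition reduces to the binomial sums
  of \<open>char_binomial_sums\<close>, and their closed forms are the polarisation of this expression.
\<close>

definition tilde :: "((hindex \<Rightarrow> 'f) \<Rightarrow> (hindex \<Rightarrow> 'f) \<Rightarrow> 'f) \<Rightarrow> (hindex \<Rightarrow> 'f) \<Rightarrow> 'f" where
  "tilde \<phi> h = (if h \<in> even_part g
     then - (h dd ^ (CHAR('f) - 2) * \<phi> ((D ^^ (CHAR('f) - 2)) h) h) / 2 else 0)"

lemma horizontal_D:
  assumes "horizontal \<phi>" "x \<in> space g" "y \<in> space g"
  shows "\<phi> (D x) y = - \<phi> x (D y)"
proof -
  have "\<phi> (D x) (u dd) = 0"
    using assms(1) C2_skew_even_g[of \<phi> "D x" "u dd", OF _ D_space even_u_dd]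
    by (simp add: horizontal_def)
  then show ?thesis
    using invariant_D[OF _ _ assms(2,3), of \<phi>] assms(1)
    by (simp add: horizontal_def eq_neg_iff_add_eq_0)
qed

lemma horizontal_D_pow:
  assumes "horizontal \<phi>" "x \<in> space g" "y \<in> space g"
  shows "\<phi> ((D ^^ k) x) y = (- 1) ^ k * \<phi> x ((D ^^ k) y)"
  using assms(3)
proof (induction k arbitrary: y)
  case (Suc k)
  have "\<phi> ((D ^^ Suc k) x) y = - \<phi> ((D ^^ k) x) (D y)"
    using horizontal_D[OF assms(1) D_pow_space[OF assms(2)] Suc.prems] by simp
  also have "\<dots> = (- 1) ^ Suc k * \<phi> x ((D ^^ k) (D y))"
    using Suc.IH[of "D y"] by simp
  finally show ?case
    by (simp only: funpow_Suc_right o_apply)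
qed simp

text \<open>An odd power of \<open>D\<close> is skew for \<open>\<phi>\<close>, and
  \<open>\<phi>\<close> is skew on the even part; the two signs cancel.\<close>

lemma horizontal_sym:
  assumes "horizontal \<phi>" "x \<in> even_part g" "y \<in> even_part g" "odd k"
  shows "\<phi> ((D ^^ k) x) y = \<phi> ((D ^^ k) y) x"
  using horizontal_D_pow[OF assms(1) assms(2,3)[THEN homog_space], of k] assms(4)
    C2_skew_even_g[of \<phi> x "(D ^^ k) y"] assms D_pow_homog[OF assms(3)] homog_space[OF assms(2)]
  by (simp add: horizontal_def)

lemma tilde_compatible:
  assumes "horizontal \<phi>"
  shows "compatible g \<phi> (tilde \<phi>)"
proof -
  have C2: "\<phi> \<in> C2 g" and inv: "invariant \<phi>"
    using assms by (simp_all add: horizontal_def)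
  define N where "N = CHAR('f) - 3"
  have p: "CHAR('f) = Suc (Suc (Suc N))"
    using char_gt_2 by (simp add: N_def)
  have N: "even N"
    using odd_char by (simp add: p)
  have "tilde \<phi> (scl a x) = a ^ CHAR('f) * tilde \<phi> x" if "x \<in> even_part g" for a x
    using that homog_space[OF that] homog_scl[OF that, of a]
    unfolding tilde_def D_pow_scl p
    by (simp add: C2_scl_left[OF C2] C2_scl_right[OF C2] D_pow_space
      space_scl power_mult_distrib del: funpow.simps)
  moreover have "tilde \<phi> (x + y) = tilde \<phi> x + tilde \<phi> y + (\<Sum>c\<in>choices CHAR('f).
      1 / of_nat (count_list c True) * \<phi> (lnbrk g (butlast (letters x y c))) (last (letters x y c)))"
    (is "_ = _ + ?S") if x: "x \<in> even_part g" and y: "y \<in> even_part g" for x y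
  proof -
    note s = x[THEN homog_space] y[THEN homog_space]
    \<comment> \<open>A symmetric bilinear form on the even part: the exponent
      \<open>Suc N = p - 2\<close> is odd. In terms of it \<open>tilde \<phi> h\<close> is
      \<open>- (h dd ^ (p - 2) * R h h) / 2\<close>.\<close>
    define R where "R a b = \<phi> ((D ^^ Suc N) a) b" for a b
    define b where "b = x dd"
    define b' where "b' = y dd"
    \<comment> \<open>The bracket of \<open>x\<close> and \<open>y\<close> has no
      \<open>dd\<close>-coordinate, so each middle letter contributes minus its
      \<open>dd\<close>-coordinate and one power of \<open>D\<close>. There are
      \<open>N = p - 3\<close> of them, an even number, so the signs disappear.\<close>
    have T: "\<phi> (lnbrk g (x # y # map (\<lambda>c. if c then x else y) cs)) w =
        (\<Prod>c\<leftarrow>cs. if c then b else b') * (b * R y w - b' * R x w)"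
      if "length cs = N" "w \<in> space g" for cs w
    proof -
      have "(\<Prod>h\<leftarrow>map (\<lambda>c. if c then x else y) cs. - h dd) = (\<Prod>c\<leftarrow>cs. - (if c then b else b'))"
        by (rule arg_cong[of _ _ prod_list]) (simp add: b_def b'_def)
      also have "\<dots> = (\<Prod>c\<leftarrow>cs. if c then b else b')"
        unfolding prod_list_minus using N that by simp
      finally show ?thesis
        using C2_foldl_brk[OF C2 inv that(2), of "brk g x y" "map (\<lambda>c. if c then x else y) cs"]
          C2_D_pow_brk[OF C2 inv s that(2), of N] s that(1)
        by (auto simp: lnbrk_def brk_space brk_dd R_def b_def b'_def)
    qed
    define A1 where "A1 = b * R y x - b' * R x x"
    define A2 where "A2 = b * R y y - b' * R x y"
    have term_eq: "1 / of_nat (count_list (True # False # cs @ [e]) True) *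
          \<phi> (lnbrk g (butlast (letters x y (True # False # cs @ [e])))) (last (letters x y (True # False # cs @ [e])))
        = (if e then 1 / of_nat (Suc (Suc (count_list cs True))) * A1 else 1 / of_nat (Suc (count_list cs True)) * A2)
          * (\<Prod>c\<leftarrow>cs. if c then b else b')" if "length cs = N" for cs e
    proof -
      have "butlast (letters x y (True # False # cs @ [e])) = x # y # map (\<lambda>c. if c then x else y) cs"
        "last (letters x y (True # False # cs @ [e])) = (if e then x else y)"
        by (simp_all add: letters_def butlast_append)
      then show ?thesis
        using T[OF that s(1)] T[OF that s(2)] by (simp add: A1_def A2_def)
    qed
    define S1 where "S1 = (\<Sum>j\<le>N. of_nat (N choose j) * (b ^ j * b' ^ (N - j) * (1 / of_nat (Suc j))))"
    define S2 where "S2 = (\<Sum>j\<le>N. of_nat (N choose j) * (b ^ j * b' ^ (N - j) * (1 / of_nat (Suc (Suc j)))))"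
    have "?S = (\<Sum>cs\<in>{cs. length cs = N}.
        (1 / of_nat (Suc (Suc (count_list cs True))) * A1 + 1 / of_nat (Suc (count_list cs True)) * A2)
        * (\<Prod>c\<leftarrow>cs. if c then b else b'))"
      unfolding p sum_choices by (rule sum.cong[OF refl]) (simp only: mem_Collect_eq term_eq if_True if_False distrib_right)
    also have "\<dots> = (\<Sum>j\<le>N. of_nat (N choose j) * (b ^ j * b' ^ (N - j) *
        (1 / of_nat (Suc (Suc j)) * A1 + 1 / of_nat (Suc j) * A2)))"
      by (rule sum_bool_lists)
    also have "\<dots> = S2 * A1 + S1 * A2"
      unfolding S1_def S2_def sum_distrib_right sum.distrib[symmetric]
      by (rule sum.cong[OF refl]) (simp only: distrib_left mult.assoc)
    finally have S: "?S = S2 * A1 + S1 * A2" .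
    have sym: "R y x = R x y"
      unfolding R_def by (rule horizontal_sym[OF assms y x]) (simp add: N)
    have sums: "2 * (b * S1) = b' ^ Suc N - (b + b') ^ Suc N" "2 * (b' * S2) = (b + b') ^ Suc N - b ^ Suc N"
      "2 * (b * S2) - 2 * (b' * S1) = - (2 * (b + b') ^ Suc N)"
      unfolding S1_def S2_def by (rule char_binomial_sums[OF p])+
    have S12: "2 * (S2 * A1 + S1 * A2) = (2 * (b * S2) - 2 * (b' * S1)) * R x y - (2 * (b' * S2)) * R x x + (2 * (b * S1)) * R y y"
      unfolding A1_def A2_def sym by (simp add: algebra_simps)
    have S': "2 * ?S = - (2 * (b + b') ^ Suc N) * R x y - ((b + b') ^ Suc N - b ^ Suc N) * R x x
        + (b' ^ Suc N - (b + b') ^ Suc N) * R y y"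
      unfolding S S12 sums(3) sums(1) sums(2) by (rule refl)
    have t: "2 * tilde \<phi> h = - (h dd ^ Suc N * R h h)" if "h \<in> even_part g" for h
    proof -
      have k: "CHAR('f) - 2 = Suc N"
        by (simp add: p)
      have "tilde \<phi> h = - (h dd ^ Suc N * R h h) / 2"
        unfolding tilde_def R_def k by (simp only: that if_True)
      then show ?thesis
        using two_nonzero by (simp only: times_divide_eq_right nonzero_mult_div_cancel_left not_False_eq_True)
    qed
    have "R (x + y) (x + y) = (R x x + R x y) + (R y x + R y y)"
      unfolding R_def D_pow_add using s
      by (simp only: C2_add_left[OF C2] C2_add_right[OF C2] D_pow_space space_add add_ac)
    then have "R (x + y) (x + y) = R x x + 2 * R x y + R y y"
      unfolding sym by simp
    moreover have "(x + y) dd = b + b'"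
      by (simp add: b_def b'_def)
    ultimately have t3: "2 * tilde \<phi> (x + y) = - ((b + b') ^ Suc N * (R x x + 2 * R x y + R y y))"
      unfolding t[OF homog_add[OF x y]] by (simp only:)
    \<comment> \<open>Everything is doubled to clear the denominator 2; what remains is the
      expansion of \<open>R (x + y) (x + y)\<close>.\<close>
    have "2 * tilde \<phi> (x + y) = 2 * (tilde \<phi> x + tilde \<phi> y + ?S)"
      unfolding distrib_left t3 t[OF x] t[OF y] S' b_def[symmetric] b'_def[symmetric]
      by (simp add: algebra_simps del: power_Suc)
    then show ?thesis
      unfolding mult_left_cancel[OF two_nonzero] .
  qed
  moreover have "tilde \<phi> x = 0" if "x \<notin> even_part g" for x
    using that by (simp add: tilde_def)
  ultimately show ?thesis
    unfolding compatible_def by blast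
qed

text \<open>\<open>D\<close> kills \<open>dd\<close>, and every other even basis vector has
  \<open>dd\<close>-coordinate 0, which enters with the positive exponent p - 2.\<close>

lemma tilde_unit:
  assumes "horizontal \<phi>" "i \<in> {1..2*m+2}"
  shows "tilde \<phi> (u (E i)) = 0"
proof (cases "E i = dd")
  case True
  obtain q where q: "CHAR('f) - 2 = Suc q"
    using char_gt_2 by (metis Suc_diff_Suc)
  have C2: "\<phi> \<in> C2 g"
    using assms by (simp add: horizontal_def)
  have "D (u dd) = 0"
    by (simp only: D_unit fixed_simps scl_simps)
  moreover have "(D ^^ k) 0 = 0" for k
    by (induction k) (simp_all only: funpow_0 funpow.simps o_apply D_zero id_apply)
  ultimately have "(D ^^ (CHAR('f) - 2)) (u dd) = 0"
    by (simp only: q funpow_Suc_right o_apply)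
  then show ?thesis
    unfolding True tilde_def using C2_zero_left[OF C2, of "u dd"]
    by (simp only: fixed_simps space_u mult_zero_right minus_zero) simp
next
  case False
  then have "u (E i) dd = 0"
    by (auto simp: unit_vector_def)
  then show ?thesis
    using char_gt_2 by (simp add: tilde_def power_0_left)
qed

lemma compatible_unique_g:
  assumes "compatible g \<phi> \<omega>" "compatible g \<phi> \<omega>'"
    and "\<And>i. i \<in> {1..2*m+2} \<Longrightarrow> \<omega> (u (E i)) = \<omega>' (u (E i))"
  shows "\<omega> = \<omega>'"
proof (rule compatible_unique[OF _ _ assms(1,2)])
  fix b assume "b \<in> bas g" "par g b = 0"
  then show "\<omega> (u b) = \<omega>' (u b)"
    using assms(3) by (cases b) auto
qed (use char_gt_2 in auto)

lemma heis_tilde_eq: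
  assumes "horizontal \<phi>"
  shows "heis_tilde m g \<phi> = tilde \<phi>"
  unfolding heis_tilde_def
proof (rule the_equality)
  show "compatible g \<phi> (tilde \<phi>) \<and> (\<forall>i\<in>{1..2*m+2}. tilde \<phi> (u (E i)) = 0)"
    using tilde_compatible tilde_unit assms by blast
  fix \<omega> assume "compatible g \<phi> \<omega> \<and> (\<forall>i\<in>{1..2*m+2}. \<omega> (u (E i)) = 0)"
  then show "\<omega> = tilde \<phi>"
    using tilde_compatible[OF assms] tilde_unit[OF assms] by (intro compatible_unique_g) auto
qed

text \<open>
  If \<open>b\<close> and \<open>c\<close> are some \<open>Y k\<close>, then \<open>ev b * inverse (ev c) = 0\<close> and \<open>form b c\<close> is just the dual
  vector. All elements of \<open>A1\<close>, \<open>A2\<close>, \<open>A3\<close>, \<open>A4\<close> are therefore 0 or of the shape \<open>form b c\<close>.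
\<close>

definition form :: "hindex \<Rightarrow> hindex \<Rightarrow> (hindex \<Rightarrow> 'f) \<Rightarrow> (hindex \<Rightarrow> 'f) \<Rightarrow> 'f" where
  "form b c = dual_wedge g b c - scl_form (ev b * inverse (ev c)) (dual_wedge g (sw b) (sw c))"

text \<open>For an odd \<open>b\<close> the skew-symmetrised product of coordinates at
  \<open>(b, b)\<close> is twice the dual vector. The factor 1/2 allows one formula for all
  pairs.\<close>

definition fac :: "hindex \<Rightarrow> hindex \<Rightarrow> 'f" where
  "fac b c = (if b = c \<and> hpar b = 1 then 1 / 2 else 1)"

lemma fac_nonzero: "fac b c \<noteq> 0"
  using two_nonzero by (simp add: fac_def)

lemma fac_sw: "fac (sw b) (sw c) = fac b c"
  by (simp add: fac_def)

lemma dual_wedge_eq: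
  assumes "x \<in> space g" "y \<in> space g"
  shows "dual_wedge g b c x y = fac b c * (x b * y c - (- 1) ^ (hpar b * hpar c) * (x c * y b))"
proof (cases "b = c")
  case True
  have "hpar b = 0 \<or> hpar b = 1"
    by (cases b) auto
  then show ?thesis
    using True assms two_nonzero by (auto simp: dual_wedge_def fac_def)
qed (use assms in \<open>simp add: dual_wedge_def fac_def\<close>)

lemma dual_wedge_C2: "dual_wedge g b c \<in> C2 g"
proof (rule C2I)
  have "bilinear_form g (\<lambda>x y. fac b c * (x b * y c + - ((- 1) ^ (hpar b * hpar c)) * (x c * y b)))"
    by (rule bilinear_mult[OF bilinear_plus[OF bilinear_tensor[OF linear_form_coord linear_form_coord]
      bilinear_mult[OF bilinear_tensor[OF linear_form_coord linear_form_coord]]]])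
  then show "bilinear_form g (dual_wedge g b c)"
    by (rule bilinear_cong) (simp add: dual_wedge_eq)
  fix i j :: nat and x y assume h: "i \<le> 1" "j \<le> 1" "x \<in> homog g i" "y \<in> homog g j"
  note s = h(3,4)[THEN homog_space]
  have par: "x a \<noteq> 0 \<Longrightarrow> hpar a = i" "y a \<noteq> 0 \<Longrightarrow> hpar a = j" for a
    using h(3,4) unfolding homog_def by auto
  have sq: "(- 1) ^ k * ((- 1) ^ k * v) = (v :: 'f)" for k :: nat and v
    by (cases "even k") simp_all
  have 1: "x b * y c = (- 1) ^ (i * j) * ((- 1) ^ (hpar b * hpar c) * (y c * x b))"
  proof (cases "x b = 0 \<or> y c = 0")
    case False
    then have "hpar b = i" "hpar c = j"
      using par by blast+
    then show ?thesis
      by (simp only: sq) (rule mult.commute)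
  qed auto
  have 2: "(- 1) ^ (hpar b * hpar c) * (x c * y b) = (- 1) ^ (i * j) * (y b * x c)"
  proof (cases "x c = 0 \<or> y b = 0")
    case False
    then have "hpar c = i" "hpar b = j"
      using par by blast+
    then show ?thesis
      by (simp only: mult.commute)
  qed auto
  show "dual_wedge g b c x y = - ((- 1) ^ (i * j) * dual_wedge g b c y x)"
    unfolding dual_wedge_eq[OF s] dual_wedge_eq[OF s(2,1)] 1 2 by (simp add: algebra_simps)
qed (auto simp: dual_wedge_def)

lemma form_C2: "form b c \<in> C2 g"
proof -
  have "form b c = dual_wedge g b c
      + (\<lambda>x y. - (ev b * inverse (ev c)) * dual_wedge g (sw b) (sw c) x y)"
    by (auto simp: form_def scl_form_def fun_eq_iff)
  then show ?thesis
    using C2_add[OF dual_wedge_C2 C2_scl[OF dual_wedge_C2]] by metis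
qed

lemma form_eq:
  assumes "x \<in> space g" "y \<in> space g"
  shows "form b c x y = fac b c * (x b * y c - (- 1) ^ (hpar b * hpar c) * (x c * y b)
    - ev b * inverse (ev c) * (x (sw b) * y (sw c) - (- 1) ^ (hpar b * hpar c) * (x (sw c) * y (sw b))))"
  unfolding form_def scl_form_def minus_apply dual_wedge_eq[OF assms] fac_sw hpar_sw
  by (simp only: right_diff_distrib mult.left_commute[of _ "fac b c"])

text \<open>Put \<open>r = ev b / ev c\<close>. Equality of the weights up to sign gives both
  \<open>r * ev c = ev b\<close> and \<open>r * ev b = ev c\<close>, which annihilate the four
  coefficients that arise. If \<open>ev c = 0\<close>, both weights are 0 and \<open>D\<close>
  contributes nothing.\<close>

lemma form_D:
  assumes "x \<in> space g" "y \<in> space g" "eq_pm (ev b) (ev c)"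
  shows "form b c (D x) y + form b c x (D y) = 0"
proof (cases "ev c = 0")
  case True
  have "ev b = 0"
    using assms(3) unfolding eq_pm_def True minus_zero by blast
  then show ?thesis
    unfolding form_eq[OF D_space assms(2)] form_eq[OF assms(1) D_space] True by (simp add: D_def True)
next
  case False
  define r where "r = ev b * inverse (ev c)"
  have r: "r * ev c = ev b" "r * ev b = ev c"
    using False assms(3) unfolding r_def eq_pm_def by (elim disjE; simp)+
  have "K * (e * xb' * yc - s * (f * xc' * yb) - r * (e * xb * yc' - s * (f * xc * yb')))
      + K * (xb * (f * yc') - s * (xc * (e * yb')) - r * (xb' * (f * yc) - s * (xc' * (e * yb))))
    = K * ((e - r * f) * xb' * yc + s * (r * f - e) * xc * yb' + (f - r * e) * xb * yc' + s * (r * e - f) * xc' * yb)"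
    for K e f s xb xc xb' xc' yb yc yb' yc' :: 'f
    by (simp add: algebra_simps)
  note identity = this
  show ?thesis
    unfolding form_eq[OF D_space assms(2)] form_eq[OF assms(1) D_space] r_def[symmetric]
    unfolding D_def sw_sw ev_sw identity r by simp
qed

lemma form_horizontal:
  assumes "eq_pm (ev b) (ev c)" "b \<notin> {zz, dd}" "c \<notin> {zz, dd}"
  shows "horizontal (form b c)"
proof -
  have sw: "sw b \<notin> {zz, dd}" "sw c \<notin> {zz, dd}"
    using assms(2,3) by (metis fixed_simps(5,6) insert_iff singletonD sw_sw)+
  have z: "form b c (u zz) y = 0" "form b c (u dd) y = 0" if "y \<in> space g" for y
    unfolding form_eq[OF space_u[OF fixed_simps(1)] that] form_eq[OF space_u[OF fixed_simps(2)] that]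
    using assms(2,3) sw by (simp_all add: unit_vector_def)
  have "ev b' * form b c (u (sw b')) (u c') + ev c' * form b c (u b') (u (sw c')) = 0"
    if "b' \<in> hbas m n t" "c' \<in> hbas m n t" for b' c'
    using form_D[OF space_u[OF that(1)] space_u[OF that(2)] assms(1)] that
    by (simp add: D_unit C2_scl_left[OF form_C2] C2_scl_right[OF form_C2] del: scl_simps(5))
  then show ?thesis
    using z form_C2 by (simp add: horizontal_def invariant_def)
qed

section \<open>Coboundaries\<close>

lemma pr_pr [simp]: "pr (pr b) = b"
  by (cases b) auto

lemma hpar_pr [simp]: "hpar (pr b) = hpar b"
  by (cases b) auto

lemma ev_pr [simp]: "ev (pr b) = ev b"
  by (cases b) auto

lemma pr_sw: "pr (sw b) = sw (pr b)"
  by (cases b) auto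

lemma sg_pr: "sg (pr b) = - ((- 1) ^ (hpar b * hpar b) * sg b)"
  by (cases b) auto

lemma sg_sw: "ev b \<noteq> 0 \<Longrightarrow> sg (sw b) = - sg b"
  by (cases b) (auto split: if_splits)

lemma BB_skew_unit:
  assumes "b \<in> hbas m n t" "c \<in> hbas m n t"
  shows "BB (u b) (u c) = - ((- 1) ^ (hpar b * hpar c) * BB (u c) (u b))"
proof (cases "c = pr b")
  case True
  have "sg b = - ((- 1) ^ (hpar b * hpar b) * sg (pr b))"
    using sg_pr[of "pr b"] by simp
  then show ?thesis
    using True assms by (simp add: BB_unit)
next
  case False
  then have "b \<noteq> pr c"
    by auto
  then show ?thesis
    using False assms by (simp add: BB_unit)
qed

lemma BB_skew:
  assumes "x \<in> homog g i" "y \<in> homog g j"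
  shows "BB x y = - ((- 1) ^ (i * j) * BB y x)"
proof -
  have "bilinear_form g (\<lambda>x y. - ((- 1) ^ (i * j) * BB y x))"
    by (rule bilinear_minus[OF bilinear_mult[OF bilinear_swap[OF BB_bilinear]]])
  note eqI = bilinear_eqI_g[OF BB_bilinear this assms[THEN homog_space]]
  show ?thesis
  proof (rule eqI)
    fix b c assume bc: "b \<in> hbas m n t" "c \<in> hbas m n t" "x b \<noteq> 0" "y c \<noteq> 0"
    then have "hpar b = i" "hpar c = j"
      using assms unfolding homog_def by auto
    then show "BB (u b) (u c) = - ((- 1) ^ (i * j) * BB (u c) (u b))"
      using BB_skew_unit[OF bc(1,2)] by blast
  qed
qed

lemma C1_linear: "\<psi> \<in> C1 g \<Longrightarrow> linear_form g \<psi>"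
  by (simp add: C1_def)

lemma d1_eq:
  assumes "\<psi> \<in> C1 g" "x \<in> space g" "y \<in> space g"
  shows "d1 g \<psi> x y = BB x y * \<psi> (u zz) + x dd * \<psi> (D y) - y dd * \<psi> (D x)"
proof -
  note lf = C1_linear[OF assms(1)]
  have s: "scl (BB x y) (u zz) \<in> space g" "scl (x dd) (D y) \<in> space g" "scl (y dd) (D x) \<in> space g"
    by (intro space_scl; simp)+
  have "d1 g \<psi> x y = \<psi> (scl (BB x y) (u zz) + scl (x dd) (D y) - scl (y dd) (D x))"
    unfolding d1_def brk_eq[OF assms(2,3)] using assms(2,3) by simp
  also have "\<dots> = \<psi> (scl (BB x y) (u zz)) + \<psi> (scl (x dd) (D y)) - \<psi> (scl (y dd) (D x))"
    using linear_form_diff[OF lf space_add[OF s(1,2)] s(3)] linear_form_add[OF lf s(1,2)] by simp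
  also have "\<dots> = BB x y * \<psi> (u zz) + x dd * \<psi> (D y) - y dd * \<psi> (D x)"
    using linear_form_scl[OF lf] by simp
  finally show ?thesis .
qed

lemma d1_C2:
  assumes "\<psi> \<in> C1 g"
  shows "d1 g \<psi> \<in> C2 g"
proof (rule C2I)
  have "bilinear_form g (\<lambda>x y. \<psi> (u zz) * BB x y + (x dd * \<psi> (D y) + - (\<psi> (D x) * y dd)))"
    using linear_form_comp[OF C1_linear[OF assms] D_endo]
    by (intro bilinear_plus[OF bilinear_mult[OF BB_bilinear]] bilinear_plus[OF
      bilinear_tensor[OF linear_form_coord] bilinear_minus[OF bilinear_tensor[OF _ linear_form_coord]]])
  then show "bilinear_form g (d1 g \<psi>)"
    by (rule bilinear_cong) (simp add: d1_eq[OF assms])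
  fix i j :: nat and x y assume h: "i \<le> 1" "j \<le> 1" "x \<in> homog g i" "y \<in> homog g j"
  note s = h(3,4)[THEN homog_space]
  have "x dd = 0 \<or> i = 0" "y dd = 0 \<or> j = 0"
    using h unfolding homog_def by auto
  then have 1: "x dd * (- 1) ^ (i * j) = x dd" "y dd * (- 1) ^ (i * j) = y dd"
    by auto
  have "s * (p + y dd * q - x dd * r) = s * p + y dd * s * q - x dd * s * r" for s p q r
    by (simp add: algebra_simps)
  note 2 = this[of "(- 1) ^ (i * j)"]
  show "d1 g \<psi> x y = - ((- 1) ^ (i * j) * d1 g \<psi> y x)"
    unfolding d1_eq[OF assms s] d1_eq[OF assms s(2,1)] BB_skew[OF h(3,4)]
    unfolding 2 1 by simp
qed (auto simp: d1_def)

lemma d1_unit: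
  assumes "\<psi> \<in> C1 g" "b \<in> hbas m n t" "c \<in> hbas m n t"
  shows "d1 g \<psi> (u b) (u c) = (if c = pr b then sg b else 0) * \<psi> (u zz)
    + (if b = dd then 1 else 0) * (ev c * \<psi> (u (sw c))) - (if c = dd then 1 else 0) * (ev b * \<psi> (u (sw b)))"
proof -
  have "u b dd = (if b = dd then 1 else 0)" "u c dd = (if c = dd then 1 else 0)"
    by (auto simp: unit_vector_def)
  moreover have "\<psi> (D (u a)) = ev a * \<psi> (u (sw a))" if "a \<in> hbas m n t" for a
    unfolding D_unit using linear_form_scl[OF C1_linear[OF assms(1)]] that by simp
  ultimately show ?thesis
    using assms by (simp add: d1_eq BB_unit)
qed

text \<open>Away from \<open>dd\<close> a bracket has only its \<open>BB\<close> component along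
  \<open>zz\<close>. This component is invariant under \<open>D\<close> because \<open>sg\<close>
  changes sign under \<open>sw\<close> on vectors of nonzero weight.\<close>

lemma d1_invariant:
  assumes "\<psi> \<in> C1 g"
  shows "invariant (d1 g \<psi>)"
proof -
  have "ev b * d1 g \<psi> (u (sw b)) (u c) + ev c * d1 g \<psi> (u b) (u (sw c)) = 0"
    if bc: "b \<in> hbas m n t" "c \<in> hbas m n t" "b \<noteq> dd" "c \<noteq> dd" for b c
  proof -
    have dd: "sw b \<noteq> dd" "sw c \<noteq> dd"
      using bc by (metis fixed_simps(6) sw_sw)+
    have e: "d1 g \<psi> (u (sw b)) (u c) = (if c = sw (pr b) then sg (sw b) else 0) * \<psi> (u zz)"
      "d1 g \<psi> (u b) (u (sw c)) = (if sw c = pr b then sg b else 0) * \<psi> (u zz)"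
      using bc dd by (simp_all add: d1_unit[OF assms] pr_sw)
    have "ev b * (if c = sw (pr b) then sg (sw b) else 0) + ev c * (if sw c = pr b then sg b else 0) = 0"
    proof (cases "c = sw (pr b)")
      case True
      then have "ev c = ev b" "sw c = pr b"
        by simp_all
      then show ?thesis
        using True sg_sw[of b] by (cases "ev b = 0") simp_all
    next
      case False
      then have "sw c \<noteq> pr b"
        by (metis sw_sw)
      then show ?thesis
        using False by simp
    qed
    then show ?thesis
      unfolding e mult.assoc[symmetric] distrib_right[symmetric] by simp
  qed
  moreover have "d1 g \<psi> (u zz) (u b) = 0" if "b \<in> hbas m n t" for b
    using that by (simp add: d1_unit[OF assms])
  ultimately show ?thesis
    by (simp add: invariant_def)
qed

lemma lnbrk_space:
  assumes "xs \<noteq> []" "set xs \<subseteq> space g"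
  shows "lnbrk g xs \<in> space g"
proof -
  have "w \<in> space g \<Longrightarrow> set hs \<subseteq> space g \<Longrightarrow> foldl (brk g) w hs \<in> space g" for w hs
    by (induction hs arbitrary: w) (auto intro: brk_space)
  then show ?thesis
    using assms by (cases xs) (auto simp: lnbrk_def)
qed

lemma linear_form_of_basis:
  obtains \<psi> where "\<psi> \<in> C1 g" "\<And>b. b \<in> hbas m n t \<Longrightarrow> \<psi> (u b) = h b"
proof
  define \<psi> where "\<psi> x = (if x \<in> space g then \<Sum>b\<in>hbas m n t. x b * h b else 0)" for x
  show "\<psi> \<in> C1 g"
    unfolding C1_def linear_form_def
    by (auto simp: \<psi>_def space_add space_scl algebra_simps sum.distrib sum_distrib_left)
  fix b assume b: "b \<in> hbas m n t"
  have "(\<Sum>c\<in>hbas m n t. u b c * h c) = (\<Sum>c\<in>hbas m n t. if c = b then h b else 0)"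
    by (intro sum.cong) (auto simp: unit_vector_def)
  then show "\<psi> (u b) = h b"
    using b by (simp add: \<psi>_def)
qed

end

context restricted_heisenberg
begin

text \<open>Applying \<open>\<psi>\<close> to the additivity formula of the p-operator yields the
  compatibility condition term by term, since \<open>\<psi>\<close> of a bracket is
  \<open>d1 g \<psi>\<close> at its two factors.\<close>

lemma ind1_compatible:
  assumes "\<psi> \<in> C1 g"
  shows "compatible g (d1 g \<psi>) (ind1 g P \<psi>)"
proof -
  note lf = C1_linear[OF assms]
  have Ps: "P x \<in> space g" if "x \<in> even_part g" for x
    using P_even[OF that] by (rule homog_space)
  have R: "P (scl a x) = scl (a ^ CHAR('f)) (P x)"
    "P (x + y) = P x + P y + (\<Sum>c\<in>choices CHAR('f).
       scl (1 / of_nat (count_list c True)) (lnbrk g (letters x y c)))"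
    if "x \<in> even_part g" "y \<in> even_part g" for a x y
    using restricted that unfolding heis_restricted_def restricted_structure_def by blast+
  have "ind1 g P \<psi> (scl a x) = a ^ CHAR('f) * ind1 g P \<psi> x" if "x \<in> even_part g" for a x
    using R(1)[OF that that] homog_scl[OF that, of a] that linear_form_scl[OF lf Ps[OF that]]
    by (simp add: ind1_def)
  moreover have "ind1 g P \<psi> (x + y) = ind1 g P \<psi> x + ind1 g P \<psi> y + (\<Sum>c\<in>choices CHAR('f).
       1 / of_nat (count_list c True) *
       d1 g \<psi> (lnbrk g (butlast (letters x y c))) (last (letters x y c)))"
    if x: "x \<in> even_part g" and y: "y \<in> even_part g" for x y
  proof -
    have c: "lnbrk g (letters x y c) \<in> space g"
      "\<psi> (lnbrk g (letters x y c)) = d1 g \<psi> (lnbrk g (butlast (letters x y c))) (last (letters x y c))"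
      if "c \<in> choices CHAR('f)" for c
    proof -
      have len: "length (letters x y c) > 2"
        using that char_gt_2 by (simp add: choices_def letters_def)
      have sub: "set (letters x y c) \<subseteq> space g"
        using x y by (auto simp: letters_def dest: homog_space)
      have ne: "letters x y c \<noteq> []" "butlast (letters x y c) \<noteq> []"
        using len by (auto simp flip: length_greater_0_conv)
      then have s: "lnbrk g (butlast (letters x y c)) \<in> space g" "last (letters x y c) \<in> space g"
        using sub by (auto intro!: lnbrk_space dest: in_set_butlastD)
      show "lnbrk g (letters x y c) \<in> space g"
        using ne(1) sub by (rule lnbrk_space)
      show "\<psi> (lnbrk g (letters x y c)) = d1 g \<psi> (lnbrk g (butlast (letters x y c))) (last (letters x y c))"
        using lnbrk_snoc[of "letters x y c" g] len s by (simp add: d1_def)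
    qed
    let ?h = "\<lambda>c. scl (1 / of_nat (count_list c True)) (lnbrk g (letters x y c))"
    have hs: "?h c \<in> space g" if "c \<in> choices CHAR('f)" for c
      using c(1)[OF that] by (rule space_scl)
    have "\<psi> (sum ?h (choices CHAR('f))) = (\<Sum>c\<in>choices CHAR('f). \<psi> (?h c))"
      by (rule linear_form_sum[OF lf hs])
    also have "\<dots> = (\<Sum>c\<in>choices CHAR('f). 1 / of_nat (count_list c True) *
       d1 g \<psi> (lnbrk g (butlast (letters x y c))) (last (letters x y c)))"
      using c linear_form_scl[OF lf] by (intro sum.cong) auto
    finally have sum: "\<psi> (sum ?h (choices CHAR('f))) = \<dots>" .
    have "\<psi> (P (x + y)) = \<psi> (P x) + \<psi> (P y) + \<psi> (sum ?h (choices CHAR('f)))"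
      unfolding R(2)[OF x y]
      using linear_form_add[OF lf space_add[OF Ps[OF x] Ps[OF y]] space_sum[OF hs]]
        linear_form_add[OF lf Ps[OF x] Ps[OF y]] by (simp only:)
    then show ?thesis
      using x y homog_add[OF x y] unfolding sum by (simp add: ind1_def)
  qed
  moreover have "ind1 g P \<psi> x = 0" if "x \<notin> even_part g" for x
    using that by (simp add: ind1_def)
  ultimately show ?thesis
    unfolding compatible_def by blast
qed

lemma B2_Z2: "B2_res g P \<subseteq> Z2_res g P"
proof
  fix c assume "c \<in> B2_res g P"
  then obtain \<psi> where \<psi>: "\<psi> \<in> C1 g" "c = (d1 g \<psi>, ind1 g P \<psi>)"
    by (auto simp: B2_res_def d1_res_def)
  moreover have "d1 g \<psi> (u (Y k)) (u dd) = 0" if "k \<in> {1..t}" for k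
    using that by (simp add: d1_unit[OF \<psi>(1)])
  ultimately show "c \<in> Z2_res g P"
    using d1_C2 d1_invariant ind1_compatible by (simp add: Z2_iff)
qed

end

section \<open>A dual system for the cohomology\<close>

lemma eq_pm_refl [simp]: "eq_pm x x"
  by (auto simp: eq_pm_def)

lemma eq_pm_iff: "eq_pm x y \<longleftrightarrow> x * x = y * y" for x y :: "'f::field"
  by (auto simp: eq_pm_def square_eq_iff)

context twisted_heisenberg
begin

text \<open>One pair for each class. The pairs \<open>(W i, W (n + i))\<close> are absent because
  their forms are 0, and \<open>(Y t, Y t)\<close> because the coboundary \<open>BB\<close>
  expresses its class through the others.\<close>

definition reps_even :: "(hindex \<times> hindex) set" where
  "reps_even =
     {(E i, E j) | i j. 1 \<le> i \<and> i < j \<and> j \<le> m \<and> eq_pm (lam i) (lam j)} \<union>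
     {(E i, E (m + j)) | i j. 1 \<le> i \<and> i \<le> j \<and> j \<le> m \<and> eq_pm (lam i) (lam j)} \<union>
     {(W i, W j) | i j. 1 \<le> i \<and> i \<le> j \<and> j \<le> n \<and> eq_pm (kap i) (kap j)} \<union>
     {(W i, W (n + j)) | i j. 1 \<le> i \<and> i < j \<and> j \<le> n \<and> eq_pm (kap i) (kap j)} \<union>
     {(Y i, Y i) | i. 1 \<le> i \<and> i \<le> t - 1} \<union>
     {(Y i, Y j) | i j. 1 \<le> i \<and> i < j \<and> j \<le> t}"

definition reps_odd :: "(hindex \<times> hindex) set" where
  "reps_odd =
     {(E (m + i), W j) | i j. 1 \<le> i \<and> i \<le> m \<and> 1 \<le> j \<and> j \<le> n \<and> eq_pm (lam i) (kap j)} \<union>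
     {(E i, W j) | i j. 1 \<le> i \<and> i \<le> m \<and> 1 \<le> j \<and> j \<le> n \<and> eq_pm (lam i) (kap j)}"

lemma reps_props:
  assumes "(b, c) \<in> reps_even \<union> reps_odd"
  shows "b \<in> hbas m n t" "c \<in> hbas m n t" "b \<notin> {zz, dd}" "c \<notin> {zz, dd}" "eq_pm (ev b) (ev c)"
    "(b, c) \<noteq> (Y t, Y t)"
  using assms t_pos by (auto simp: reps_even_def reps_odd_def)

lemma reps_even_par: "(b, c) \<in> reps_even \<Longrightarrow> hpar b = hpar c"
  and reps_odd_par: "(b, c) \<in> reps_odd \<Longrightarrow> hpar b = 0 \<and> hpar c = 1"
  by (auto simp: reps_even_def reps_odd_def)

lemma reps_horizontal: "(b, c) \<in> reps_even \<union> reps_odd \<Longrightarrow> horizontal (form b c)"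
  using reps_props by (intro form_horizontal) blast+

lemma form_unit:
  assumes "b' \<in> hbas m n t" "c' \<in> hbas m n t"
  shows "form b c (u b') (u c') = fac b c *
    (of_bool (b = b' \<and> c = c') - (- 1) ^ (hpar b * hpar c) * of_bool (c = b' \<and> b = c')
     - ev b * inverse (ev c) * (of_bool (sw b = b' \<and> sw c = c')
       - (- 1) ^ (hpar b * hpar c) * of_bool (sw c = b' \<and> sw b = c')))"
proof -
  have "u a x = of_bool (x = a)" for a x
    by (simp add: unit_vector_def)
  then show ?thesis
    unfolding form_eq[OF space_u[OF assms(1)] space_u[OF assms(2)]] by (simp only: of_bool_conj)
qed

lemma reps_cases [consumes 1, case_names 1 2 3 4 5 6 7 8]:
  assumes "(b, c) \<in> reps_even \<union> reps_odd"
  obtains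
    (1) i j where "b = E i" "c = E j" "1 \<le> i" "i < j" "j \<le> m" "eq_pm (lam i) (lam j)"
  | (2) i j where "b = E i" "c = E (m + j)" "1 \<le> i" "i \<le> j" "j \<le> m" "eq_pm (lam i) (lam j)"
  | (3) i j where "b = E (m + i)" "c = W j" "1 \<le> i" "i \<le> m" "1 \<le> j" "j \<le> n" "eq_pm (lam i) (kap j)"
  | (4) i j where "b = E i" "c = W j" "1 \<le> i" "i \<le> m" "1 \<le> j" "j \<le> n" "eq_pm (lam i) (kap j)"
  | (5) i j where "b = W i" "c = W j" "1 \<le> i" "i \<le> j" "j \<le> n" "eq_pm (kap i) (kap j)"
  | (6) i j where "b = W i" "c = W (n + j)" "1 \<le> i" "i < j" "j \<le> n" "eq_pm (kap i) (kap j)"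
  | (7) i where "b = Y i" "c = Y i" "1 \<le> i" "i \<le> t - 1"
  | (8) i j where "b = Y i" "c = Y j" "1 \<le> i" "i < j" "j \<le> t"
  using assms unfolding reps_even_def reps_odd_def
  by (elim UnE CollectE exE conjE Pair_inject)
    ((rule that(1); assumption) | (rule that(2); assumption) | (rule that(3); assumption) |
      (rule that(4); assumption) | (rule that(5); assumption) | (rule that(6); assumption) |
      (rule that(7); assumption) | (rule that(8); assumption))+

lemma reps_mem:
  "(E a, E b) \<in> reps_even \<union> reps_odd \<longleftrightarrow> (1 \<le> a \<and> a < b \<and> b \<le> m \<and> eq_pm (lam a) (lam b)) \<or>
    (\<exists>j. b = m + j \<and> 1 \<le> a \<and> a \<le> j \<and> j \<le> m \<and> eq_pm (lam a) (lam j))"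
  "(W a, W b) \<in> reps_even \<union> reps_odd \<longleftrightarrow> (1 \<le> a \<and> a \<le> b \<and> b \<le> n \<and> eq_pm (kap a) (kap b)) \<or>
    (\<exists>j. b = n + j \<and> 1 \<le> a \<and> a < j \<and> j \<le> n \<and> eq_pm (kap a) (kap j))"
  "(Y a, Y b) \<in> reps_even \<union> reps_odd \<longleftrightarrow> (b = a \<and> 1 \<le> a \<and> a \<le> t - 1) \<or> (1 \<le> a \<and> a < b \<and> b \<le> t)"
  "(E a, W b) \<in> reps_even \<union> reps_odd \<longleftrightarrow>
    (\<exists>i. a = m + i \<and> 1 \<le> i \<and> i \<le> m \<and> 1 \<le> b \<and> b \<le> n \<and> eq_pm (lam i) (kap b)) \<or>
    (1 \<le> a \<and> a \<le> m \<and> 1 \<le> b \<and> b \<le> n \<and> eq_pm (lam a) (kap b))"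
  "(W a, E b) \<notin> reps_even \<union> reps_odd"
  by (simp_all add: reps_even_def reps_odd_def)

text \<open>A form has its support on the pairs obtained from \<open>(b, c)\<close> by transposition
  and, for nonzero weight, by applying \<open>sw\<close> to both entries. No second representative
  lies among them; the last clause allows for \<open>(E i, E (m + i))\<close>, which both operations
  together fix.\<close>

lemma reps_distinct_conj:
  assumes "(b, c) \<in> reps_even \<union> reps_odd"
  shows "((c, b) \<in> reps_even \<union> reps_odd \<longrightarrow> c = b) \<and>
    (ev b \<noteq> 0 \<longrightarrow> (sw b, sw c) \<notin> reps_even \<union> reps_odd) \<and>
    (ev b \<noteq> 0 \<longrightarrow> (sw c, sw b) \<in> reps_even \<union> reps_odd \<longrightarrow> sw c = b)"
  using assms by (cases rule: reps_cases; clarsimp simp: reps_mem simp del: Un_iff; auto)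

lemmas reps_distinct = reps_distinct_conj[THEN conjunct1, rule_format]
  reps_distinct_conj[THEN conjunct2, THEN conjunct1, rule_format]
  reps_distinct_conj[THEN conjunct2, THEN conjunct2, rule_format]

lemma form_off:
  assumes "(b, c) \<in> reps_even \<union> reps_odd" "(b', c') \<in> reps_even \<union> reps_odd" "(b', c') \<noteq> (b, c)"
  shows "form b c (u b') (u c') = 0"
proof -
  have 1: "\<not> (b = b' \<and> c = c')"
    using assms(3) by auto
  have 3: "\<not> (c = b' \<and> b = c')"
  proof
    assume h: "c = b' \<and> b = c'"
    then have "(c, b) \<in> reps_even \<union> reps_odd"
      using assms(2) by (simp only:)
    then have "c = b"
      by (rule reps_distinct(1)[OF assms(1)])
    then show False
      using h assms(3) by simp
  qed
  have 2: "\<not> (sw b = b' \<and> sw c = c')" "\<not> (sw c = b' \<and> sw b = c')" if "ev b \<noteq> 0"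
  proof -
    show "\<not> (sw b = b' \<and> sw c = c')"
    proof
      assume "sw b = b' \<and> sw c = c'"
      then have "(sw b, sw c) \<in> reps_even \<union> reps_odd"
        using assms(2) by (simp only:)
      then show False
        using reps_distinct(2)[OF assms(1) that] by simp
    qed
    show "\<not> (sw c = b' \<and> sw b = c')"
    proof
      assume h: "sw c = b' \<and> sw b = c'"
      then have "(sw c, sw b) \<in> reps_even \<union> reps_odd"
        using assms(2) by (simp only:)
      then have "sw c = b"
        by (rule reps_distinct(3)[OF assms(1) that])
      then have "b' = b" "c' = c"
        using h by auto
      then show False
        using assms(3) by simp
    qed
  qed
  show ?thesis
  proof (cases "ev b = 0")
    case True
    show ?thesis
      unfolding form_unit[OF reps_props(1,2)[OF assms(2)]] True
      by (simp only: 1 3 of_bool_eq mult_zero_left mult_zero_right diff_self)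
  next
    case False
    show ?thesis
      unfolding form_unit[OF reps_props(1,2)[OF assms(2)]]
      by (simp only: 1 3 2[OF False] of_bool_eq mult_zero_right diff_self)
  qed
qed

text \<open>The value is 1, except that it is 2 for \<open>(E i, E (m + i))\<close>: there the two
  dual vectors in the form coincide and add up.\<close>

lemma form_diag:
  assumes "(b, c) \<in> reps_even \<union> reps_odd"
  shows "form b c (u b) (u c) \<noteq> 0"
proof -
  note p = reps_props[OF assms]
  have 1: "sw b = b \<Longrightarrow> ev b = 0"
    using assms by (auto simp: reps_even_def reps_odd_def)
  have 2: "sw c = b \<Longrightarrow> hpar b * hpar c = 0 \<or> ev b = 0"
    using assms by (auto simp: reps_even_def reps_odd_def)
  have 3: "b = c \<Longrightarrow> hpar b * hpar c = 1"
    using assms by (auto simp: reps_even_def reps_odd_def)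
  have "of_bool (b = b \<and> c = c) - (- 1) ^ (hpar b * hpar c) * of_bool (c = b \<and> b = c)
     - ev b * inverse (ev c) * (of_bool (sw b = b \<and> sw c = c)
       - (- 1) ^ (hpar b * hpar c) * of_bool (sw c = b \<and> sw b = c)) \<in> {1, 2 :: 'f}"
  proof (cases "ev b \<noteq> 0 \<and> sw c = b")
    case True
    then have e: "ev b * inverse (ev c) = 1" "hpar b * hpar c = 0" "sw b = c"
      using 2 by auto
    have "c \<noteq> b"
      using 1 True by auto
    then have f: "(c = b \<and> b = c) = False" "(sw b = b \<and> sw c = c) = False" "(sw c = b \<and> sw b = c) = True"
      using True e(3) by auto
    show ?thesis
      unfolding f e(1,2) by simp
  next
    case False
    then have "ev b * inverse (ev c) = 0 \<or> (sw b = b \<and> sw c = c) = False \<and> (sw c = b \<and> sw b = c) = False"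
      using 1 by (cases "ev b = 0") auto
    then have f: "ev b * inverse (ev c) * (of_bool (sw b = b \<and> sw c = c)
       - (- 1) ^ (hpar b * hpar c) * of_bool (sw c = b \<and> sw b = c)) = (0 :: 'f)"
      by (elim disjE conjE) (simp_all only: of_bool_eq mult_zero_left mult_zero_right diff_self)
    show ?thesis
      unfolding f using 3 by (cases "b = c") (simp_all only: of_bool_eq simp_thms power_one_right, simp_all)
  qed
  then show ?thesis
    unfolding form_unit[OF p(1,2)] using fac_nonzero[of b c] two_nonzero
    by (metis insertE singletonD mult_eq_0_iff one_neq_zero)
qed

text \<open>Hence the correction term in the coordinates vanishes on all the chosen
  cocycles.\<close>

lemma form_Yt:
  assumes "(b, c) \<in> reps_even \<union> reps_odd"
  shows "form b c (u (Y t)) (u (Y t)) = 0"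
proof -
  have "\<not> (b = Y t \<and> c = Y t)" "sw b = Y t \<Longrightarrow> ev b = 0" "sw c = Y t \<Longrightarrow> ev c = 0"
    using reps_props(6)[OF assms] by (metis ev.simps(3) ev_sw)+
  then show ?thesis
    using t_pos by (auto simp: form_unit)
qed

section \<open>The listed forms and the chosen representatives\<close>

lemma horizontal_zero: "horizontal 0"
  by (simp add: horizontal_def invariant_def C2_zero)

lemma A_horizontal:
  assumes "\<phi> \<in> A1 m g lam \<union> A2 m n g lam kap \<union> A3 n g kap \<union> A4 t g"
  shows "horizontal \<phi>"
proof -
  have scl: "scl_form (of_bool B) \<psi> = (if B then \<psi> else 0)" for B and \<psi> :: "(hindex \<Rightarrow> 'f) \<Rightarrow> (hindex \<Rightarrow> 'f) \<Rightarrow> 'f"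
    by (auto simp: scl_form_def fun_eq_iff)
  have h: "horizontal (scl_form (of_bool B) \<psi>)"
    if "B \<Longrightarrow> \<psi> = form b c \<and> eq_pm (ev b) (ev c) \<and> b \<notin> {zz, dd} \<and> c \<notin> {zz, dd}" for B \<psi> b c
    using that form_horizontal[of b c] horizontal_zero unfolding scl by (cases B) auto
  \<comment> \<open>In the second family of \<open>A1\<close> the last wedge has its factors in the
    opposite order to \<open>sw\<close> applied to the pair. This accounts for the plus sign
    there.\<close>
  have anti: "dual_wedge g (E i) (E j) + scl_form r (dual_wedge g (E k) (E l))
      = dual_wedge g (E i) (E j) - scl_form r (dual_wedge g (E l) (E k))" if "k \<noteq> l" for i j k l r
    using that by (auto simp: fun_eq_iff dual_wedge_def scl_form_def algebra_simps)
  have sym: "dual_wedge g (W i) (W j) = dual_wedge g (W j) (W i)" for i j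
    by (auto simp: fun_eq_iff dual_wedge_def algebra_simps)
  have "\<exists>B \<psi> b c. \<phi> = scl_form (of_bool B) \<psi> \<and>
      (B \<longrightarrow> \<psi> = form b c \<and> eq_pm (ev b) (ev c) \<and> b \<notin> {zz, dd} \<and> c \<notin> {zz, dd})"
  proof -
    consider
      (1) i j where "1 \<le> i" "i \<le> j" "j \<le> m" "\<phi> = scl_form (of_bool (eq_pm (lam i) (lam j)))
        (dual_wedge g (E i) (E j) - scl_form (lam i * inverse (lam j)) (dual_wedge g (E (m+i)) (E (m+j))))"
    | (2) i j where "1 \<le> i" "i \<le> j" "j \<le> m" "\<phi> = scl_form (of_bool (eq_pm (lam i) (lam j)))
        (dual_wedge g (E i) (E (m+j)) + scl_form (lam i * inverse (lam j)) (dual_wedge g (E j) (E (m+i))))"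
    | (3) i j where "1 \<le> i" "i \<le> m" "1 \<le> j" "j \<le> n" "\<phi> = scl_form (of_bool (eq_pm (lam i) (kap j)))
        (dual_wedge g (E (m+i)) (W j) - scl_form (lam i * inverse (kap j)) (dual_wedge g (E i) (W (n+j))))"
    | (4) i j where "1 \<le> i" "i \<le> m" "1 \<le> j" "j \<le> n" "\<phi> = scl_form (of_bool (eq_pm (lam i) (kap j)))
        (dual_wedge g (E i) (W j) - scl_form (lam i * inverse (kap j)) (dual_wedge g (E (m+i)) (W (n+j))))"
    | (5) i j where "1 \<le> i" "i \<le> j" "j \<le> n" "\<phi> = scl_form (of_bool (eq_pm (kap i) (kap j)))
        (dual_wedge g (W i) (W j) - scl_form (kap i * inverse (kap j)) (dual_wedge g (W (n+i)) (W (n+j))))"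
    | (6) i j where "1 \<le> i" "i \<le> j" "j \<le> n" "\<phi> = scl_form (of_bool (eq_pm (kap i) (kap j)))
        (dual_wedge g (W i) (W (n+j)) - scl_form (kap i * inverse (kap j)) (dual_wedge g (W j) (W (n+i))))"
    | (7) i j where "\<phi> = dual_wedge g (Y i) (Y j)"
      using assms unfolding A1_def A2_def A3_def A4_def by blast
    then show ?thesis
    proof cases
      case 1
      then show ?thesis
        by (intro exI[of _ "eq_pm (lam i) (lam j)"] exI[of _ "form (E i) (E j)"]
          exI[of _ "E i"] exI[of _ "E j"]) (auto simp: form_def)
    next
      case 2
      have "m + i \<noteq> j"
        using 2 by simp
      with 2 anti[of j "m + i" i "m + j"] show ?thesis
        by (intro exI[of _ "eq_pm (lam i) (lam j)"] exI[of _ "form (E i) (E (m + j))"]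
          exI[of _ "E i"] exI[of _ "E (m + j)"]) (auto simp: form_def)
    next
      case 3
      then show ?thesis
        by (intro exI[of _ "eq_pm (lam i) (kap j)"] exI[of _ "form (E (m + i)) (W j)"]
          exI[of _ "E (m + i)"] exI[of _ "W j"]) (auto simp: form_def)
    next
      case 4
      then show ?thesis
        by (intro exI[of _ "eq_pm (lam i) (kap j)"] exI[of _ "form (E i) (W j)"]
          exI[of _ "E i"] exI[of _ "W j"]) (auto simp: form_def)
    next
      case 5
      then show ?thesis
        by (intro exI[of _ "eq_pm (kap i) (kap j)"] exI[of _ "form (W i) (W j)"]
          exI[of _ "W i"] exI[of _ "W j"]) (auto simp: form_def)
    next
      case 6
      then show ?thesis
        by (intro exI[of _ "eq_pm (kap i) (kap j)"] exI[of _ "form (W i) (W (n + j))"]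
          exI[of _ "W i"] exI[of _ "W (n + j)"]) (auto simp: form_def sym[of j "n + i"])
    next
      case 7
      then show ?thesis
        by (intro exI[of _ True] exI[of _ "form (Y i) (Y j)"] exI[of _ "Y i"] exI[of _ "Y j"])
          (auto simp: form_def scl_form_def fun_eq_iff)
    qed
  qed
  then show ?thesis
    using h by blast
qed

lemma reps_in_A:
  assumes "(b, c) \<in> reps_even \<union> reps_odd"
  shows "form b c \<in> A1 m g lam \<union> A2 m n g lam kap \<union> A3 n g kap \<union> A4 t g"
proof -
  have scl: "scl_form 1 \<psi> = \<psi>" for \<psi> :: "(hindex \<Rightarrow> 'f) \<Rightarrow> (hindex \<Rightarrow> 'f) \<Rightarrow> 'f"
    by (simp add: scl_form_def)
  have anti: "dual_wedge g (E i) (E j) + scl_form r (dual_wedge g (E k) (E l))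
      = dual_wedge g (E i) (E j) - scl_form r (dual_wedge g (E l) (E k))" if "k \<noteq> l" for i j k l r
    using that by (auto simp: fun_eq_iff dual_wedge_def scl_form_def algebra_simps)
  have sym: "dual_wedge g (W i) (W j) = dual_wedge g (W j) (W i)" for i j
    by (auto simp: fun_eq_iff dual_wedge_def algebra_simps)
  have zero: "scl_form 0 \<psi> = 0" for \<psi> :: "(hindex \<Rightarrow> 'f) \<Rightarrow> (hindex \<Rightarrow> 'f) \<Rightarrow> 'f"
    by (simp add: scl_form_def fun_eq_iff)
  from assms show ?thesis
  proof (cases rule: reps_cases)
    case (1 i j)
    then have "form b c \<in> A1 m g lam"
      unfolding A1_def
      by (intro UnI1 CollectI exI[of _ i] exI[of _ j]) (auto simp: form_def scl)
    then show ?thesis by blast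
  next
    case (2 i j)
    then have "form b c \<in> A1 m g lam"
      unfolding A1_def using anti[of j "m + i" i "m + j"]
      by (intro UnI2 CollectI exI[of _ i] exI[of _ j]) (auto simp: form_def scl)
    then show ?thesis by blast
  next
    case (3 i j)
    then have "form b c \<in> A2 m n g lam kap"
      unfolding A2_def
      by (intro UnI1 CollectI exI[of _ i] exI[of _ j]) (auto simp: form_def scl)
    then show ?thesis by blast
  next
    case (4 i j)
    then have "form b c \<in> A2 m n g lam kap"
      unfolding A2_def
      by (intro UnI2 CollectI exI[of _ i] exI[of _ j]) (auto simp: form_def scl)
    then show ?thesis by blast
  next
    case (5 i j)
    then have "form b c \<in> A3 n g kap"
      unfolding A3_def
      by (intro UnI1 CollectI exI[of _ i] exI[of _ j]) (auto simp: form_def scl)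
    then show ?thesis by blast
  next
    case (6 i j)
    then have "form b c \<in> A3 n g kap"
      unfolding A3_def
      by (intro UnI2 CollectI exI[of _ i] exI[of _ j]) (auto simp: form_def scl sym[of j "n + i"])
    then show ?thesis by blast
  next
    case (7 i)
    then have "form b c \<in> A4 t g"
      unfolding A4_def by (intro UnI1 CollectI exI[of _ i]) (auto simp: form_def zero)
    then show ?thesis by blast
  next
    case (8 i j)
    then have "form b c \<in> A4 t g"
      unfolding A4_def by (intro UnI2 CollectI exI[of _ i] exI[of _ j]) (auto simp: form_def zero)
    then show ?thesis by blast
  qed
qed

section \<open>Vanishing criteria for invariant forms\<close>

lemma C2_unit_skew_zero:
  assumes "\<phi> \<in> C2 g" "b \<in> hbas m n t" "c \<in> hbas m n t" "\<phi> (u c) (u b) = 0"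
  shows "\<phi> (u b) (u c) = 0"
  using C2_skew[OF assms(1) homog_unit homog_unit, of b c] assms(2-4) hpar_le by simp

lemma invariant_swap_zero:
  assumes "invariant \<phi>" "b \<in> hbas m n t" "c \<in> hbas m n t" "ev b \<noteq> 0" "ev c \<noteq> 0"
    and "\<phi> (u (sw b)) (u (sw c)) = 0"
  shows "\<phi> (u b) (u c) = 0"
proof -
  have "b \<noteq> dd" "sw c \<noteq> dd"
    using assms(4,5) by (metis ev_sw fixed_simps(8))+
  then have "ev b * \<phi> (u (sw b)) (u (sw c)) + ev (sw c) * \<phi> (u b) (u (sw (sw c))) = 0"
    using assms(1-3) unfolding invariant_def by (metis sw_mem)
  then show ?thesis
    using assms(5,6) by simp
qed

text \<open>Applying invariance twice multiplies the value by \<open>ev b ^ 2 - ev c ^ 2\<close>,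
  which is nonzero unless the weights agree up to sign.\<close>

lemma invariant_not_pm_zero:
  assumes "invariant \<phi>" "b \<in> hbas m n t" "c \<in> hbas m n t" "ev c \<noteq> 0" "\<not> eq_pm (ev b) (ev c)" "b \<noteq> dd"
  shows "\<phi> (u b) (u c) = 0"
proof -
  have dd: "b \<noteq> dd" "c \<noteq> dd" "sw b \<noteq> dd" "sw c \<noteq> dd"
    using assms(4,6) by (metis ev_sw fixed_simps(6,8) sw_sw)+
  have "ev b * \<phi> (u (sw b)) (u (sw c)) + ev (sw c) * \<phi> (u b) (u (sw (sw c))) = 0"
    "ev (sw b) * \<phi> (u (sw (sw b))) (u c) + ev c * \<phi> (u (sw b)) (u (sw c)) = 0"
    using assms(1-3) dd unfolding invariant_def by (metis sw_mem)+
  then have "(ev b * ev b - ev c * ev c) * \<phi> (u b) (u c) = 0"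
  proof -
    assume "ev b * \<phi> (u (sw b)) (u (sw c)) + ev (sw c) * \<phi> (u b) (u (sw (sw c))) = 0"
      "ev (sw b) * \<phi> (u (sw (sw b))) (u c) + ev c * \<phi> (u (sw b)) (u (sw c)) = 0"
    moreover have "(ev b * ev b - ev c * ev c) * \<phi> (u b) (u c)
      = ev b * (ev b * \<phi> (u b) (u c) + ev c * \<phi> (u (sw b)) (u (sw c)))
        - ev c * (ev b * \<phi> (u (sw b)) (u (sw c)) + ev c * \<phi> (u b) (u c))"
      by (simp add: algebra_simps)
    ultimately show ?thesis
      unfolding ev_sw sw_sw by simp
  qed
  then show ?thesis
    using assms(5) by (simp add: eq_pm_iff)
qed

text \<open>
  Invariance reduces every pair of basis vectors to a pair in \<open>reps_even\<close> or \<open>reps_odd\<close>, except for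
  \<open>(Y t, Y t)\<close> and for the pairs that contain \<open>dd\<close>.
\<close>

lemma invariant_zero:
  assumes \<phi>: "\<phi> \<in> C2 g" "invariant \<phi>"
    and dd: "\<And>b. b \<in> hbas m n t \<Longrightarrow> \<phi> (u dd) (u b) = 0"
    and Yt: "\<phi> (u (Y t)) (u (Y t)) = 0"
    and reps: "\<And>b c. (b, c) \<in> reps_even \<union> reps_odd \<Longrightarrow> \<phi> (u b) (u c) = 0"
  shows "\<phi> = 0"
proof -
  define Z where "Z b c \<longleftrightarrow> \<phi> (u b) (u c) = 0" for b c
  have sym: "Z b c" if "b \<in> hbas m n t" "c \<in> hbas m n t" "Z c b" for b c
    using C2_unit_skew_zero[OF \<phi>(1) that(1,2)] that(3) by (simp add: Z_def)
  have swap: "Z b c" if "b \<in> hbas m n t" "c \<in> hbas m n t" "ev b \<noteq> 0" "ev c \<noteq> 0" "Z (sw b) (sw c)" for b c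
    using invariant_swap_zero[OF \<phi>(2) that(1-4)] that(5) by (simp add: Z_def)
  have rep: "Z b c" if "eq_pm (ev b) (ev c) \<Longrightarrow> (b, c) \<in> reps_even \<union> reps_odd"
    "b \<in> hbas m n t" "c \<in> hbas m n t" "ev c \<noteq> 0" "b \<noteq> dd" for b c
    using reps[of b c] invariant_not_pm_zero[OF \<phi>(2) that(2-4) _ that(5)] that(1)
    unfolding Z_def by blast
  have evE: "ev (E i) \<noteq> 0" "ev (E (m + i)) \<noteq> 0" if "1 \<le> i" "i \<le> m" for i
    using that lam_nonzero[of i] by simp_all
  have evW: "ev (W j) \<noteq> 0" "ev (W (n + j)) \<noteq> 0" if "1 \<le> j" "j \<le> n" for j
    using that kap_nonzero[of j] by simp_all
  have EE: "Z (E i) (E j)" if i: "1 \<le> i" "i \<le> m" and j: "1 \<le> j" "j \<le> m" for i j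
  proof -
    have lt: "Z (E i) (E j)" if "1 \<le> i" "i < j" "j \<le> m" for i j
      using that evE[of j] by (intro rep) (auto simp: reps_mem simp del: Un_iff)
    have "u (E i) \<in> even_part g"
      using homog_unit[of "E i" g] i by simp
    then have "Z (E i) (E i)"
      unfolding Z_def by (rule C2_diag_even[OF \<phi>(1)])
    moreover have "Z (E i) (E j)" if "j < i"
      using lt[OF j(1) that i(2)] i j by - (rule sym; auto)
    ultimately show ?thesis
      using lt[OF i(1) _ j(2)] by (cases i j rule: linorder_cases) auto
  qed
  have EE': "Z (E i) (E (m + j))" if i: "1 \<le> i" "i \<le> m" and j: "1 \<le> j" "j \<le> m" for i j
  proof -
    have le: "Z (E i) (E (m + j))" if "1 \<le> i" "i \<le> j" "j \<le> m" for i j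
      using that evE[of j] by (intro rep) (auto simp: reps_mem simp del: Un_iff)
    \<comment> \<open>Applying \<open>sw\<close> to both entries and transposing exchanges the roles
      of \<open>i\<close> and \<open>j\<close>.\<close>
    have "Z (E i) (E (m + j))" if "j \<le> i"
    proof (rule swap)
      show "Z (sw (E i)) (sw (E (m + j)))"
        using le[OF j(1) that i(2)] i j by - (rule sym; auto)
    qed (use i j evE in auto)
    then show ?thesis
      using le[OF i(1) _ j(2)] by (cases "i \<le> j") auto
  qed
  have EhEh: "Z (E (m + i)) (E (m + j))" if i: "1 \<le> i" "i \<le> m" and j: "1 \<le> j" "j \<le> m" for i j
    using EE[OF i j] i j evE by - (rule swap; auto)
  have EhE: "Z (E (m + i)) (E j)" if i: "1 \<le> i" "i \<le> m" and j: "1 \<le> j" "j \<le> m" for i j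
    using EE'[OF j i] i j by - (rule sym; auto)
  have WW: "Z (W i) (W j)" if i: "1 \<le> i" "i \<le> n" and j: "1 \<le> j" "j \<le> n" for i j
  proof -
    have le: "Z (W i) (W j)" if "1 \<le> i" "i \<le> j" "j \<le> n" for i j
      using that evW[of j] by (intro rep) (auto simp: reps_mem simp del: Un_iff)
    have "Z (W i) (W j)" if "j \<le> i"
      using le[OF j(1) that i(2)] i j by - (rule sym; auto)
    then show ?thesis
      using le[OF i(1) _ j(2)] by (cases "i \<le> j") auto
  qed
  have WW': "Z (W i) (W (n + j))" if i: "1 \<le> i" "i \<le> n" and j: "1 \<le> j" "j \<le> n" for i j
  proof -
    have lt: "Z (W i) (W (n + j))" if "1 \<le> i" "i < j" "j \<le> n" for i j
      using that evW[of j] by (intro rep) (auto simp: reps_mem simp del: Un_iff)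
    have "Z (W i) (W (n + j))" if "j < i"
    proof (rule swap)
      show "Z (sw (W i)) (sw (W (n + j)))"
        using lt[OF j(1) that i(2)] i j by - (rule sym; auto)
    qed (use i j evW in auto)
    \<comment> \<open>Not a representative, so it must vanish by itself. Invariance at
      \<open>(W i, W i)\<close> and the symmetry of odd arguments give \<open>2 * ev (W i)\<close>
      times the value.\<close>
    moreover have "Z (W i) (W (n + i))"
    proof -
      have Wi: "W i \<in> hbas m n t" "W (n + i) \<in> hbas m n t"
        using i by simp_all
      have "ev (W i) * \<phi> (u (sw (W i))) (u (W i)) + ev (W i) * \<phi> (u (W i)) (u (sw (W i))) = 0"
        using \<phi>(2) Wi unfolding invariant_def by (metis fixed_simps(16))
      moreover have "\<phi> (u (W (n + i))) (u (W i)) = \<phi> (u (W i)) (u (W (n + i)))"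
        using C2_skew[OF \<phi>(1) homog_unit homog_unit, of "W (n + i)" "W i"] Wi by simp
      ultimately have "ev (W i) * (2 * \<phi> (u (W i)) (u (W (n + i)))) = 0"
        using i by (simp add: algebra_simps)
      then show ?thesis
        using evW[OF i] two_nonzero by (simp add: Z_def del: ev.simps)
    qed
    ultimately show ?thesis
      using lt[OF i(1) _ j(2)] by (cases i j rule: linorder_cases) auto
  qed
  have WhWh: "Z (W (n + i)) (W (n + j))" if i: "1 \<le> i" "i \<le> n" and j: "1 \<le> j" "j \<le> n" for i j
    using WW[OF i j] i j evW by - (rule swap; auto)
  have WhW: "Z (W (n + i)) (W j)" if i: "1 \<le> i" "i \<le> n" and j: "1 \<le> j" "j \<le> n" for i j
    using WW'[OF j i] i j by - (rule sym; auto)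
  have EW: "Z (E i) (W j)" "Z (E (m + i)) (W j)" if "1 \<le> i" "i \<le> m" "1 \<le> j" "j \<le> n" for i j
    using that evW[of j] by (intro rep; auto simp: reps_mem simp del: Un_iff)+
  have EW': "Z (E i) (W (n + j))" "Z (E (m + i)) (W (n + j))" if h: "1 \<le> i" "i \<le> m" "1 \<le> j" "j \<le> n" for i j
    using EW[OF h] h evE evW by - (rule swap; auto)+
  have WE: "Z (W j) (E i)" "Z (W j) (E (m + i))" "Z (W (n + j)) (E i)" "Z (W (n + j)) (E (m + i))"
    if h: "1 \<le> i" "i \<le> m" "1 \<le> j" "j \<le> n" for i j
    using EW[OF h] EW'[OF h] h by - (rule sym; auto)+
  have YV: "Z (Y k) c" "Z c (Y k)" if "1 \<le> k" "k \<le> t" "c \<in> hbas m n t" "ev c \<noteq> 0" for k c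
  proof -
    \<comment> \<open>Weight 0 never agrees, up to sign, with a nonzero weight.\<close>
    have "\<not> eq_pm (ev (Y k)) (ev c)"
      using that(4) by (simp add: eq_pm_def)
    then show "Z (Y k) c"
      unfolding Z_def using that by (intro invariant_not_pm_zero[OF \<phi>(2)]) auto
    then show "Z c (Y k)"
      using that by - (rule sym; auto)
  qed
  have YE: "Z (Y k) (E i)" "Z (E i) (Y k)" "Z (Y k) (E (m + i))" "Z (E (m + i)) (Y k)"
    if h: "1 \<le> k" "k \<le> t" "1 \<le> i" "i \<le> m" for k i
    using YV[OF h(1,2), of "E i"] YV[OF h(1,2), of "E (m + i)"] evE[OF h(3,4)] h(3,4) by auto
  have YW: "Z (Y k) (W i)" "Z (W i) (Y k)" "Z (Y k) (W (n + i))" "Z (W (n + i)) (Y k)"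
    if h: "1 \<le> k" "k \<le> t" "1 \<le> i" "i \<le> n" for k i
    using YV[OF h(1,2), of "W i"] YV[OF h(1,2), of "W (n + i)"] evW[OF h(3,4)] h(3,4) by auto
  have YY: "Z (Y i) (Y j)" if i: "1 \<le> i" "i \<le> t" and j: "1 \<le> j" "j \<le> t" for i j
  proof -
    have lt: "Z (Y i) (Y j)" if "1 \<le> i" "i < j" "j \<le> t" for i j
      unfolding Z_def using that by (intro reps) (auto simp: reps_mem simp del: Un_iff)
    have "Z (Y i) (Y j)" if "j < i"
      using lt[OF j(1) that i(2)] i j by - (rule sym; auto)
    moreover have "Z (Y i) (Y i)"
    proof (cases "i = t")
      case False
      then show ?thesis
        unfolding Z_def using i by (intro reps) (auto simp: reps_mem simp del: Un_iff)
    qed (use Yt in \<open>simp add: Z_def\<close>)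
    ultimately show ?thesis
      using lt[OF i(1) _ j(2)] by (cases i j rule: linorder_cases) auto
  qed
  have zzZ: "Z zz c" "Z c zz" if "c \<in> hbas m n t" for c
    using invariant_zz[OF \<phi>] that by (simp_all add: Z_def)
  have ddZ: "Z dd c" "Z c dd" if "c \<in> hbas m n t" for c
    using dd that sym[of c dd] by (simp_all add: Z_def)
  have "Z b c" if b: "b \<in> hbas m n t" and c: "c \<in> hbas m n t" for b c
    using b
  proof (cases rule: hbas_cases)
    case (lo i)
    with c show ?thesis
      by (cases rule: hbas_cases) (auto intro: EE EE' EW EW' YE zzZ ddZ simp del: ev.simps)
  next
    case (hi i)
    with c show ?thesis
      by (cases rule: hbas_cases) (auto intro: EhE EhEh EW EW' YE zzZ ddZ simp del: ev.simps)
  next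
    case zz
    then show ?thesis
      using zzZ(1)[OF c] by simp
  next
    case dd
    then show ?thesis
      using ddZ(1)[OF c] by simp
  next
    case (W_lo i)
    with c show ?thesis
      by (cases rule: hbas_cases) (auto intro: WE WW WW' YW zzZ ddZ simp del: ev.simps)
  next
    case (W_hi i)
    with c show ?thesis
      by (cases rule: hbas_cases) (auto intro: WE WhW WhWh YW zzZ ddZ simp del: ev.simps)
  next
    case (Y i)
    with c show ?thesis
      by (cases rule: hbas_cases) (auto intro: YE YW YY zzZ ddZ simp del: ev.simps)
  qed
  then show ?thesis
    by (intro C2_eqI[of g, unfolded bas_g, OF finite_hbas \<phi>(1) C2_zero]) (auto simp: Z_def)
qed

end

section \<open>The duality between coordinates and cocycles\<close>

context restricted_heisenberg
begin

definition cocyc :: "(hindex \<times> hindex) + nat \<Rightarrow> (hindex, 'f) restricted_2_cochain" where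
  "cocyc k = (case k of Inl (b, c) \<Rightarrow> (form b c, tilde (form b c)) | Inr i \<Rightarrow> (0, ebar g i))"

text \<open>
  On a coboundary of \<open>\<psi>\<close> the value at \<open>(Y t, Y t)\<close> is \<open>\<psi> (u zz)\<close>; subtracting its contribution
  makes the coordinates vanish on coboundaries.
\<close>

definition coord :: "(hindex \<times> hindex) + nat \<Rightarrow> (hindex, 'f) restricted_2_cochain \<Rightarrow> 'f" where
  "coord k c = (case k of
     Inl (b, b') \<Rightarrow> fst c (u b) (u b') - BB (u b) (u b') * fst c (u (Y t)) (u (Y t))
   | Inr i \<Rightarrow> snd c (u (E i)) - mu i * fst c (u (Y t)) (u (Y t)))"

text \<open>The index \<open>2 * m + 2\<close> does not occur: the form dual to \<open>dd\<close>
  vanishes on all brackets, so its coboundary is \<open>l\<close> times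
  \<open>(0, ebar g (2 * m + 2))\<close>.\<close>

definition even_index :: "((hindex \<times> hindex) + nat) set" where
  "even_index = reps_even <+> {1..2*m+1}"

definition odd_index :: "((hindex \<times> hindex) + nat) set" where
  "odd_index = Inl ` reps_odd"

lemma coord_add: "coord k (c + c') = coord k c + coord k c'"
  by (auto simp: coord_def algebra_simps split: sum.splits)

lemma coord_scl: "coord k (scl_res a c) = a * coord k c"
  by (auto simp: coord_def scl_res_sel algebra_simps split: sum.splits)

lemma index_cases [consumes 1, case_names Inl Inr]:
  assumes "k \<in> even_index \<union> odd_index"
  obtains b c where "k = Inl (b, c)" "(b, c) \<in> reps_even \<union> reps_odd"
    | i where "k = Inr i" "i \<in> {1..2*m+1}"
  using assms unfolding even_index_def odd_index_def by fast

lemma Yt_mem: "Y t \<in> hbas m n t"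
  using t_pos by simp

text \<open>On the coboundary of \<open>\<psi>\<close> all three values involved are multiples of
  \<open>\<psi> (u zz)\<close>: the factor is \<open>BB\<close> at a representative,
  \<open>mu i\<close> at \<open>E i\<close>, and 1 at \<open>(Y t, Y t)\<close>.\<close>

lemma coord_B2:
  assumes "k \<in> even_index \<union> odd_index" "c \<in> B2_res g P"
  shows "coord k c = 0"
proof -
  obtain \<psi> where \<psi>: "\<psi> \<in> C1 g" "c = (d1 g \<psi>, ind1 g P \<psi>)"
    using assms(2) by (auto simp: B2_res_def d1_res_def)
  have Yt: "d1 g \<psi> (u (Y t)) (u (Y t)) = \<psi> (u zz)"
    using d1_unit[OF \<psi>(1) Yt_mem Yt_mem] t_pos by simp
  show ?thesis
    using assms(1)
  proof (cases rule: index_cases)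
    case (Inl b c')
    note p = reps_props[OF Inl(2)]
    show ?thesis
      using p(1-4) d1_unit[OF \<psi>(1) p(1,2)] by (simp add: Inl(1) coord_def \<psi>(2) Yt BB_unit)
  next
    case (Inr i)
    then have "u (E i) \<in> even_part g"
      using homog_unit[of "E i" g] by simp
    moreover have "\<psi> (scl (mu i) (u zz)) = mu i * \<psi> (u zz)"
      using linear_form_scl[OF C1_linear[OF \<psi>(1)]] by simp
    ultimately show ?thesis
      using Inr P_unit[of i] by (simp add: coord_def \<psi>(2) Yt ind1_def)
  qed
qed

lemma ebar_compatible: "compatible g 0 (ebar g i)"
proof -
  have "(x + y) ^ CHAR('f) = x ^ CHAR('f) + y ^ CHAR('f)" for x y :: 'f
    by (rule freshmans_dream[OF prime_char refl])
  then show ?thesis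
    unfolding compatible_def ebar_def using homog_add[of _ g 0] homog_scl[of _ g 0]
    by (simp add: power_mult_distrib)
qed

lemma horizontal_Z2:
  assumes "horizontal \<phi>"
  shows "(\<phi>, tilde \<phi>) \<in> Z2_res g P"
proof -
  have "\<phi> (u (Y k)) (u dd) = 0" if "k \<in> {1..t}" for k
    using assms that C2_skew_even_g[of \<phi> "u (Y k)" "u dd", OF _ _ even_u_dd] by (simp add: horizontal_def)
  then show ?thesis
    using assms tilde_compatible by (simp add: Z2_iff horizontal_def)
qed

lemma ebar_Z2: "(0, ebar g i) \<in> Z2_res g P"
  using ebar_compatible horizontal_zero by (simp add: Z2_iff horizontal_def)

lemma cocycles_Z2: "heis_cocycles m n t lam kap \<subseteq> Z2_res g P"
  unfolding heis_cocycles_def Let_def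
  using A_horizontal horizontal_Z2 heis_tilde_eq ebar_Z2 by auto

lemma cocyc_mem:
  assumes "k \<in> even_index \<union> odd_index"
  shows "cocyc k \<in> heis_cocycles m n t lam kap"
  using assms
proof (cases rule: index_cases)
  case (Inl b c)
  then show ?thesis
    using reps_in_A[OF Inl(2)] heis_tilde_eq[OF reps_horizontal[OF Inl(2)], symmetric]
    unfolding heis_cocycles_def Let_def cocyc_def by auto
next
  case (Inr i)
  then show ?thesis
    unfolding heis_cocycles_def Let_def cocyc_def by auto
qed

lemma coord_diag:
  assumes "k \<in> even_index \<union> odd_index"
  shows "coord k (cocyc k) \<noteq> 0"
  using assms
proof (cases rule: index_cases)
  case (Inl b c)
  then show ?thesis
    using form_diag[OF Inl(2)] form_Yt[OF Inl(2)] by (simp add: coord_def cocyc_def)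
next
  case (Inr i)
  then show ?thesis
    using homog_unit[of "E i" g] by (simp add: coord_def cocyc_def ebar_def unit_vector_def)
qed

lemma coord_off:
  assumes "k \<in> even_index \<union> odd_index" "k' \<in> even_index \<union> odd_index" "k \<noteq> k'"
  shows "coord k (cocyc k') = 0"
  using assms(2)
proof (cases rule: index_cases)
  case k': (Inl b' c')
  note Yt = form_Yt[OF k'(2)]
  show ?thesis
    using assms(1)
  proof (cases rule: index_cases)
    case (Inl b c)
    then have "form b' c' (u b) (u c) = 0"
      using form_off[OF k'(2) Inl(2)] assms(3) k'(1) by simp
    then show ?thesis
      by (simp add: Inl(1) k'(1) coord_def cocyc_def Yt)
  next
    case (Inr i)
    then show ?thesis
      using tilde_unit[OF reps_horizontal[OF k'(2)], of i] by (simp add: k'(1) coord_def cocyc_def Yt)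
  qed
next
  case k': (Inr j)
  show ?thesis
    using assms(1)
  proof (cases rule: index_cases)
    case (Inr i)
    then show ?thesis
      using assms(3) k'(1) homog_unit[of "E i" g] char_gt_2
      by (simp add: coord_def cocyc_def ebar_def unit_vector_def power_0_left)
  qed (simp add: k'(1) coord_def cocyc_def)
qed

lemma coord_kernel:
  assumes c: "c \<in> Z2_res g P" and zero: "\<And>k. k \<in> even_index \<union> odd_index \<Longrightarrow> coord k c = 0"
  shows "c \<in> B2_res g P"
proof -
  obtain \<phi> \<omega> where c_eq: "c = (\<phi>, \<omega>)"
    by (cases c)
  define s where "s = \<phi> (u (Y t)) (u (Y t))"
  \<comment> \<open>The value at \<open>zz\<close> clears the pair \<open>(Y t, Y t)\<close>. The
    value at \<open>dd\<close> clears \<open>\<omega> (u dd)\<close>, because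
    \<open>\<psi> (P (u dd))\<close> is
    \<open>l * \<psi> (u dd) + mu (2*m+2) * \<psi> (u zz)\<close>. The remaining values clear the
    row of \<open>dd\<close>. At \<open>Y k\<close> the quotient has denominator 0 and is 0; the row
    of \<open>dd\<close> vanishes there by the restricted cocycle condition.\<close>
  obtain \<psi> where \<psi>: "\<psi> \<in> C1 g" "\<And>b. b \<in> hbas m n t \<Longrightarrow> \<psi> (u b) =
      (if b = zz then s else if b = dd then (\<omega> (u dd) - mu (2*m+2) * s) / l else \<phi> (u dd) (u (sw b)) / ev b)"
    by (rule linear_form_of_basis[of "\<lambda>b. if b = zz then s
      else if b = dd then (\<omega> (u dd) - mu (2*m+2) * s) / l else \<phi> (u dd) (u (sw b)) / ev b"]) blast
  define c' where "c' = c - d1_res g P \<psi>"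
  have B: "d1_res g P \<psi> \<in> B2_res g P"
    using \<psi>(1) by (simp add: B2_res_def)
  have c'Z: "c' \<in> Z2_res g P"
    unfolding c'_def using B B2_Z2 c by (intro lin_closed_diff[OF Z2_res_lin_closed]) auto
  have c'zero: "coord k c' = 0" if "k \<in> even_index \<union> odd_index" for k
    using coord_add[of k c' "d1_res g P \<psi>"] zero[OF that] coord_B2[OF that B] by (simp add: c'_def)
  obtain \<phi>' \<omega>' where c'_eq: "c' = (\<phi>', \<omega>')"
    by (cases c')
  then have \<phi>': "\<phi>' x y = \<phi> x y - d1 g \<psi> x y" and \<omega>': "\<omega>' x = \<omega> x - ind1 g P \<psi> x" for x y
    by (auto simp: c'_def c_eq d1_res_def)
  have Z: "\<phi>' \<in> C2 g" "compatible g \<phi>' \<omega>'" "invariant \<phi>'" "\<And>k. k \<in> {1..t} \<Longrightarrow> \<phi>' (u (Y k)) (u dd) = 0"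
    using c'Z by (auto simp: c'_eq Z2_iff)
  have Yt: "\<phi>' (u (Y t)) (u (Y t)) = 0"
    using d1_unit[OF \<psi>(1) Yt_mem Yt_mem] t_pos \<psi>(2)[of zz] by (simp add: \<phi>' s_def)
  have dd: "\<phi>' (u dd) (u b) = 0" if b: "b \<in> hbas m n t" for b
  proof -
    consider "ev b \<noteq> 0" | "b = zz" | "b = dd" | k where "b = Y k"
      using ev_nonzero[OF b] by blast
    then show ?thesis
    proof cases
      case 1
      then have "b \<noteq> dd" "sw b \<noteq> zz" "sw b \<noteq> dd"
        by (metis ev_sw fixed_simps(7,8))+
      then have "d1 g \<psi> (u dd) (u b) = \<phi> (u dd) (u b)"
        using d1_unit[OF \<psi>(1) _ b, of dd] \<psi>(2)[of "sw b"] 1 b by simp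
      then show ?thesis
        by (simp add: \<phi>')
    next
      case 2
      then show ?thesis
        using invariant_zz(2)[OF Z(1,3), of "u dd"] by simp
    next
      case 3
      then show ?thesis
        using C2_diag_even[OF Z(1) even_u_dd] by simp
    next
      case (4 k)
      then show ?thesis
        using Z(4)[of k] b C2_unit_skew_zero[OF Z(1), of dd b] by simp
    qed
  qed
  have "\<phi>' = 0"
  proof (rule invariant_zero[OF Z(1,3) dd Yt])
    fix b b' assume bb: "(b, b') \<in> reps_even \<union> reps_odd"
    then have "Inl (b, b') \<in> even_index \<union> odd_index"
      by (auto simp: even_index_def odd_index_def)
    then show "\<phi>' (u b) (u b') = 0"
      using c'zero[of "Inl (b, b')"] Yt by (simp add: coord_def c'_eq)
  qed
  \<comment> \<open>Once the form is 0, the second component is determined by its values on the even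
    basis vectors, and all of these have been removed.\<close>
  moreover have "\<omega>' = 0"
  proof (rule compatible_unique_g)
    show "compatible g 0 \<omega>'"
      using Z(2) \<open>\<phi>' = 0\<close> by simp
    show "compatible g 0 0"
      by (rule compatible_zero)
    fix i assume i: "i \<in> {1..2*m+2}"
    show "\<omega>' (u (E i)) = 0 (u (E i))"
    proof (cases "i = 2 * m + 2")
      case False
      then have "Inr i \<in> even_index \<union> odd_index"
        using i by (auto simp: even_index_def)
      then show ?thesis
        using c'zero[of "Inr i"] Yt by (simp add: coord_def c'_eq)
    next
      case True
      have "\<psi> (P (u dd)) = l * \<psi> (u dd) + mu (2*m+2) * \<psi> (u zz)"
        unfolding P_dd using C1_linear[OF \<psi>(1)]
        by (simp add: linear_form_add[of g \<psi>] linear_form_scl[of g \<psi>] space_scl del: plus_fun_apply scl_simps(5))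
      then have "ind1 g P \<psi> (u dd) = \<omega> (u dd)"
        using \<psi>(2)[of dd] \<psi>(2)[of zz] l_nonzero even_u_dd by (simp add: ind1_def)
      then show ?thesis
        using True by (simp add: \<omega>' dd_def)
    qed
  qed
  ultimately have "c' = 0"
    by (simp add: c'_eq zero_prod_def)
  then show ?thesis
    using B by (simp add: c'_def)
qed

lemma reps_finite: "finite reps_even" "finite reps_odd"
proof -
  have "reps_even \<union> reps_odd \<subseteq> hbas m n t \<times> hbas m n t"
    using reps_props(1,2) by auto
  then have "finite (reps_even \<union> reps_odd)"
    by (rule finite_subset) simp
  then show "finite reps_even" "finite reps_odd"
    by simp_all
qed

lemma index_finite: "finite even_index" "finite odd_index"
  by (simp_all add: even_index_def odd_index_def reps_finite)

text \<open>Serves all cocycles, the even ones and the odd ones. The last hypothesis says that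
  coordinates outside \<open>I\<close> vanish on \<open>Z\<close>, so that those in \<open>I\<close>
  still detect coboundaries.\<close>

lemma dual_system:
  assumes "lin_closed Z" "Z \<subseteq> Z2_res g P" "I \<subseteq> even_index \<union> odd_index"
    and "\<And>k. k \<in> I \<Longrightarrow> cocyc k \<in> Z"
    and "\<And>c k. c \<in> Z \<Longrightarrow> k \<in> even_index \<union> odd_index \<Longrightarrow> k \<notin> I \<Longrightarrow> coord k c = 0"
  shows "quotient_dual_system Z (B2_res g P) I cocyc coord"
proof (rule quotient_dual_system.intro)
  show "lin_closed Z" "lin_closed (B2_res g P)"
    using assms(1) B2_res_lin_closed .
  have "finite (even_index \<union> odd_index)"
    using index_finite by (rule finite_UnI)
  with assms(3) show "finite I"
    by (rule finite_subset)
next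
  fix c assume c: "c \<in> Z" "\<And>k. k \<in> I \<Longrightarrow> coord k c = 0"
  show "c \<in> B2_res g P"
  proof (rule coord_kernel)
    show "c \<in> Z2_res g P"
      using c(1) assms(2) by (rule rev_subsetD)
    show "coord k c = 0" if "k \<in> even_index \<union> odd_index" for k
      using c(2)[of k] assms(5)[OF c(1) that] by (cases "k \<in> I") simp_all
  qed
next
  fix k assume k: "k \<in> I"
  then show "cocyc k \<in> Z"
    by (rule assms(4))
  have k': "k \<in> even_index \<union> odd_index"
    using k assms(3) by (rule rev_subsetD)
  show "coord k (cocyc k) \<noteq> 0"
    by (rule coord_diag[OF k'])
  show "coord k c = 0" if "c \<in> B2_res g P" for c
    by (rule coord_B2[OF k' that])
  show "coord k (cocyc j) = 0" if "j \<in> I" "k \<noteq> j" for j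
    by (rule coord_off[OF k' rev_subsetD[OF that(1) assms(3)] that(2)])
qed (rule coord_add coord_scl)+

lemma cocyc_Z2: "k \<in> even_index \<union> odd_index \<Longrightarrow> cocyc k \<in> Z2_res g P"
  using cocyc_mem cocycles_Z2 by blast

text \<open>The classes in the dual system already span and belong to listed cocycles. The other
  listed ones lie in the carrier and add nothing.\<close>

lemma span_cocycles:
  "LinearCombinations.module.span class_ring (H2_res g P) (H2_class g P ` heis_cocycles m n t lam kap)
    = carrier (H2_res g P)"
proof -
  interpret quotient_dual_system "Z2_res g P" "B2_res g P" "even_index \<union> odd_index" cocyc coord
    by (rule dual_system) (auto simp: Z2_res_lin_closed intro: cocyc_Z2)
  let ?C = "(\<lambda>c. c +o B2_res g P) ` heis_cocycles m n t lam kap"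
  have C: "?C \<subseteq> carrier (quotient_space (Z2_res g P) (B2_res g P))"
    using cocycles_Z2 coset_carrier by blast
  have "(\<lambda>k. cocyc k +o B2_res g P) ` (even_index \<union> odd_index) \<subseteq> ?C"
    using cocyc_mem by blast
  then have "carrier (quotient_space (Z2_res g P) (B2_res g P)) \<subseteq> span ?C"
    using span_is_monotone span_classes by blast
  then show ?thesis
    using span_is_subset2[OF C] unfolding H2_res_def H2_class_def by blast
qed

lemma hpar_homog: "b \<in> hbas m n t \<Longrightarrow> u b \<in> homog g (hpar b)"
  using homog_unit[of b g] by simp

lemma cocyc_even:
  assumes "k \<in> even_index"
  shows "cocyc k \<in> even_cochains g"
proof -
  have C: "cocyc k \<in> C2_res g"
    using cocyc_Z2[of k] assms by (simp add: Z2_res_iff)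
  have "k \<in> even_index \<union> odd_index"
    using assms by simp
  then show ?thesis
  proof (cases rule: index_cases)
    case (Inl b c)
    then have par: "hpar b = hpar c"
      using assms reps_even_par[of b c] by (auto simp: even_index_def)
    have "form b c x y = 0 \<and> form b c y x = 0" if h: "x \<in> homog g 0" "y \<in> homog g 1" for x y
    proof -
      have z: "x a * y a' = 0" "y a * x a' = 0" if "hpar a = hpar a'" for a a'
        using h that unfolding homog_def by force+
      note z' = z[OF par] z[OF par[symmetric]] z[of "sw b" "sw c"] z[of "sw c" "sw b"]
      show ?thesis
        unfolding form_eq[OF h[THEN homog_space]] form_eq[OF h(2,1)[THEN homog_space]]
        using z' par by (simp only: hpar_sw mult_zero_right diff_self simp_thms)
    qed
    then show ?thesis
      using C by (simp add: even_cochains_iff Inl(1) cocyc_def)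
  next
    case (Inr i)
    then show ?thesis
      using C by (simp add: even_cochains_iff cocyc_def)
  qed
qed

lemma cocyc_odd:
  assumes "k \<in> odd_index"
  shows "cocyc k \<in> odd_cochains g"
proof -
  have C: "cocyc k \<in> C2_res g"
    using cocyc_Z2[of k] assms by (simp add: Z2_res_iff)
  obtain b c where k: "k = Inl (b, c)" "(b, c) \<in> reps_odd"
    using assms by (auto simp: odd_index_def)
  have par: "hpar b = 0" "hpar c = 1"
    using reps_odd_par[OF k(2)] by simp_all
  have zero: "form b c x y = 0" if h: "x \<in> homog g i" "y \<in> homog g i" for x y i
  proof -
    have z: "x a * y a' = 0" if "hpar a \<noteq> hpar a'" for a a'
      using h that unfolding homog_def by force
    have "x b * y c = 0" "x c * y b = 0" "x (sw b) * y (sw c) = 0" "x (sw c) * y (sw b) = 0"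
      by (rule z; simp add: par)+
    then show ?thesis
      unfolding form_eq[OF h[THEN homog_space]] by (simp only: mult_zero_right diff_self)
  qed
  \<comment> \<open>The closed formula evaluates the form on two even arguments, where an odd form
    vanishes.\<close>
  have "tilde (form b c) h = 0" for h
    using zero[OF D_pow_homog[of h 0], of h] by (simp add: tilde_def)
  then show ?thesis
    using C zero by (simp add: odd_cochains_iff k(1) cocyc_def fun_eq_iff)
qed

text \<open>\<open>BB\<close> pairs only vectors of equal parity, so the correction by the value at
  \<open>(Y t, Y t)\<close> does not mix parities.\<close>

lemma coord_odd_index:
  assumes "c \<in> even_cochains g" "k \<in> odd_index"
  shows "coord k c = 0"
proof -
  obtain b b' where k: "k = Inl (b, b')" "(b, b') \<in> reps_odd"
    using assms(2) by (auto simp: odd_index_def)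
  have p: "b \<in> hbas m n t" "b' \<in> hbas m n t" "hpar b = 0" "hpar b' = 1"
    using reps_props(1,2)[of b b'] reps_odd_par[of b b'] k(2) by simp_all
  have "fst c (u b) (u b') = 0"
    using assms(1) hpar_homog[OF p(1)] hpar_homog[OF p(2)] p(3,4) by (simp add: even_cochains_iff)
  moreover have "BB (u b) (u b') = 0"
    using BB_unit[OF p(1), of b'] p(3,4) hpar_pr[of b] by auto
  ultimately show ?thesis
    by (simp add: coord_def k(1))
qed

lemma coord_even_index:
  assumes "c \<in> odd_cochains g" "k \<in> even_index"
  shows "coord k c = 0"
proof -
  have Yt: "fst c (u (Y t)) (u (Y t)) = 0"
    using assms(1) hpar_homog[OF Yt_mem] by (simp add: odd_cochains_iff)
  have "k \<in> even_index \<union> odd_index"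
    using assms by simp
  then show ?thesis
  proof (cases rule: index_cases)
    case (Inl b b')
    then have "hpar b = hpar b'" "b \<in> hbas m n t" "b' \<in> hbas m n t"
      using assms(2) reps_even_par[of b b'] reps_props(1,2)[of b b'] by (auto simp: even_index_def)
    moreover from this have "u b \<in> homog g (hpar b)" "u b' \<in> homog g (hpar b)"
      using hpar_homog[of b] hpar_homog[of b'] by simp_all
    moreover have "hpar b = 0 \<or> hpar b = 1"
      by (cases b) auto
    ultimately have "fst c (u b) (u b') = 0"
      using assms(1) unfolding odd_cochains_iff by metis
    then show ?thesis
      by (simp add: coord_def Inl(1) Yt)
  next
    case (Inr i)
    then show ?thesis
      using assms(1) by (simp add: coord_def Yt odd_cochains_iff)
  qed
qed

lemma dim_even: "vectorspace.dim class_ring (H2_res_even g P) = card even_index"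
proof -
  interpret quotient_dual_system "Z2_res g P \<inter> even_cochains g" "B2_res g P" even_index cocyc coord
    by (rule dual_system)
      (auto simp: lin_closed_Int Z2_res_lin_closed even_cochains_lin_closed
        intro: cocyc_Z2 cocyc_even coord_odd_index)
  show ?thesis
    unfolding H2_res_even_def by (rule dim_quotient)
qed

lemma dim_odd: "vectorspace.dim class_ring (H2_res_odd g P) = card odd_index"
proof -
  interpret quotient_dual_system "Z2_res g P \<inter> odd_cochains g" "B2_res g P" odd_index cocyc coord
    by (rule dual_system)
      (auto simp: lin_closed_Int Z2_res_lin_closed odd_cochains_lin_closed
        intro: cocyc_Z2 cocyc_odd coord_even_index)
  show ?thesis
    unfolding H2_res_odd_def by (rule dim_quotient)
qed

end

section \<open>Counting the classes\<close>

lemma card_pairs_less: "card {(i, j). 1 \<le> i \<and> i < j \<and> j \<le> (t::nat)} = t * (t - 1) div 2"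
proof -
  have "{(i, j). 1 \<le> i \<and> i < j \<and> j \<le> t} = (\<lambda>(j, i). (i, j)) ` (SIGMA j:{1..t}. {1..<j})"
    by force
  then have "card {(i, j). 1 \<le> i \<and> i < j \<and> j \<le> t} = card (SIGMA j:{1..t}. {1..<j})"
    by (simp only:) (rule card_image, auto simp: inj_on_def)
  also have "\<dots> = (\<Sum>j = 1..t. j - 1)"
    by simp
  also have "\<dots> = t * (t - 1) div 2"
  proof (induction t)
    case (Suc t)
    have "Suc t * (Suc t - 1) = t * (t - 1) + 2 * t"
      by (cases t) simp_all
    then show ?case
      using Suc by simp
  qed simp
  finally show ?thesis .
qed

lemma card_pairs_le:
  fixes R :: "nat \<Rightarrow> nat \<Rightarrow> bool"
  assumes "\<And>i. R i i"
  shows "card {(i, j). R i j \<and> 1 \<le> i \<and> i \<le> j \<and> j \<le> k} = card {(i, j). R i j \<and> 1 \<le> i \<and> i < j \<and> j \<le> k} + k"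
proof -
  let ?L = "{(i, j). R i j \<and> 1 \<le> i \<and> i < j \<and> j \<le> k}" and ?D = "(\<lambda>i. (i, i)) ` {1..k}"
  have "{(i, j). R i j \<and> 1 \<le> i \<and> i \<le> j \<and> j \<le> k} = ?L \<union> ?D"
    using assms by auto
  moreover have "finite ?L"
    by (rule finite_subset[of _ "{1..k} \<times> {1..k}"]) auto
  moreover have "card ?D = k"
    by (subst card_image) (auto simp: inj_on_def)
  ultimately show ?thesis
    by (simp only:) (subst card_Un_disjoint; auto)
qed

lemma card_pair_image:
  assumes "inj f" "inj h"
  shows "card {(f i, h j) | i j. Q i j} = card {(i, j). Q i j}"
proof -
  have "{(f i, h j) | i j. Q i j} = (\<lambda>(i, j). (f i, h j)) ` {(i, j). Q i j}"
    by auto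
  then show ?thesis
    using assms by (simp only:) (rule card_image, auto simp: inj_on_def dest: injD)
qed

context twisted_heisenberg
begin

lemma card_reps_even:
  "card reps_even = 2 * card {(i, j). eq_pm (lam i) (lam j) \<and> 1 \<le> i \<and> i < j \<and> j \<le> m} + m
    + (2 * card {(i, j). eq_pm (kap i) (kap j) \<and> 1 \<le> i \<and> i < j \<and> j \<le> n} + n)
    + (t - 1) + t * (t - 1) div 2"
proof -
  let ?S1 = "{(E i, E j) | i j. 1 \<le> i \<and> i < j \<and> j \<le> m \<and> eq_pm (lam i) (lam j)}"
  let ?S2 = "{(E i, E (m + j)) | i j. 1 \<le> i \<and> i \<le> j \<and> j \<le> m \<and> eq_pm (lam i) (lam j)}"
  let ?S3 = "{(W i, W j) | i j. 1 \<le> i \<and> i \<le> j \<and> j \<le> n \<and> eq_pm (kap i) (kap j)}"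
  let ?S4 = "{(W i, W (n + j)) | i j. 1 \<le> i \<and> i < j \<and> j \<le> n \<and> eq_pm (kap i) (kap j)}"
  let ?S5 = "{(Y i, Y i) | i. 1 \<le> i \<and> i \<le> t - 1}"
  let ?S6 = "{(Y i, Y j) | i j. 1 \<le> i \<and> i < j \<and> j \<le> t}"
  have inj: "inj E" "inj W" "inj Y" "inj (\<lambda>j. E (m + j))" "inj (\<lambda>j. W (n + j))"
    by (auto simp: inj_def)
  have perm: "{(i, j). A i \<and> B i j \<and> C j \<and> R i j} = {(i, j). R i j \<and> A i \<and> B i j \<and> C j}"
    for A C :: "nat \<Rightarrow> bool" and B R :: "nat \<Rightarrow> nat \<Rightarrow> bool"
    by auto
  have c: "card ?S1 = card {(i, j). eq_pm (lam i) (lam j) \<and> 1 \<le> i \<and> i < j \<and> j \<le> m}"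
    "card ?S2 = card {(i, j). eq_pm (lam i) (lam j) \<and> 1 \<le> i \<and> i < j \<and> j \<le> m} + m"
    "card ?S3 = card {(i, j). eq_pm (kap i) (kap j) \<and> 1 \<le> i \<and> i < j \<and> j \<le> n} + n"
    "card ?S4 = card {(i, j). eq_pm (kap i) (kap j) \<and> 1 \<le> i \<and> i < j \<and> j \<le> n}"
    "card ?S6 = t * (t - 1) div 2"
    unfolding card_pair_image[OF inj(1,1)] card_pair_image[OF inj(1,4)] card_pair_image[OF inj(2,2)]
      card_pair_image[OF inj(2,5)] card_pair_image[OF inj(3,3)] perm
    by (simp_all only: card_pairs_less card_pairs_le[of "\<lambda>i j. eq_pm (lam i) (lam j)", OF eq_pm_refl]
      card_pairs_le[of "\<lambda>i j. eq_pm (kap i) (kap j)", OF eq_pm_refl])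
  have c5: "card ?S5 = t - 1"
  proof -
    have "?S5 = (\<lambda>i. (Y i, Y i)) ` {1..t - 1}"
      by auto
    then show ?thesis
      by (simp only:) (subst card_image; simp add: inj_on_def)
  qed
  have fin: "finite reps_even"
    by (rule finite_subset[of _ "hbas m n t \<times> hbas m n t"]) (use reps_props(1,2) in auto)
  have sub: "finite ?S1" "finite ?S2" "finite ?S3" "finite ?S4" "finite ?S5" "finite ?S6"
    by (rule finite_subset[OF _ fin]; unfold reps_even_def; blast)+
  have disj: "?S1 \<inter> ?S2 = {}" "(?S1 \<union> ?S2) \<inter> ?S3 = {}" "(?S1 \<union> ?S2 \<union> ?S3) \<inter> ?S4 = {}"
    "(?S1 \<union> ?S2 \<union> ?S3 \<union> ?S4) \<inter> ?S5 = {}" "(?S1 \<union> ?S2 \<union> ?S3 \<union> ?S4 \<union> ?S5) \<inter> ?S6 = {}"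
    by auto
  show ?thesis
    unfolding reps_even_def
    using c c5 sub disj by (simp only: card_Un_disjoint finite_Un simp_thms)
qed

lemma card_reps_odd:
  "card reps_odd = 2 * card {(i, j). eq_pm (lam i) (kap j) \<and> 1 \<le> i \<and> i \<le> m \<and> 1 \<le> j \<and> j \<le> n}"
proof -
  let ?S1 = "{(E (m + i), W j) | i j. 1 \<le> i \<and> i \<le> m \<and> 1 \<le> j \<and> j \<le> n \<and> eq_pm (lam i) (kap j)}"
  let ?S2 = "{(E i, W j) | i j. 1 \<le> i \<and> i \<le> m \<and> 1 \<le> j \<and> j \<le> n \<and> eq_pm (lam i) (kap j)}"
  have inj: "inj E" "inj W" "inj (\<lambda>j. E (m + j))"
    by (auto simp: inj_def)
  have "{(i, j). 1 \<le> i \<and> i \<le> m \<and> 1 \<le> j \<and> j \<le> n \<and> eq_pm (lam i) (kap j)} =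
      {(i, j). eq_pm (lam i) (kap j) \<and> 1 \<le> i \<and> i \<le> m \<and> 1 \<le> j \<and> j \<le> n}"
    by auto
  then have c: "card ?S1 = card {(i, j). eq_pm (lam i) (kap j) \<and> 1 \<le> i \<and> i \<le> m \<and> 1 \<le> j \<and> j \<le> n}"
    "card ?S2 = card {(i, j). eq_pm (lam i) (kap j) \<and> 1 \<le> i \<and> i \<le> m \<and> 1 \<le> j \<and> j \<le> n}"
    unfolding card_pair_image[OF inj(3,2)] card_pair_image[OF inj(1,2)] by simp_all
  have fin: "finite reps_odd"
    by (rule finite_subset[of _ "hbas m n t \<times> hbas m n t"]) (use reps_props(1,2) in auto)
  have sub: "finite ?S1" "finite ?S2"
    by (rule finite_subset[OF _ fin]; unfold reps_odd_def; blast)+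
  have "?S1 \<inter> ?S2 = {}"
    by auto
  then show ?thesis
    unfolding reps_odd_def by (simp only: card_Un_disjoint[OF sub] c mult_2)
qed

end

context restricted_heisenberg
begin

lemma sdim_H2: "sdim_H2_res g P = (heis_d0 m n t lam kap, heis_d1 m n lam kap)"
proof -
  have "card even_index = card reps_even + (2 * m + 1)"
    unfolding even_index_def by (subst card_Plus) (simp_all add: reps_finite)
  \<comment> \<open>The summand 1 comes from the \<open>2 * m + 1\<close> classes of the
    \<open>ebar g i\<close>. The other \<open>2 * m\<close> of them join the \<open>m\<close>
    diagonal pairs \<open>(E i, E (m + i))\<close> to give \<open>3 * m\<close>.\<close>
  moreover have "(t - 1) + t * (t - 1) div 2 + 1 = t * (t + 1) div 2"
  proof -
    obtain q where q: "t = Suc q"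
      using t_pos by (cases t) auto
    have "t * (t + 1) = 2 * t + t * (t - 1)"
      by (simp add: q algebra_simps)
    then show ?thesis
      using q by simp
  qed
  ultimately have "card even_index = heis_d0 m n t lam kap"
    unfolding heis_d0_def card_reps_even by simp
  moreover have "card odd_index = heis_d1 m n lam kap"
    unfolding odd_index_def heis_d1_def card_reps_odd[symmetric] by (rule card_image) simp
  ultimately show ?thesis
    by (simp add: sdim_H2_res_def dim_even dim_odd)
qed

end

theorem theorem5p1:
  fixes lam kap mu :: "nat \<Rightarrow> 'f::alg_closed_field"
    and l :: 'f
    and m n t :: nat
    and P :: "(hindex \<Rightarrow> 'f) \<Rightarrow> (hindex \<Rightarrow> 'f)"
  assumes "CHAR('f) > 2"
    and "m \<ge> 1" and "n \<ge> 1" and "t \<ge> 1"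
    and "\<forall>i\<in>{1..m}. lam i \<noteq> 0" and "\<forall>j\<in>{1..n}. kap j \<noteq> 0"
    and "\<forall>i\<in>{1..m}. lam i ^ (CHAR('f) - 1) = l"
    and "\<forall>j\<in>{1..n}. kap j ^ (CHAR('f) - 1) = l"
    and "heis_restricted m n t lam kap mu l P"
  shows "heis_cocycles m n t lam kap \<subseteq> Z2_res (heis m n t lam kap) P \<and>
         LinearCombinations.module.span class_ring (H2_res (heis m n t lam kap) P)
           (H2_class (heis m n t lam kap) P ` heis_cocycles m n t lam kap)
         = carrier (H2_res (heis m n t lam kap) P) \<and>
         sdim_H2_res (heis m n t lam kap) P = (heis_d0 m n t lam kap, heis_d1 m n lam kap)"
proof -
  interpret restricted_heisenberg m n t lam kap l mu P
    using assms by unfold_locales auto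
  show ?thesis
    using cocycles_Z2 span_cocycles sdim_H2 by blast
qed

end
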